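(* There is an algorithm which, given an $n$-vertex graph $G$ with maximum degree $\Delta=\Delta(G)$ and minimum degree $\delta(G)\geq 8$, determines whether $G$ is $3$-colorable in time $O(1.3158^{\,n-0.7\Delta})$.
   Context: All graphs are finite and simple. A graph is $3$-colorable if its vertices can be assigned colors from a set of $3$ colors so that adjacent vertices receive different colors. $\Delta(G)$ and $\delta(G)$ denote the maximum and minimum vertex degree of $G$. *)

theory Defs
  imports Complex_Main "HOL-Library.Discrete_Functions" "Graph_Theory.Graph_Theory"
begin

section \<open>Simple graphs\<close>

text \<open>
  A finite simple graph is a \<open>pair_graph\<close>: a finite, symmetric, loop-free digraph without
  parallel arcs. Each edge is represented by its two opposite arcs, so the degree of a vertex is
  its out-degree. Minimum and maximum degree are meaningful only for nonempty finite graphs.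
\<close>

definition max_degree :: "'a pair_pre_digraph \<Rightarrow> nat" where
  "max_degree G = Max (out_degree (with_proj G) ` pverts G)"

definition min_degree :: "'a pair_pre_digraph \<Rightarrow> nat" where
  "min_degree G = Min (out_degree (with_proj G) ` pverts G)"

definition three_colorable :: "'a pair_pre_digraph \<Rightarrow> bool" where
  "three_colorable G \<longleftrightarrow>
     (\<exists>c :: 'a \<Rightarrow> nat. (\<forall>v \<in> pverts G. c v \<in> {0, 1, 2}) \<and> (\<forall>(u, v) \<in> parcs G. c u \<noteq> c v))"

section \<open>Random access machines with logarithmic cost\<close>

text \<open>
  Algorithms are structured programs for a random access machine. A program mentions finitely many
  registers by name; in addition there is a memory that is accessed indirectly, through addresses
  held in registers. All cells hold natural numbers of arbitrary size, and each operation is charged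
  the total number of bits of the numbers (and memory addresses) it handles. In this way huge
  numbers cannot be used to hide work, and a computation on numbers and addresses of \<open>O(log n)\<close> bits
  costs \<open>O(log n)\<close> times its number of operations.
\<close>

datatype binop = Plus | Minus | Times | Div

fun apply_binop :: "binop \<Rightarrow> nat \<Rightarrow> nat \<Rightarrow> nat" where
  "apply_binop Plus x y = x + y"
| "apply_binop Minus x y = x - y"
| "apply_binop Times x y = x * y"
| "apply_binop Div x y = x div y"

type_synonym reg = nat

datatype prog =
    Skip
  | Const reg nat
  | Op reg binop reg reg
  | Load reg reg
  | Store reg reg
  | Seq prog prog
  | If reg prog prog
  | While reg prog

type_synonym state = "(reg \<Rightarrow> nat) \<times> (nat \<Rightarrow> nat)"

text \<open>Length of the binary representation; 0 and 1 have length 1, since \<open>floor_log 0 = 0\<close>.\<close>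

definition bits :: "nat \<Rightarrow> nat" where
  "bits k = floor_log k + 1"

text \<open>
  \<open>exec p s t s'\<close>: started in state \<open>s\<close>, the program \<open>p\<close> halts in state \<open>s'\<close> after time \<open>t\<close>.
  A branch is taken, or a loop entered, if the tested register is nonzero.
\<close>

inductive exec :: "prog \<Rightarrow> state \<Rightarrow> nat \<Rightarrow> state \<Rightarrow> bool" where
  Skip: "exec Skip s 1 s"
| Const: "exec (Const r k) (R, M) (bits k) (R(r := k), M)"
| Op: "exec (Op r f a b) (R, M) (bits (R a) + bits (R b)) (R(r := apply_binop f (R a) (R b)), M)"
| Load: "exec (Load r a) (R, M) (bits (R a) + bits (M (R a))) (R(r := M (R a)), M)"
| Store: "exec (Store a r) (R, M) (bits (R a) + bits (R r)) (R, M(R a := R r))"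
| Seq: "exec p s t s' \<Longrightarrow> exec q s' u s'' \<Longrightarrow> exec (Seq p q) s (t + u) s''"
| IfTrue: "R r \<noteq> 0 \<Longrightarrow> exec p (R, M) t s' \<Longrightarrow> exec (If r p q) (R, M) (bits (R r) + t) s'"
| IfFalse: "R r = 0 \<Longrightarrow> exec q (R, M) t s' \<Longrightarrow> exec (If r p q) (R, M) (bits (R r) + t) s'"
| WhileFalse: "R r = 0 \<Longrightarrow> exec (While r p) (R, M) (bits (R r)) (R, M)"
| WhileTrue: "R r \<noteq> 0 \<Longrightarrow> exec p (R, M) t s' \<Longrightarrow> exec (While r p) s' u s'' \<Longrightarrow>
    exec (While r p) (R, M) (bits (R r) + t + u) s''"

inductive_cases exec_SkipE: "exec Skip s t s'"
inductive_cases exec_ConstE: "exec (Const r k) s t s'"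
inductive_cases exec_OpE: "exec (Op r f a b) s t s'"
inductive_cases exec_LoadE: "exec (Load r a) s t s'"
inductive_cases exec_StoreE: "exec (Store a r) s t s'"
inductive_cases exec_SeqE: "exec (Seq p q) s t s'"
inductive_cases exec_IfE: "exec (If r p q) s t s'"
inductive_cases exec_WhileE: "exec (While r p) s t s'"

lemma exec_deterministic:
  assumes "exec p s t s'" and "exec p s u s''"
  shows "t = u \<and> s' = s''"
  using assms
proof (induction arbitrary: u s'' rule: exec.induct)
  case Skip
  from Skip.prems show ?case by (rule exec_SkipE) simp
next
  case Const
  from Const.prems show ?case by (rule exec_ConstE) simp
next
  case Op
  from Op.prems show ?case by (rule exec_OpE) simp
next
  case Load
  from Load.prems show ?case by (rule exec_LoadE) simp
next
  case Store
  from Store.prems show ?case by (rule exec_StoreE) simp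
next
  case (Seq p s t s' q v s3)
  from Seq.prems show ?case
    by (rule exec_SeqE) (metis Seq.IH)
next
  case (IfTrue R r p M t s' q)
  from IfTrue.prems show ?case
    by (rule exec_IfE) (use IfTrue.hyps in \<open>auto dest: IfTrue.IH\<close>)
next
  case (IfFalse R r q M t s' p)
  from IfFalse.prems show ?case
    by (rule exec_IfE) (use IfFalse.hyps in \<open>auto dest: IfFalse.IH\<close>)
next
  case (WhileFalse R r p M)
  from WhileFalse.prems show ?case
    by (rule exec_WhileE) (use WhileFalse.hyps in simp_all)
next
  case (WhileTrue R r p M t s' v s3)
  from WhileTrue.prems show ?case
  proof (rule exec_WhileE)
    fix R' M' t' s1 u'
    assume s: "(R, M) = (R', M')" and u: "u = bits (R' r) + t' + u'"
      and body: "exec p (R', M') t' s1" and rest: "exec (While r p) s1 u' s''"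
    have "t = t' \<and> s' = s1" using WhileTrue.IH(1) body s by simp
    moreover from this have "v = u' \<and> s3 = s''" using WhileTrue.IH(2) rest by simp
    ultimately show ?thesis using s u by simp
  qed (use WhileTrue.hyps in simp_all)
qed

section \<open>Graphs as inputs\<close>

text \<open>
  With respect to a listing \<open>vs\<close> of its \<open>n\<close> vertices, a graph is presented by \<open>n\<close> in register 0
  and its adjacency matrix, row by row, in the memory cells \<open>0, \<dots>, n\<^sup>2 - 1\<close>. The answer is read
  off register 0: nonzero means yes.
\<close>

definition graph_input :: "'a pair_pre_digraph \<Rightarrow> 'a list \<Rightarrow> state" where
  "graph_input G vs = (let n = length vs in
     ((\<lambda>_. 0)(0 := n),
      \<lambda>a. if a < n * n \<and> (vs ! (a div n), vs ! (a mod n)) \<in> parcs G then 1 else 0))"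

definition accepting :: "state \<Rightarrow> bool" where
  "accepting s \<longleftrightarrow> fst s 0 \<noteq> 0"

end

theory Submission
  imports Defs
begin

text \<open>
  The algorithm is a depth-first search over list assignments with lists in \<open>{0,1,2}\<close>, propagated so
  that a vertex with one color left strikes it from its neighbors. Let \<open>m\<close> be the number of vertices
  with a full list. While some 2-list vertex has at least 3 full neighbors or some 3-list vertex has
  at least 4, branching on it costs \<open>2 T(m - 3)\<close> or \<open>3 T(m - 5)\<close>, both at most \<open>1.26 ^ m\<close>. Otherwise
  counting the edges between 3-list and 2-list vertices gives \<open>7 m \<le> 2 n\<close>, because all degrees are at
  least 8. Then color a vertex \<open>v\<close> with a largest list tentatively and let \<open>B\<close> be the propagated result. If no other full
  list shrinks to exactly two colors, \<open>B\<close> is as good as the original assignment. If exactly one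
  does, say at \<open>w\<close>, then either \<open>B\<close> is solvable or \<open>w\<close> gets its lost color, and each case fixes both
  \<open>v\<close> and \<open>w\<close>: \<open>2 T(m - 2)\<close>. If two or more do, the cost is \<open>T(m - 3) + T(m - 1)\<close>. These two are at
  most \<open>1.4656 ^ m\<close>, and \<open>1.26 ^ 5 * 1.4656 ^ 2 < 1.3158 ^ 7\<close>. A vertex of maximum degree \<open>\<Delta>\<close> is branched on
  first, which leaves \<open>m \<le> n - \<Delta> - 1\<close>.
\<close>

section \<open>List colorings and branching\<close>

text \<open>The number of full lists alone cannot count the iterations, because a step with a single
  successor may leave it unchanged. Such a step still removes a color, so the potential multiplies
  the exponential weight by one plus the total list size, at the price of a factor
  \<open>O(n)\<close>. This and all other polynomial factors, from propagation and from the
  logarithmic cost of operations, vanish in the end because the inequality behind 1.3158 is strict: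
  a geometric factor below 1 is left over and absorbs them. The coefficient 0.7 rests on
  \<open>1.3158 ^ 7 \<le> 1.26 ^ 10\<close>: each full list removed by the first branching saves a
  factor 1.26, which is at least \<open>1.3158 powr 0.7\<close>. On the machine, everything but the
  main loop consists of loops with exactly \<open>n\<close> rounds. The main loop runs exponentially
  often, so the size of the numbers it handles has to be controlled over the whole run.\<close>

locale list_coloring =
  fixes n :: nat and E :: "nat \<Rightarrow> nat \<Rightarrow> bool"
  assumes sym: "E v w \<Longrightarrow> E w v"
    and irrefl: "\<not> E v v"
    and deg: "v < n \<Longrightarrow> card {w. w < n \<and> E v w} \<ge> 8"
    and n_pos: "n > 0"
begin

definition nbrs :: "nat \<Rightarrow> nat set" where
  "nbrs v = {w. w < n \<and> E v w}"

definition sol :: "(nat \<Rightarrow> nat set) \<Rightarrow> (nat \<Rightarrow> nat) \<Rightarrow> bool" where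
  "sol A c \<longleftrightarrow> (\<forall>v<n. c v \<in> A v) \<and> (\<forall>v<n. \<forall>w<n. E v w \<longrightarrow> c v \<noteq> c w)"

definition solvable :: "(nat \<Rightarrow> nat set) \<Rightarrow> bool" where
  "solvable A \<longleftrightarrow> (\<exists>c. sol A c)"

definition size_sum :: "(nat \<Rightarrow> nat set) \<Rightarrow> nat" where
  "size_sum A = (\<Sum>v<n. card (A v))"

definition threes :: "(nat \<Rightarrow> nat set) \<Rightarrow> nat set" where
  "threes A = {v. v < n \<and> card (A v) = 3}"

text \<open>The full lists that survive one round of propagation; using them as the measure makes it
  unnecessary to propagate an assignment before it is put on the stack.\<close>

definition free_threes :: "(nat \<Rightarrow> nat set) \<Rightarrow> nat set" where
  "free_threes A = {v \<in> threes A. \<forall>u\<in>nbrs v. card (A u) \<noteq> 1}"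

text \<open>The fixpoints of propagation. Two adjacent vertices with the same single color violate
  the condition, so a fixpoint without empty lists has no conflict between vertices that are already
  decided.\<close>

definition stuck :: "(nat \<Rightarrow> nat set) \<Rightarrow> bool" where
  "stuck A \<longleftrightarrow> (\<forall>v<n. \<forall>w<n. E v w \<longrightarrow> card (A v) = 1 \<longrightarrow> A v \<inter> A w = {})"

definition lists :: "(nat \<Rightarrow> nat set) \<Rightarrow> bool" where
  "lists A \<longleftrightarrow> (\<forall>v<n. A v \<subseteq> {0,1,2})"

definition all_ne :: "(nat \<Rightarrow> nat set) \<Rightarrow> bool" where
  "all_ne A \<longleftrightarrow> (\<forall>v<n. A v \<noteq> {})"

text \<open>A relation instead of a function, so that the order of the strikes stays open. The last
  conjunct keeps fixpoints unchanged; it guarantees that the initial assignment, which has no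
  single-color list, reaches its first branching with all lists full.\<close>

definition propagated :: "(nat \<Rightarrow> nat set) \<Rightarrow> (nat \<Rightarrow> nat set) \<Rightarrow> bool" where
  "propagated C A \<longleftrightarrow> (\<forall>v<n. A v \<subseteq> C v) \<and> (\<forall>c. sol C c \<longrightarrow> sol A c) \<and> stuck A
     \<and> (stuck C \<longrightarrow> (\<forall>v<n. A v = C v))"

text \<open>The bonus for two-color lists gives both branching rules the same threshold: a score of
  at least 4 means three full neighbors for a two-color list and four for a full one. On the initial
  assignment the score is the degree.\<close>

definition score :: "(nat \<Rightarrow> nat set) \<Rightarrow> nat \<Rightarrow> nat" where
  "score A v = of_bool (card (A v) = 2) + card (nbrs v \<inter> threes A)"

text \<open>For a propagated \<open>B\<close> without empty lists obtained from \<open>A\<close>, these are the lists of \<open>A\<close> that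
  shrink from three colors to two.\<close>

definition partial :: "(nat \<Rightarrow> nat set) \<Rightarrow> (nat \<Rightarrow> nat set) \<Rightarrow> nat set" where
  "partial A B = {v. v < n \<and> B v \<noteq> A v \<and> card (B v) \<noteq> 1}"

definition maxdeg :: nat where
  "maxdeg = Max ((\<lambda>v. card (nbrs v)) ` {..<n})"

text \<open>The branching bound: growth rate 1.4656 for the last \<open>2 n / 7\<close> full lists and 1.26 for the
  others. Here \<open>1.26 ^ 3 \<ge> 2\<close> and \<open>1.26 ^ 5 \<ge> 3\<close>, while 1.4656 exceeds the real root of
  \<open>x ^ 3 = x ^ 2 + 1\<close> and the square root of 2.\<close>

definition bound :: "nat \<Rightarrow> real" where
  "bound m = (1.4656 / 1.26) ^ min m (2 * n div 7) * 1.26 ^ m"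

text \<open>The initial assignment is weighted separately, since only its first branching exploits the
  maximum degree; the factor 3 accounts for the three colors tried there.\<close>

definition weight :: "(nat \<Rightarrow> nat set) \<Rightarrow> real" where
  "weight A = (if \<forall>v<n. card (A v) = 3 then 3 * bound (n - maxdeg - 1) else bound (card (free_threes A)))"

text \<open>The weight accounts for the branching of the search tree, the other factor for the
  length of its paths, since every step removes at least one color.\<close>

definition potential :: "(nat \<Rightarrow> nat set) \<Rightarrow> real" where
  "potential A = (real (size_sum A) + 1) * weight A"

text \<open>One iteration replaces the stack entry \<open>C\<close> by \<open>Bs\<close>;
  \<open>acc\<close> says that it has found a solution. The 1 in the inequality pays for the
  iteration, so the initial potential bounds the number of iterations.\<close>

definition good_step :: "(nat \<Rightarrow> nat set) \<Rightarrow> bool \<Rightarrow> (nat \<Rightarrow> nat set) list \<Rightarrow> bool" where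
  "good_step C acc Bs \<longleftrightarrow> (solvable C \<longleftrightarrow> acc \<or> (\<exists>B\<in>set Bs. solvable B)) \<and>
     1 + (\<Sum>B\<leftarrow>Bs. potential B) \<le> potential C"

section \<open>Elementary facts on lists, solutions and propagation\<close>

lemma finite_nbrs [simp]: "finite (nbrs v)" by (simp add: nbrs_def)
lemma finite_threes [simp]: "finite (threes A)" by (simp add: threes_def)
lemma finite_free [simp]: "finite (free_threes A)" by (simp add: free_threes_def)
lemma finite_partial [simp]: "finite (partial A B)" by (simp add: partial_def)

lemma card_subset3: "X \<subseteq> {0,1,2::nat} \<Longrightarrow> card X \<le> 3 \<and> finite X"
  using card_mono[of "{0,1,2::nat}" X] finite_subset[of X "{0,1,2}"] by auto

lemma lists_card: "lists A \<Longrightarrow> v < n \<Longrightarrow> card (A v) \<le> 3" "lists A \<Longrightarrow> v < n \<Longrightarrow> finite (A v)"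
  using card_subset3 by (auto simp: lists_def)

lemma lists_card3: "lists A \<Longrightarrow> v < n \<Longrightarrow> card (A v) = 3 \<Longrightarrow> A v = {0,1,2}"
  by (rule card_subset_eq) (auto simp: lists_def)

lemma sol_mono: "sol A c \<Longrightarrow> \<forall>v<n. A v \<subseteq> B v \<Longrightarrow> sol B c"
  by (auto simp: sol_def)

lemma propagated_sol: "propagated C A \<Longrightarrow> sol C c \<longleftrightarrow> sol A c"
  using sol_mono by (auto simp: propagated_def)

lemma propagated_solvable: "propagated C A \<Longrightarrow> solvable C \<longleftrightarrow> solvable A"
  by (simp add: solvable_def propagated_sol)

section \<open>Estimates for the branching bound\<close>

lemma bound_ge1: "bound m \<ge> 1"
proof -
  have "(1::real) \<le> (1.4656 / 1.26) ^ min m (2 * n div 7)" "(1::real) \<le> 1.26 ^ m"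
    by (auto intro!: one_le_power)
  from mult_mono[OF this] show ?thesis by (simp add: bound_def)
qed

text \<open>The capped factor is monotone in \<open>m\<close>, so each further full list is worth at
  least 1.26 whatever the cap.\<close>

lemma bound_drop: "bound (m + k) \<ge> 1.26 ^ k * bound m"
proof -
  have "(1.4656 / 1.26) ^ min m (2 * n div 7) \<le> (1.4656 / 1.26 :: real) ^ min (m+k) (2 * n div 7)"
    by (intro power_increasing) auto
  hence "(1.4656 / 1.26) ^ min m (2 * n div 7) * (1.26 ^ m * 1.26 ^ k)
     \<le> (1.4656 / 1.26 :: real) ^ min (m+k) (2 * n div 7) * (1.26 ^ m * 1.26 ^ k)"
    by (rule mult_right_mono) auto
  thus ?thesis unfolding bound_def power_add by (simp add: mult_ac)
qed

lemma bound_mono: "a \<le> b \<Longrightarrow> bound a \<le> bound b"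
proof -
  assume "a \<le> b"
  then obtain k where k: "b = a + k" using le_Suc_ex by blast
  have "1 * bound a \<le> 1.26 ^ k * bound a"
    by (intro mult_right_mono one_le_power) (use bound_ge1[of a] in auto)
  thus ?thesis using bound_drop[of k a] k by simp
qed

text \<open>\<open>1.26 ^ 3 = 2.000376\<close>: the base is the cube root of 2 rounded up, and this
  is the branching that dictates it.\<close>

lemma bound_branch2: assumes "a + 3 \<le> m" shows "2 * bound a \<le> bound m"
proof -
  have "2 * bound a \<le> 1.26 ^ 3 * bound a"
    by (intro mult_right_mono) (use bound_ge1[of a] in \<open>auto simp: power3_eq_cube\<close>)
  thus ?thesis using bound_drop[of 3 a] bound_mono[OF assms] by simp
qed

lemma bound_branch3: assumes "a + 5 \<le> m" shows "3 * bound a \<le> bound m"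
proof -
  have "3 * bound a \<le> 1.26 ^ 5 * bound a"
    by (intro mult_right_mono) (use bound_ge1[of a] in \<open>auto simp: eval_nat_numeral\<close>)
  thus ?thesis using bound_drop[of 5 a] bound_mono[OF assms] by simp
qed

text \<open>Below the cap both powers have exponent \<open>m\<close>, and the factors 1.26
  cancel.\<close>

lemma bound_small: "7 * m \<le> 2 * n \<Longrightarrow> bound m = 1.4656 ^ m"
proof -
  assume "7 * m \<le> 2 * n"
  hence "min m (2 * n div 7) = m" by linarith
  thus ?thesis unfolding bound_def by (simp flip: power_mult_distrib)
qed

lemma bound_sum22:
  assumes "7 * m \<le> 2 * n" "a + 2 \<le> m" "b + 2 \<le> m" shows "bound a + bound b \<le> bound m"
proof -
  obtain k where k: "m = k + 2" using assms(2) by (metis add.commute le_Suc_ex add_leD2)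
  have "bound a \<le> bound k" "bound b \<le> bound k" using assms k by (auto intro!: bound_mono)
  moreover have "2 * bound k \<le> bound m"
    using assms k by (simp add: bound_small power_add power2_eq_square)
  ultimately show ?thesis by linarith
qed

lemma bound_sum31:
  assumes "7 * m \<le> 2 * n" "a + 3 \<le> m" "b + 1 \<le> m" shows "bound a + bound b \<le> bound m"
proof -
  obtain k where k: "m = k + 3" using assms(2) by (metis add.commute le_Suc_ex add_leD2)
  have "bound a \<le> bound k" "bound b \<le> bound (k+2)" using assms k by (auto intro!: bound_mono)
  moreover have "bound k + bound (k+2) \<le> bound m"
    using assms k by (simp add: bound_small power_add power2_eq_square power3_eq_cube)
  ultimately show ?thesis by linarith
qed

section \<open>Weight and potential under shrinking lists\<close>

lemma weight_ge1: "weight A \<ge> 1"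
  using bound_ge1[of "n - maxdeg - 1"] bound_ge1[of "card (free_threes A)"] unfolding weight_def by auto

lemma potential_ge1: "potential A \<ge> 1"
proof -
  have "1 * 1 \<le> (real (size_sum A) + 1) * weight A"
    by (rule mult_mono) (use weight_ge1 in auto)
  thus ?thesis by (simp add: potential_def)
qed

text \<open>A child has a smaller size sum, so its factor \<open>size_sum B + 1\<close> is at most
  \<open>size_sum C\<close>. The parent has one more \<open>weight C\<close> than that, which is at
  least 1 and pays for the step.\<close>

lemma potential_step:
  assumes "\<forall>B\<in>set Bs. size_sum B < size_sum C" "(\<Sum>B\<leftarrow>Bs. weight B) \<le> weight C"
  shows "1 + (\<Sum>B\<leftarrow>Bs. potential B) \<le> potential C"
proof -
  have "(\<Sum>B\<leftarrow>Bs. potential B) \<le> (\<Sum>B\<leftarrow>Bs. real (size_sum C) * weight B)"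
    unfolding potential_def
    by (intro sum_list_mono mult_right_mono) (use assms(1) order_trans[OF zero_le_one weight_ge1] in \<open>force+\<close>)
  also have "\<dots> = real (size_sum C) * (\<Sum>B\<leftarrow>Bs. weight B)" by (simp add: sum_list_const_mult)
  also have "\<dots> \<le> real (size_sum C) * weight C" by (intro mult_left_mono assms) auto
  finally show ?thesis using weight_ge1[of C] by (simp add: potential_def algebra_simps)
qed

lemma size_sum_less:
  assumes "lists C" "\<forall>v<n. B v \<subseteq> C v" "u < n" "B u \<noteq> C u"
  shows "size_sum B < size_sum C"
  unfolding size_sum_def
proof (rule sum_strict_mono_ex1)
  show "\<forall>v\<in>{..<n}. card (B v) \<le> card (C v)"
    using assms lists_card by (auto intro!: card_mono)
  show "\<exists>v\<in>{..<n}. card (B v) < card (C v)"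
    using assms lists_card by (intro bexI[of _ u] psubset_card_mono) auto
qed auto

lemma size_sum_le:
  assumes "lists C" "\<forall>v<n. B v \<subseteq> C v" shows "size_sum B \<le> size_sum C"
  unfolding size_sum_def using assms lists_card by (auto intro!: card_mono sum_mono)

lemma propagated_subset: "propagated C A \<Longrightarrow> v < n \<Longrightarrow> A v \<subseteq> C v"
  by (simp add: propagated_def)

lemma propagated_lists: "propagated C A \<Longrightarrow> lists C \<Longrightarrow> lists A"
  by (fastforce simp: propagated_def lists_def)

text \<open>A single-color list that does not become empty survives propagation and meets every full
  list. So a list that is still full at the fixpoint had no single-color neighbor to begin
  with.\<close>

lemma propagated_threes:
  assumes "propagated C A" "lists C" "all_ne A"
  shows "threes A \<subseteq> free_threes C"
proof
  fix v assume v: "v \<in> threes A"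
  hence vn: "v < n" and cA: "card (A v) = 3" by (auto simp: threes_def)
  have lA: "lists A" using assms propagated_lists by blast
  have Av: "A v = {0,1,2}" using lists_card3[OF lA vn cA] .
  have sub: "A v \<subseteq> C v" using assms(1) vn by (simp add: propagated_def)
  have "card (C v) = 3"
    using card_mono[OF lists_card(2)[OF assms(2) vn] sub] lists_card(1)[OF assms(2) vn] cA by simp
  moreover have "card (C u) \<noteq> 1" if "u \<in> nbrs v" for u
  proof
    assume c1: "card (C u) = 1"
    have un: "u < n" and e: "E u v" using that sym[of v u] by (auto simp: nbrs_def)
    have "A u \<subseteq> C u" "A u \<noteq> {}" using assms un by (auto simp: propagated_def all_ne_def)
    hence eq: "A u = C u" using c1 by (metis card_1_singletonE subset_singletonD)
    have "stuck A" using assms(1) by (simp add: propagated_def)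
    moreover have "card (A u) = 1" using eq c1 by simp
    ultimately have "A u \<inter> A v = {}" using e un vn unfolding stuck_def by blast
    moreover have "A u \<subseteq> {0,1,2}" using lA un by (simp add: lists_def)
    ultimately show False using Av \<open>A u \<noteq> {}\<close> by auto
  qed
  ultimately show "v \<in> free_threes C" using vn by (auto simp: free_threes_def threes_def)
qed

text \<open>Lists have at most three colors, so an assignment with a smaller size sum than another
  one cannot be full everywhere. The special weight therefore never applies to a child.\<close>

lemma weight_nonfull:
  assumes "lists C" "size_sum B < size_sum C"
  shows "weight B = bound (card (free_threes B))"
proof -
  have "\<not> (\<forall>v<n. card (B v) = 3)"
  proof
    assume "\<forall>v<n. card (B v) = 3"
    hence "size_sum C \<le> size_sum B"
      unfolding size_sum_def using lists_card(1)[OF assms(1)] by (intro sum_mono) auto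
    thus False using assms by simp
  qed
  thus ?thesis by (auto simp: weight_def)
qed

lemma weight_child_le:
  assumes "lists C" "size_sum B < size_sum C" "card (free_threes B) \<le> k"
  shows "weight B \<le> bound k"
  using weight_nonfull[OF assms(1,2)] bound_mono[OF assms(3)] by simp

text \<open>Double counting of the edges between 3-list and 2-list vertices: a 3-list vertex has at least
  five 2-list neighbors, a 2-list vertex at most two 3-list neighbors.\<close>

lemma score_count:
  assumes "lists A" "all_ne A" "stuck A"
    and "\<And>v. v < n \<Longrightarrow> card (A v) \<ge> 2 \<Longrightarrow> score A v \<le> 3"
  shows "7 * card (threes A) \<le> 2 * n"
proof -
  define X where "X = threes A"
  define Y where "Y = {v. v < n \<and> card (A v) = 2}"
  have fin: "finite X" "finite Y" by (auto simp: X_def Y_def)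
  have dis: "X \<inter> Y = {}" by (auto simp: X_def Y_def threes_def)
  have XY: "card X + card Y \<le> n"
  proof -
    have "card (X \<union> Y) \<le> card {..<n}" by (intro card_mono) (auto simp: X_def Y_def threes_def)
    thus ?thesis using card_Un_disjoint[OF fin dis] by simp
  qed
  have five: "5 \<le> card (nbrs v \<inter> Y)" if "v \<in> X" for v
  proof -
    have vn: "v < n" and c3: "card (A v) = 3" using that by (auto simp: X_def threes_def)
    have Av: "A v = {0,1,2}" by (rule lists_card3[OF assms(1) vn c3])
    have "nbrs v \<subseteq> (nbrs v \<inter> X) \<union> (nbrs v \<inter> Y)"
    proof
      fix w assume w: "w \<in> nbrs v"
      hence wn: "w < n" and e: "E w v" using sym[of v w] by (auto simp: nbrs_def)
      have Aw: "A w \<subseteq> {0,1,2}" "A w \<noteq> {}" "card (A w) \<le> 3" "finite (A w)"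
        using assms(1,2) wn lists_card[OF assms(1) wn] by (simp_all add: lists_def all_ne_def)
      \<comment> \<open>A full list meets every nonempty list, so at a fixpoint no neighbor of
        \<open>v\<close> has a single color.\<close>
      have "A w \<inter> A v \<noteq> {}" using Av Aw by auto
      hence "card (A w) \<noteq> 1" using assms(3) e wn vn unfolding stuck_def by blast
      moreover have "card (A w) \<noteq> 0" using Aw by auto
      ultimately have "card (A w) = 2 \<or> card (A w) = 3" using Aw(3) by linarith
      thus "w \<in> (nbrs v \<inter> X) \<union> (nbrs v \<inter> Y)"
        using w wn by (auto simp: X_def Y_def threes_def)
    qed
    hence "card (nbrs v) \<le> card ((nbrs v \<inter> X) \<union> (nbrs v \<inter> Y))" by (intro card_mono finite_UnI finite_Int disjI1 finite_nbrs)
    also have "\<dots> \<le> card (nbrs v \<inter> X) + card (nbrs v \<inter> Y)" by (rule card_Un_le)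
    finally have "8 \<le> card (nbrs v \<inter> X) + card (nbrs v \<inter> Y)"
      using deg[OF vn] by (simp add: nbrs_def)
    moreover have "card (nbrs v \<inter> X) \<le> 3"
      using assms(4)[OF vn] c3 by (simp add: score_def X_def)
    ultimately show ?thesis by linarith
  qed
  have two: "card (nbrs w \<inter> X) \<le> 2" if "w \<in> Y" for w
    using assms(4)[of w] that by (auto simp: score_def X_def Y_def)
  have "5 * card X = (\<Sum>v\<in>X. 5)" by simp
  also have "\<dots> \<le> (\<Sum>v\<in>X. card (nbrs v \<inter> Y))" by (intro sum_mono five)
  also have "\<dots> = (\<Sum>v\<in>X. \<Sum>w\<in>Y. of_bool (E v w))"
  proof (intro sum.cong refl)
    fix v assume "v \<in> X"
    have "nbrs v \<inter> Y = {w \<in> Y. E v w}" by (auto simp: nbrs_def Y_def)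
    thus "card (nbrs v \<inter> Y) = (\<Sum>w\<in>Y. of_bool (E v w))"
      using fin by (simp add: of_bool_def sum.If_cases Int_def)
  qed
  also have "\<dots> = (\<Sum>w\<in>Y. \<Sum>v\<in>X. of_bool (E v w))" by (rule sum.swap)
  also have "\<dots> = (\<Sum>w\<in>Y. card (nbrs w \<inter> X))"
  proof (intro sum.cong refl)
    fix w assume "w \<in> Y"
    have "nbrs w \<inter> X = {v \<in> X. E v w}" using sym by (auto simp: nbrs_def X_def threes_def)
    thus "(\<Sum>v\<in>X. of_bool (E v w)) = card (nbrs w \<inter> X)"
      using fin by (simp add: of_bool_def sum.If_cases Int_def)
  qed
  also have "\<dots> \<le> (\<Sum>w\<in>Y. 2)" by (intro sum_mono two)
  finally have "5 * card X \<le> 2 * card Y" by simp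
  with XY show ?thesis by (simp add: X_def)
qed

text \<open>Ensures that \<open>n * n\<close> passes of propagation outnumber the
  \<open>3 * n\<close> colors that can be struck.\<close>

lemma n_ge: "n \<ge> 8"
proof -
  have "card (nbrs 0) \<le> card {..<n}" by (intro card_mono) (auto simp: nbrs_def)
  thus ?thesis using deg[OF n_pos] by (simp add: nbrs_def)
qed

section \<open>Dead ends, acceptance, and branching on a vertex of high score\<close>

lemma good_dead:
  assumes "propagated C A" "\<not> all_ne A" shows "good_step C False []"
proof -
  have "\<not> solvable A" using assms(2) by (auto simp: solvable_def sol_def all_ne_def)
  thus ?thesis using propagated_solvable[OF assms(1)] potential_ge1[of C] by (simp add: good_step_def)
qed

text \<open>All lists are singletons, and a fixpoint has disjoint singletons on adjacent vertices,
  so the lists themselves are a coloring.\<close>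

lemma good_accept:
  assumes "propagated C A" "all_ne A" "\<And>v. v < n \<Longrightarrow> card (A v) \<le> 1" "lists C"
  shows "good_step C True []"
proof -
  have lA: "lists A" using assms propagated_lists by blast
  have s: "\<exists>a. A v = {a}" if "v < n" for v
  proof -
    have "card (A v) \<noteq> 0" using assms(2) that lists_card(2)[OF lA that] by (auto simp: all_ne_def)
    hence "card (A v) = 1" using assms(3)[OF that] by linarith
    thus ?thesis by (meson card_1_singletonE)
  qed
  have "sol A (\<lambda>v. the_elem (A v))"
    unfolding sol_def
  proof (intro conjI allI impI)
    fix v assume "v < n" thus "the_elem (A v) \<in> A v" using s by force
  next
    fix v w assume vw: "v < n" "w < n" "E v w"
    obtain a b where "A v = {a}" "A w = {b}" using s[OF vw(1)] s[OF vw(2)] by blast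
    moreover have "stuck A" using assms(1) by (simp add: propagated_def)
    moreover have "card (A v) = 1" using \<open>A v = {a}\<close> by simp
    ultimately have "A v \<inter> A w = {}" using vw unfolding stuck_def by blast
    thus "the_elem (A v) \<noteq> the_elem (A w)"
      using \<open>A v = {a}\<close> \<open>A w = {b}\<close> by auto
  qed
  hence "solvable C" using propagated_sol[OF assms(1)] by (auto simp: solvable_def)
  thus ?thesis using potential_ge1[of C] by (simp add: good_step_def)
qed

lemma solvable_branch:
  assumes "v < n" "lists A"
  shows "solvable A \<longleftrightarrow> (\<exists>a\<in>A v. solvable (A(v := {a})))"
proof
  assume "solvable A"
  then obtain c where c: "sol A c" by (auto simp: solvable_def)
  hence "c v \<in> A v" "sol (A(v := {c v})) c" using assms by (auto simp: sol_def)
  thus "\<exists>a\<in>A v. solvable (A(v := {a}))" by (auto simp: solvable_def)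
next
  assume "\<exists>a\<in>A v. solvable (A(v := {a}))"
  then obtain a c where "a \<in> A v" "sol (A(v := {a})) c" by (auto simp: solvable_def)
  hence "sol A c" by (intro sol_mono[of "A(v := {a})" c A]) auto
  thus "solvable A" by (auto simp: solvable_def)
qed

text \<open>Once \<open>v\<close> has a single color, all its full neighbors drop out of
  \<open>free_threes\<close> without any propagation, and so does \<open>v\<close> itself if its
  list was full.\<close>

lemma good_branch:
  assumes p: "propagated C A" and "lists C" and ne: "all_ne A"
    and v: "v < n" "card (A v) \<ge> 2" "score A v \<ge> 4"
    and mx: "\<And>w. w < n \<Longrightarrow> card (A w) \<ge> 2 \<Longrightarrow> score A w \<le> score A v"
  shows "good_step C False (map (\<lambda>a. A(v := {a})) (filter (\<lambda>a. a \<in> A v) [0,1,2]))"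
proof -
  let ?Bs = "map (\<lambda>a. A(v := {a})) (filter (\<lambda>a. a \<in> A v) [0,1,2])"
  have lA: "lists A" using assms propagated_lists by blast
  have Av: "A v \<subseteq> {0,1,2}" "card (A v) \<le> 3" using lA v lists_card by (auto simp: lists_def)
  have sv: "solvable C \<longleftrightarrow> (\<exists>B\<in>set ?Bs. solvable B)"
    unfolding propagated_solvable[OF p] solvable_branch[OF v(1) lA] using Av by auto
  have sz: "size_sum B < size_sum C" if "B \<in> set ?Bs" for B
  proof -
    obtain a where a: "a \<in> A v" "B = A(v := {a})" using \<open>B \<in> set ?Bs\<close> by (force split: if_splits)
    have "size_sum B < size_sum A"
      by (rule size_sum_less[OF lA _ v(1)]) (use a v in \<open>auto dest: HOL.sym[of "{a}"]\<close>)
    also have "\<dots> \<le> size_sum C" by (rule size_sum_le[OF \<open>lists C\<close>]) (use p in \<open>simp add: propagated_def\<close>)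
    finally show ?thesis .
  qed
  define d where "d = card (nbrs v \<inter> threes A)"
  have fr: "card (free_threes B) + d + of_bool (card (A v) = 3) \<le> card (threes A)" if "B \<in> set ?Bs" for B
  proof -
    obtain a where a: "a \<in> A v" "B = A(v := {a})" using \<open>B \<in> set ?Bs\<close> by (force split: if_splits)
    have "free_threes B \<subseteq> threes A - nbrs v - {v}"
    proof
      fix w assume w: "w \<in> free_threes B"
      hence "w \<noteq> v" using a by (auto simp: free_threes_def threes_def)
      moreover have "w \<notin> nbrs v"
      proof
        assume "w \<in> nbrs v"
        hence "v \<in> nbrs w" using sym[of v w] v(1) by (simp add: nbrs_def)
        moreover have "card (B v) = 1" using a by simp
        ultimately show False using w by (auto simp: free_threes_def)
      qed
      ultimately show "w \<in> threes A - nbrs v - {v}" using w a by (simp add: free_threes_def threes_def)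
    qed
    hence 1: "card (free_threes B) \<le> card (threes A - (nbrs v \<inter> threes A) - {v})"
      by (intro card_mono) auto
    have 2: "card (threes A - (nbrs v \<inter> threes A)) + d = card (threes A)"
      unfolding d_def using card_mono[of "threes A" "nbrs v \<inter> threes A"] by (subst card_Diff_subset) auto
    have "card (threes A - (nbrs v \<inter> threes A) - {v}) + of_bool (card (A v) = 3) \<le> card (threes A - (nbrs v \<inter> threes A))"
    proof (cases "card (A v) = 3")
      case True
      hence "v \<in> threes A - (nbrs v \<inter> threes A)" using v irrefl by (auto simp: threes_def nbrs_def)
      from card.remove[OF _ this] show ?thesis using True by simp
    qed (auto intro!: card_mono)
    with 1 2 show ?thesis by linarith
  qed
  have len: "length ?Bs = card (A v)"
  proof -
    have "set (filter (\<lambda>a. a \<in> A v) [0,1,2]) = A v" using Av by auto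
    moreover have "distinct (filter (\<lambda>a. a \<in> A v) [0,1,2])" by (rule distinct_filter) simp
    ultimately show ?thesis unfolding length_map by (metis distinct_card)
  qed
  have sumc: "(\<Sum>B\<leftarrow>?Bs. x) = real (card (A v)) * x" for x :: real
    unfolding sum_list_triv len ..
  have W: "(\<Sum>B\<leftarrow>?Bs. weight B) \<le> weight C"
  proof (cases "\<forall>v<n. card (C v) = 3")
    case True
    \<comment> \<open>This is the initial assignment. Propagation leaves it alone and scores are
      degrees, so the maximality of \<open>v\<close> makes it a vertex of maximum degree; its three
      children share the factor 3 in the weight.\<close>
    have "stuck C" using True by (auto simp: stuck_def)
    hence eq: "\<forall>v<n. A v = C v" using p by (auto simp: propagated_def)
    have tA: "threes A = {..<n}" using eq True by (auto simp: threes_def)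
    have sc: "score A w = card (nbrs w)" if "w < n" for w
      using eq True that tA by (auto simp: score_def nbrs_def intro!: arg_cong[of _ _ card])
    have "maxdeg \<in> (\<lambda>v. card (nbrs v)) ` {..<n}"
      unfolding maxdeg_def using n_pos by (intro Max_in) auto
    then obtain w where "w < n" "maxdeg = card (nbrs w)" by auto
    hence "maxdeg \<le> score A v" using mx[of w] sc eq True by simp
    moreover have "score A v = d" using eq True v by (simp add: score_def d_def)
    ultimately have d: "d \<ge> maxdeg" by simp
    have "weight B \<le> bound (n - maxdeg - 1)" if "B \<in> set ?Bs" for B
      by (rule weight_child_le[OF \<open>lists C\<close> sz[OF that]]) (use fr[OF that] d tA v eq True in auto)
    hence "(\<Sum>B\<leftarrow>?Bs. weight B) \<le> (\<Sum>B\<leftarrow>?Bs. bound (n - maxdeg - 1))"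
      by (intro sum_list_mono) blast
    also have "\<dots> = real (card (A v)) * bound (n - maxdeg - 1)" by (rule sumc)
    also have "\<dots> = weight C" using eq True v by (simp add: weight_def)
    finally show ?thesis .
  next
    case False
    have CA: "card (threes A) \<le> card (free_threes C)"
      by (intro card_mono propagated_threes assms) auto
    have B: "weight B \<le> bound (card (threes A) - (d + of_bool (card (A v) = 3)))"
      if "B \<in> set ?Bs" for B
      by (rule weight_child_le[OF \<open>lists C\<close> sz[OF that]]) (use fr[OF that] in auto)
    have ex: "?Bs \<noteq> []"
    proof
      assume "?Bs = []"
      thus False using len v(2) by (simp only: list.size)
    qed
    \<comment> \<open>Any child yields this inequality, which keeps the natural subtractions below
      from being truncated; it is the reason for exhibiting a child.\<close>
    have le: "d + of_bool (card (A v) = 3) \<le> card (threes A)"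
      using fr[OF hd_in_set[OF ex]] by linarith
    have "(\<Sum>B\<leftarrow>?Bs. weight B) \<le> (\<Sum>B\<leftarrow>?Bs. bound (card (threes A) - (d + of_bool (card (A v) = 3))))"
      by (intro sum_list_mono) (use B in blast)
    also have "\<dots> = real (card (A v)) * bound (card (threes A) - (d + of_bool (card (A v) = 3)))"
      by (rule sumc)
    also have "\<dots> \<le> bound (card (threes A))"
    proof (cases "card (A v) = 3")
      case True
      hence "d \<ge> 4" using v by (simp add: score_def d_def)
      thus ?thesis using True le by (auto intro!: bound_branch3)
    next
      case False
      hence "card (A v) = 2" using v Av by linarith
      moreover hence "d \<ge> 3" using v by (simp add: score_def d_def)
      ultimately show ?thesis using le by (auto intro!: bound_branch2)
    qed
    also have "\<dots> \<le> bound (card (free_threes C))" by (rule bound_mono[OF CA])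
    also have "\<dots> = weight C" using False by (auto simp: weight_def)
    finally show ?thesis .
  qed
  show ?thesis unfolding good_step_def using sv potential_step[OF _ W] sz by blast
qed

section \<open>Tentative coloring of a vertex with a largest list when all scores are at most
  3\<close>

context
  fixes C A B :: "nat \<Rightarrow> nat set" and v a :: nat
  assumes CA: "propagated C A" and lC: "lists C" and neA: "all_ne A"
    and low: "\<And>w. w < n \<Longrightarrow> card (A w) \<ge> 2 \<Longrightarrow> score A w \<le> 3"
    and v: "v < n" "card (A v) \<ge> 2" and sel: "\<And>w. w < n \<Longrightarrow> card (A w) \<le> card (A v)"
    and a: "a \<in> A v" and AB: "propagated (A(v := {a})) B"
begin

lemma lA: "lists A" using CA lC by (rule propagated_lists)

lemma AC: "w < n \<Longrightarrow> A w \<subseteq> C w" using CA by (rule propagated_subset)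

lemma BA: "w < n \<Longrightarrow> B w \<subseteq> A w"
  using propagated_subset[OF AB, of w] a by (auto split: if_splits)

lemma Bv: "B v \<subseteq> {a}" using propagated_subset[OF AB v(1)] by simp

lemma few_threes: "7 * card (threes A) \<le> 2 * n"
  by (rule score_count[OF lA neA _ low]) (use CA in \<open>auto simp: propagated_def\<close>)

text \<open>If \<open>C\<close> were full everywhere, it would equal its propagation and all
  \<open>n\<close> vertices would be full, against \<open>few_threes\<close>. So \<open>C\<close>
  has the ordinary weight.\<close>

lemma weight_parent: "bound (card (threes A)) \<le> weight C"
proof -
  have "\<not> (\<forall>v<n. card (C v) = 3)"
  proof
    assume full: "\<forall>v<n. card (C v) = 3"
    hence "stuck C" by (auto simp: stuck_def)
    hence "\<forall>v<n. A v = C v" using CA by (auto simp: propagated_def)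
    hence "threes A = {..<n}" using full by (auto simp: threes_def)
    thus False using few_threes n_pos by simp
  qed
  hence "weight C = bound (card (free_threes C))" by (auto simp: weight_def)
  moreover have "card (threes A) \<le> card (free_threes C)"
    by (intro card_mono propagated_threes CA lC neA) simp
  ultimately show ?thesis by (simp add: bound_mono)
qed

lemma size_sum_child:
  assumes "\<And>w. w < n \<Longrightarrow> D w \<subseteq> A w" "D v \<noteq> A v"
  shows "size_sum D < size_sum C"
proof -
  have "size_sum D < size_sum A" by (rule size_sum_less[OF lA _ v(1)]) (use assms in auto)
  also have "\<dots> \<le> size_sum C" by (rule size_sum_le[OF lC]) (use AC in auto)
  finally show ?thesis .
qed

lemma B_ne: "B v \<noteq> A v"
proof
  assume "B v = A v"
  hence "card (A v) \<le> card {a}" using Bv by (intro card_mono) auto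
  thus False using v by simp
qed

text \<open>A list that has shrunk but has neither zero nor one color left has two, so it had three
  before.\<close>

lemma partial_threes: "all_ne B \<Longrightarrow> partial A B \<subseteq> threes A"
proof
  fix w assume ne: "all_ne B" and "w \<in> partial A B"
  hence w: "w < n" "B w \<noteq> A w" "card (B w) \<noteq> 1" by (auto simp: partial_def)
  have fin: "finite (A w)" by (rule lists_card(2)[OF lA w(1)])
  hence "card (B w) \<noteq> 0" using ne w(1) finite_subset[OF BA[OF w(1)]] by (auto simp: all_ne_def)
  moreover have "card (B w) < card (A w)" using BA[OF w(1)] w(2) fin by (intro psubset_card_mono) auto
  ultimately show "w \<in> threes A" using w lists_card(1)[OF lA w(1)] by (auto simp: threes_def)
qed

lemma threes_B: "threes B \<subseteq> threes A - partial A B - {v}"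
proof
  fix w assume "w \<in> threes B"
  hence w: "w < n" "card (B w) = 3" by (auto simp: threes_def)
  have fin: "finite (A w)" by (rule lists_card(2)[OF lA w(1)])
  have "card (B w) \<le> card (A w)" by (rule card_mono[OF fin BA[OF w(1)]])
  hence "card (A w) = 3" using lists_card(1)[OF lA w(1)] w by linarith
  moreover from this have "B w = A w" using BA[OF w(1)] fin w by (intro card_subset_eq) auto
  moreover have "w \<noteq> v" using B_ne calculation by auto
  ultimately show "w \<in> threes A - partial A B - {v}" using w by (auto simp: threes_def partial_def)
qed

lemma v_partial: "all_ne B \<Longrightarrow> v \<notin> partial A B"
proof
  assume "all_ne B" "v \<in> partial A B"
  hence "B v = {a}" using Bv v by (auto simp: all_ne_def)
  thus False using \<open>v \<in> partial A B\<close> by (simp add: partial_def)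
qed

text \<open>A list that shrinks to two colors was full, and \<open>v\<close> has a largest list, so
  \<open>v\<close> was full too. It drops out in addition to the lists counted by
  \<open>partial\<close>.\<close>

lemma card_threes_B: "all_ne B \<Longrightarrow> partial A B \<noteq> {} \<Longrightarrow> card (threes B) + card (partial A B) + 1 \<le> card (threes A)"
proof -
  assume ne: "all_ne B" and "partial A B \<noteq> {}"
  then obtain w where "w \<in> threes A" using partial_threes by blast
  hence "card (A v) = 3" using sel[of w] lists_card(1)[OF lA v(1)] by (simp add: threes_def)
  hence vt: "v \<in> threes A - partial A B" using v v_partial[OF ne] by (simp add: threes_def)
  have "card (threes B) \<le> card (threes A - partial A B - {v})" by (intro card_mono threes_B) auto
  moreover have "card (threes A - partial A B) = Suc (card (threes A - partial A B - {v}))"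
    by (rule card.remove[OF _ vt]) simp
  moreover have "card (threes A - partial A B) + card (partial A B) = card (threes A)"
    using card_mono[OF finite_threes partial_threes[OF ne]]
    by (subst card_Diff_subset) (use partial_threes[OF ne] in auto)
  ultimately show ?thesis by linarith
qed

lemma sol_forced: "sol A c \<Longrightarrow> c v = a \<Longrightarrow> sol B c"
proof -
  assume "sol A c" "c v = a"
  hence "sol (A(v := {a})) c" by (auto simp: sol_def)
  thus ?thesis using AB by (simp add: propagated_def)
qed

text \<open>Overwriting a solution with the forced colors keeps it a solution, because no forced color
  occurs in the list of an unforced neighbor.\<close>

lemma sol_override:
  assumes c: "sol A c" and w: "\<And>w. w \<in> partial A B \<Longrightarrow> c w \<in> B w" and ne: "all_ne B"
  shows "solvable B"
proof -
  define c' where "c' = (\<lambda>u. if card (B u) = 1 then the_elem (B u) else c u)"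
  have 1: "B u = {c' u}" if "card (B u) = 1" for u
    using that by (metis c'_def card_1_singletonE the_elem_eq)
  have 2: "c' u \<in> B u" if "u < n" for u
  proof (cases "card (B u) = 1")
    case False
    hence "B u = A u \<or> u \<in> partial A B" using that by (auto simp: partial_def)
    thus ?thesis using w c that False by (auto simp: c'_def sol_def)
  qed (use 1 in auto)
  have st: "stuck B" using AB by (simp add: propagated_def)
  have "c' u \<noteq> c' w" if "u < n" "w < n" "E u w" for u w
  proof (cases "card (B u) = 1 \<or> card (B w) = 1")
    case True
    hence "B u \<inter> B w = {}" using st that sym[OF that(3)] unfolding stuck_def by blast
    thus ?thesis using 2 that by (metis disjoint_iff)
  next
    case False
    thus ?thesis using c that by (auto simp: c'_def sol_def)
  qed
  thus ?thesis using 2 by (auto simp: solvable_def sol_def)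
qed

lemma solvable_B: "solvable B \<Longrightarrow> solvable A"
  unfolding solvable_def using sol_mono[of B _ A] BA by blast

lemma solvable_del: "solvable (A(v := A v - {a})) \<Longrightarrow> solvable A"
  unfolding solvable_def using sol_mono[of "A(v := A v - {a})" _ A] by (metis Diff_subset fun_upd_apply order_refl)

lemma sol_del: "sol A c \<Longrightarrow> c v \<noteq> a \<Longrightarrow> sol (A(v := A v - {a})) c"
  by (auto simp: sol_def)

lemma weight_B: "weight B \<le> bound (card (threes B))"
  by (rule weight_child_le[OF lC size_sum_child]) (use BA B_ne in \<open>auto simp: free_threes_def intro: card_mono\<close>)

lemma size_del: "size_sum (A(v := A v - {a})) < size_sum C"
  by (rule size_sum_child) (use a in auto)

lemma threes_del: "threes (A(v := A v - {a})) \<subseteq> threes A - {v}"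
proof
  fix w assume w: "w \<in> threes (A(v := A v - {a}))"
  have "card (A v - {a}) < card (A v)"
    using a lists_card(2)[OF lA v(1)] by (intro psubset_card_mono) auto
  hence "w \<noteq> v" using w lists_card(1)[OF lA v(1)] by (auto simp: threes_def)
  thus "w \<in> threes A - {v}" using w by (simp add: threes_def)
qed

text \<open>The color \<open>a\<close> is refuted for \<open>v\<close>. The weight need not
  decrease; the removed color pays.\<close>

lemma good_conflict: "\<not> all_ne B \<Longrightarrow> good_step C False [A(v := A v - {a})]"
proof -
  assume "\<not> all_ne B"
  hence nB: "\<not> sol B c" for c by (auto simp: sol_def all_ne_def)
  have "solvable A \<longleftrightarrow> solvable (A(v := A v - {a}))"
    using solvable_del sol_del sol_forced nB by (metis solvable_def)
  moreover have "weight (A(v := A v - {a})) \<le> bound (card (threes A))"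
    by (rule weight_child_le[OF lC size_del])
      (use threes_del in \<open>auto simp: free_threes_def intro!: card_mono\<close>)
  ultimately show ?thesis
    using propagated_solvable[OF CA] weight_parent size_del potential_step[of "[A(v := A v - {a})]" C]
    by (simp add: good_step_def)
qed

text \<open>Every changed list has become a single color, so by \<open>sol_override\<close> any
  solution of \<open>A\<close> can be turned into one of \<open>B\<close>. The choice of
  \<open>a\<close> at \<open>v\<close> thus loses nothing, and no second child is needed.\<close>

lemma good_autarky: "all_ne B \<Longrightarrow> partial A B = {} \<Longrightarrow> good_step C False [B]"
proof -
  assume ne: "all_ne B" and "partial A B = {}"
  hence "solvable A \<longleftrightarrow> solvable B"
    using solvable_B sol_override by (auto simp: solvable_def)
  moreover have "card (threes B) \<le> card (threes A)" using threes_B by (intro card_mono) auto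
  hence "weight B \<le> weight C" using weight_B weight_parent bound_mono order_trans by meson
  moreover have "size_sum B < size_sum C" by (rule size_sum_child) (use BA B_ne in auto)
  ultimately show ?thesis
    using propagated_solvable[OF CA] potential_step[of "[B]" C] by (simp add: good_step_def)
qed

text \<open>A plain case distinction on whether \<open>v\<close> gets \<open>a\<close>. In the first
  child \<open>v\<close> and at least two further lists are no longer full, in the second only
  \<open>v\<close>.\<close>

lemma good_many:
  assumes ne: "all_ne B" and p: "card (partial A B) \<ge> 2"
  shows "good_step C False [B, A(v := A v - {a})]"
proof -
  let ?D = "A(v := A v - {a})"
  have "solvable A \<longleftrightarrow> solvable B \<or> solvable ?D"
    using solvable_B solvable_del sol_forced sol_del by (metis solvable_def)
  moreover have "size_sum B < size_sum C" by (rule size_sum_child) (use BA B_ne in auto)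
  moreover have "weight B + weight ?D \<le> weight C"
  proof -
    have pn: "partial A B \<noteq> {}" using p by auto
    have t: "card (threes B) + card (partial A B) + 1 \<le> card (threes A)" by (rule card_threes_B[OF ne pn])
    obtain w where "w \<in> threes A" using partial_threes[OF ne] pn by blast
    hence "card (A v) = 3" using sel[of w] lists_card(1)[OF lA v(1)] by (simp add: threes_def)
    hence vt: "v \<in> threes A" using v by (simp add: threes_def)
    have "free_threes ?D \<subseteq> threes A - {v}" using threes_del by (auto simp: free_threes_def)
    hence "card (free_threes ?D) \<le> card (threes A - {v})" by (intro card_mono) auto
    also have "\<dots> = card (threes A) - 1" using vt by simp
    finally have "weight ?D \<le> bound (card (threes A) - 1)"
      by (rule weight_child_le[OF lC size_del])
    moreover have "bound (card (threes B)) + bound (card (threes A) - 1) \<le> bound (card (threes A))"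
      using t p by (intro bound_sum31 few_threes) auto
    ultimately show ?thesis using weight_B weight_parent by linarith
  qed
  ultimately show ?thesis
    using propagated_solvable[OF CA] size_del potential_step[of "[B, ?D]" C] by (simp add: good_step_def)
qed

text \<open>A solution of \<open>A\<close> with \<open>c v = a\<close> solves \<open>B\<close>, and
  one with \<open>c w \<in> B w\<close> can be overwritten to solve \<open>B\<close>. So the second
  child may assume that both fail, and it loses two full lists instead of one.\<close>

lemma good_one:
  assumes ne: "all_ne B" and p: "partial A B = {w}"
  shows "good_step C False [B, A(v := A v - {a}, w := A w - B w)]"
proof -
  let ?D = "A(v := A v - {a}, w := A w - B w)"
  have w: "w \<in> threes A" "w \<noteq> v" "w < n" "card (B w) \<noteq> 1" "B w \<noteq> A w"
    using p partial_threes[OF ne] v_partial[OF ne] by (auto simp: partial_def)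
  have fin: "finite (A w)" by (rule lists_card(2)[OF lA w(3)])
  have DA: "?D u \<subseteq> A u" for u by auto
  have "solvable A \<longleftrightarrow> solvable B \<or> solvable ?D"
  proof
    assume "solvable A"
    then obtain c where c: "sol A c" by (auto simp: solvable_def)
    show "solvable B \<or> solvable ?D"
    proof (cases "c v = a \<or> c w \<in> B w")
      case True
      thus ?thesis using sol_forced[OF c] sol_override[OF c _ ne] p by (auto simp: solvable_def)
    next
      case False
      hence "sol ?D c" using c by (auto simp: sol_def)
      thus ?thesis by (auto simp: solvable_def)
    qed
  next
    assume "solvable B \<or> solvable ?D"
    moreover have "solvable ?D \<Longrightarrow> solvable A"
      unfolding solvable_def using sol_mono[of ?D _ A] DA by metis
    ultimately show "solvable A" using solvable_B by blast
  qed
  moreover have "size_sum B < size_sum C" by (rule size_sum_child) (use BA B_ne in auto)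
  moreover have sD: "size_sum ?D < size_sum C" by (rule size_sum_child) (use a w in auto)
  moreover have "weight B + weight ?D \<le> weight C"
  proof -
    have t: "card (threes B) + card (partial A B) + 1 \<le> card (threes A)"
      by (rule card_threes_B[OF ne]) (use p in auto)
    have "card (A v) = 3" using w sel[of w] lists_card(1)[OF lA v(1)] by (simp add: threes_def)
    hence vt: "{v,w} \<subseteq> threes A" using v w by (simp add: threes_def)
    have "card (B w) \<noteq> 0" using ne w finite_subset[OF BA[OF w(3)] fin] by (auto simp: all_ne_def)
    moreover have "card (A w - B w) = card (A w) - card (B w)"
      using BA[OF w(3)] finite_subset[OF BA[OF w(3)] fin] by (intro card_Diff_subset)
    ultimately have "card (A w - B w) < 3" using w(1) by (simp add: threes_def)
    moreover have "free_threes ?D \<subseteq> threes ?D" by (auto simp: free_threes_def)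
    ultimately have "free_threes ?D \<subseteq> threes A - {v, w}"
      using threes_del by (fastforce simp: threes_def split: if_splits)
    hence "card (free_threes ?D) \<le> card (threes A - {v, w})" by (intro card_mono) auto
    also have "\<dots> = card (threes A) - 2" using vt w by (subst card_Diff_subset) auto
    finally have "weight ?D \<le> bound (card (threes A) - 2)"
      by (rule weight_child_le[OF lC sD])
    moreover have "bound (card (threes B)) + bound (card (threes A) - 2) \<le> bound (card (threes A))"
      using t p by (intro bound_sum22 few_threes) auto
    ultimately show ?thesis using weight_B weight_parent by linarith
  qed
  ultimately show ?thesis
    using propagated_solvable[OF CA] potential_step[of "[B, ?D]" C] by (simp add: good_step_def)
qed

end

end

section \<open>A language of bounded loops\<close>

text \<open>All loops have \<open>n\<close> rounds, so the semantics is a total function and the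
  cost depends on the command and \<open>n\<close> only. \<open>Tab\<close> looks up an arbitrary
  finite table, which provides all operations on lists at constant cost; \<open>Get\<close> and
  \<open>Put\<close> access column \<open>v\<close> of row \<open>r\<close>.\<close>

datatype cmd =
    CSkip
  | Cst nat nat
  | Len nat
  | Copy nat nat
  | Inc nat
  | Sub nat nat nat
  | Tab nat "nat \<Rightarrow> nat \<Rightarrow> nat" nat nat
  | Get nat nat nat
  | Put nat nat nat
  | CSeq cmd cmd (infixr ";;" 60)
  | CIf nat cmd cmd
  | For nat cmd

type_synonym cstate = "(nat \<Rightarrow> nat) \<times> (nat \<Rightarrow> nat \<Rightarrow> nat)"

text \<open>The memory is a matrix with rows of length \<open>n\<close>; the quotient and the remainder only matter
  for a column index that is out of range, where they make the compiled code correct all the same.\<close>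

primrec sem :: "nat \<Rightarrow> cmd \<Rightarrow> cstate \<Rightarrow> cstate" where
  "sem n CSkip s = s"
| "sem n (Cst x k) s = ((fst s)(x := k), snd s)"
| "sem n (Len x) s = ((fst s)(x := n), snd s)"
| "sem n (Copy x y) s = ((fst s)(x := fst s y), snd s)"
| "sem n (Inc x) s = ((fst s)(x := Suc (fst s x)), snd s)"
| "sem n (Sub z x y) s = ((fst s)(z := fst s x - fst s y), snd s)"
| "sem n (Tab z g x y) s = ((fst s)(z := g (min (fst s x) 7) (min (fst s y) 7)), snd s)"
| "sem n (Get x r v) s = ((fst s)(x := snd s (fst s r + fst s v div n) (fst s v mod n)), snd s)"
| "sem n (Put r v x) s = (fst s, (snd s)(fst s r + fst s v div n :=
     (snd s (fst s r + fst s v div n))(fst s v mod n := fst s x)))"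
| "sem n (CSeq c d) s = sem n d (sem n c s)"
| "sem n (CIf x c d) s = (if fst s x \<noteq> 0 then sem n c s else sem n d s)"
| "sem n (For i c) s =
     (let s' = fold (\<lambda>k s. sem n c ((fst s)(i := k), snd s)) [0..<n] s in ((fst s')(i := n), snd s'))"

primrec writes :: "cmd \<Rightarrow> nat set" where
  "writes CSkip = {}"
| "writes (Cst x k) = {x}"
| "writes (Len x) = {x}"
| "writes (Copy x y) = {x}"
| "writes (Inc x) = {x}"
| "writes (Sub z x y) = {z}"
| "writes (Tab z g x y) = {z}"
| "writes (Get x r v) = {x}"
| "writes (Put r v x) = {}"
| "writes (CSeq c d) = writes c \<union> writes d"
| "writes (CIf x c d) = writes c \<union> writes d"
| "writes (For i c) = insert i (writes c)"

text \<open>A loop is compiled with its counter in a register, which the body must therefore leave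
  alone. Bounded table entries keep the stored numbers small.\<close>

primrec wf_cmd :: "cmd \<Rightarrow> bool" where
  "wf_cmd CSkip = True"
| "wf_cmd (Cst x k) = True"
| "wf_cmd (Len x) = True"
| "wf_cmd (Copy x y) = True"
| "wf_cmd (Inc x) = True"
| "wf_cmd (Sub z x y) = True"
| "wf_cmd (Tab z g x y) = (\<forall>i j. g i j \<le> 7)"
| "wf_cmd (Get x r v) = True"
| "wf_cmd (Put r v x) = True"
| "wf_cmd (CSeq c d) = (wf_cmd c \<and> wf_cmd d)"
| "wf_cmd (CIf x c d) = (wf_cmd c \<and> wf_cmd d)"
| "wf_cmd (For i c) = (i \<notin> writes c \<and> wf_cmd c)"

text \<open>Serves two purposes: multiplied by a bit length it bounds the running time, and it
  bounds the growth of the largest stored number, which is why the constant \<open>k\<close> is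
  charged \<open>k + 1\<close>.\<close>

primrec cost :: "nat \<Rightarrow> cmd \<Rightarrow> nat" where
  "cost n CSkip = 1"
| "cost n (Cst x k) = k + 1"
| "cost n (Len x) = 10"
| "cost n (Copy x y) = 10"
| "cost n (Inc x) = 10"
| "cost n (Sub z x y) = 10"
| "cost n (Tab z g x y) = 100"
| "cost n (Get x r v) = 10"
| "cost n (Put r v x) = 10"
| "cost n (CSeq c d) = cost n c + cost n d"
| "cost n (CIf x c d) = 1 + cost n c + cost n d"
| "cost n (For i c) = n * (cost n c + 10) + 10"

text \<open>A chain of tests that counts \<open>r\<close> down, with register 3 holding the constant
  1. The last entry also serves all larger values, which is how arguments get truncated.\<close>

fun switch :: "nat \<Rightarrow> prog list \<Rightarrow> prog" where
  "switch r [] = Skip"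
| "switch r [p] = p"
| "switch r (p # q # ps) = If r (Seq (Const 3 1) (Seq (Op r Minus r 3) (switch r (q # ps)))) p"

text \<open>Register \<open>x\<close> of a command is register \<open>x + 4\<close> of the machine. Register 0 keeps \<open>n\<close>, and
  registers 1 to 3 are scratch.\<close>

primrec compile :: "cmd \<Rightarrow> prog" where
  "compile CSkip = Skip"
| "compile (Cst x k) = Const (x + 4) k"
| "compile (Len x) = Seq (Const 1 0) (Op (x + 4) Plus 0 1)"
| "compile (Copy x y) = Seq (Const 1 0) (Op (x + 4) Plus (y + 4) 1)"
| "compile (Inc x) = Seq (Const 1 1) (Op (x + 4) Plus (x + 4) 1)"
| "compile (Sub z x y) = Op (z + 4) Minus (x + 4) (y + 4)"
| "compile (Tab z g x y) = Seq (Const 3 0) (Seq (Op 1 Plus (x + 4) 3) (Seq (Op 2 Plus (y + 4) 3)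
     (switch 1 (map (\<lambda>i. switch 2 (map (\<lambda>j. Const (z + 4) (g i j)) [0..<8])) [0..<8]))))"
| "compile (Get x r v) = Seq (Op 1 Times (r + 4) 0) (Seq (Op 1 Plus 1 (v + 4)) (Load (x + 4) 1))"
| "compile (Put r v x) = Seq (Op 1 Times (r + 4) 0) (Seq (Op 1 Plus 1 (v + 4)) (Store 1 (x + 4)))"
| "compile (CSeq c d) = Seq (compile c) (compile d)"
| "compile (CIf x c d) = If (x + 4) (compile c) (compile d)"
| "compile (For i c) = Seq (Const (i + 4) 0) (Seq (Op 1 Minus 0 (i + 4))
     (While 1 (Seq (compile c) (Seq (Const 1 1) (Seq (Op (i + 4) Plus (i + 4) 1) (Op 1 Minus 0 (i + 4)))))))"

definition bounded_by :: "nat \<Rightarrow> cstate \<Rightarrow> bool" where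
  "bounded_by V s \<longleftrightarrow> (\<forall>x. fst s x \<le> V) \<and> (\<forall>r v. snd s r v \<le> V)"

text \<open>The restriction to \<open>v < n\<close> makes the cell \<open>r * n + v\<close>
  determine \<open>r\<close> and \<open>v\<close>. Nothing is said about the scratch
  registers.\<close>

definition represents :: "nat \<Rightarrow> cstate \<Rightarrow> state \<Rightarrow> bool" where
  "represents n s C \<longleftrightarrow> fst C 0 = n \<and> (\<forall>x. fst C (x + 4) = fst s x) \<and>
     (\<forall>r v. v < n \<longrightarrow> snd C (r * n + v) = snd s r v)"

text \<open>Total correctness with a time bound. The postcondition \<open>Q\<close> may itself be a
  \<open>runs\<close> statement, so that sequences are handled without naming intermediate
  states.\<close>

definition runs :: "prog \<Rightarrow> state \<Rightarrow> nat \<Rightarrow> (state \<Rightarrow> bool) \<Rightarrow> bool" where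
  "runs p s T Q \<longleftrightarrow> (\<exists>t s'. exec p s t s' \<and> t \<le> T \<and> Q s')"

section \<open>Frame, loop and growth rules for the loop language\<close>

lemma sem_frame: "x \<notin> writes c \<Longrightarrow> fst (sem n c s) x = fst s x"
proof (induction c arbitrary: s)
  case (For i c)
  have "fst (fold (\<lambda>k s. sem n c ((fst s)(i := k), snd s)) ks s) x = fst s x" for ks s
    by (induction ks arbitrary: s) (use For in auto)
  thus ?case using For by (simp add: Let_def)
qed auto

text \<open>The invariant is stated before the counter is set, so it can ignore the counter.\<close>

lemma sem_For_rule:
  assumes "I 0 s" and "\<And>k s. k < n \<Longrightarrow> I k s \<Longrightarrow> I (Suc k) (sem n c ((fst s)(i := k), snd s))"
    and "\<And>s. I n s \<Longrightarrow> Q ((fst s)(i := n), snd s)"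
  shows "Q (sem n (For i c) s)"
proof -
  have "m \<le> n \<Longrightarrow> I m (fold (\<lambda>k s. sem n c ((fst s)(i := k), snd s)) [0..<m] s)" for m
    by (induction m) (use assms(1,2) in auto)
  from this[of n] show ?thesis using assms(3) by (simp add: Let_def)
qed

lemma bounded_by_mono: "bounded_by V s \<Longrightarrow> V \<le> W \<Longrightarrow> bounded_by W s"
  unfolding bounded_by_def using order_trans by blast

lemma bounded_by_upd: "bounded_by V s \<Longrightarrow> V \<le> W \<Longrightarrow> k \<le> W \<Longrightarrow> bounded_by W ((fst s)(x := k), snd s)"
  unfolding bounded_by_def using order_trans by (simp, blast)

lemma bounded_byD: "bounded_by V s \<Longrightarrow> fst s x \<le> V" "bounded_by V s \<Longrightarrow> snd s r v \<le> V"
  by (simp_all add: bounded_by_def)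

text \<open>Values grow only additively, so even after exponentially many steps they have \<open>O(n)\<close> bits.\<close>

lemma bounded_by_sem:
  assumes "wf_cmd c" "bounded_by V s" "n \<le> V" "7 \<le> V"
  shows "bounded_by (V + cost n c) (sem n c s)"
  using assms
proof (induction c arbitrary: s V)
  case (Tab z g x y)
  have "g i j \<le> V" for i j
    using Tab by (meson le_trans wf_cmd.simps(7))
  thus ?case using Tab by (auto simp: bounded_by_def intro: trans_le_add1)
next
  case (CSeq c d)
  have "bounded_by (V + cost n c) (sem n c s)" using CSeq by auto
  from CSeq.IH(2)[OF _ this] CSeq.prems show ?case by (simp add: add.assoc)
next
  case (CIf x c d)
  have "bounded_by (V + cost n c) (sem n c s)" "bounded_by (V + cost n d) (sem n d s)"
    using CIf by auto
  thus ?case by (auto elim!: bounded_by_mono)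
next
  case (For i c)
  have step: "bounded_by (U + cost n c) (sem n c ((fst s)(i := k), snd s))"
    if "bounded_by U s" "V \<le> U" "k < n" for U s k
    using that For.prems by (intro For.IH) (auto simp: bounded_by_def)
  show ?case
  proof (rule sem_For_rule[where I = "\<lambda>k s. bounded_by (V + k * cost n c) s"])
    fix k s assume "k < n" "bounded_by (V + k * cost n c) s"
    from step[OF this(2) _ this(1)]
    show "bounded_by (V + Suc k * cost n c) (sem n c ((fst s)(i := k), snd s))"
      by (simp add: algebra_simps)
  next
    fix s assume "bounded_by (V + n * cost n c) s"
    hence "bounded_by (V + cost n (For i c)) s" by (rule bounded_by_mono) (simp add: add_mult_distrib2)
    thus "bounded_by (V + cost n (For i c)) ((fst s)(i := n), snd s)"
      using For.prems by (simp add: bounded_by_def)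
  qed (use For.prems in simp)
next
  case (Put r v x)
  have "bounded_by (V + cost n (Put r v x)) s" using Put.prems by (auto elim: bounded_by_mono)
  thus ?case by (simp add: bounded_by_def)
next
  case (Copy x y)
  thus ?case using bounded_byD(1)[of V s y] by (auto intro!: bounded_by_upd[of V])
next
  case (Inc x)
  thus ?case using bounded_byD(1)[of V s x] by (auto intro!: bounded_by_upd[of V])
next
  case (Sub z x y)
  thus ?case using bounded_byD(1)[of V s x] by (auto intro!: bounded_by_upd[of V])
next
  case (Get x r v)
  thus ?case using bounded_byD(2)[of V s] by (auto intro!: bounded_by_upd[of V] trans_le_add1)
next
  case CSkip
  thus ?case by (auto elim: bounded_by_mono)
qed (auto intro!: bounded_by_upd)

section \<open>Timed execution on the machine and correctness of the compilation\<close>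

lemma bits_mono: "a \<le> b \<Longrightarrow> bits a \<le> bits b"
  unfolding bits_def using floor_log_mono by (simp add: monoD)

lemma bits_pos: "1 \<le> bits a"
  by (simp add: bits_def)

lemma runs_weaken: "runs p s T Q \<Longrightarrow> T \<le> U \<Longrightarrow> (\<And>s. Q s \<Longrightarrow> Q' s) \<Longrightarrow> runs p s U Q'"
  unfolding runs_def by (meson le_trans)

lemma runs_le: "runs p s T Q \<Longrightarrow> T \<le> U \<Longrightarrow> runs p s U Q"
  by (erule runs_weaken)

lemma runs_Seq: "runs p s T (\<lambda>s'. runs q s' U Q) \<Longrightarrow> runs (Seq p q) s (T + U) Q"
  unfolding runs_def using exec.Seq by (meson add_mono)

lemma runs_Skip: "1 \<le> T \<Longrightarrow> Q s \<Longrightarrow> runs Skip s T Q"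
  unfolding runs_def using exec.Skip by blast

lemma runs_Const: "bits k \<le> T \<Longrightarrow> Q ((fst s)(r := k), snd s) \<Longrightarrow> runs (Const r k) s T Q"
  unfolding runs_def using exec.Const[of r k "fst s" "snd s"] by auto

lemma runs_Op: "bits (fst s a) + bits (fst s b) \<le> T \<Longrightarrow>
    Q ((fst s)(r := apply_binop f (fst s a) (fst s b)), snd s) \<Longrightarrow> runs (Op r f a b) s T Q"
  unfolding runs_def using exec.Op[of r f a b "fst s" "snd s"] by auto

lemma runs_Load: "bits (fst s a) + bits (snd s (fst s a)) \<le> T \<Longrightarrow>
    Q ((fst s)(r := snd s (fst s a)), snd s) \<Longrightarrow> runs (Load r a) s T Q"
  unfolding runs_def using exec.Load[of r a "fst s" "snd s"] by auto

lemma runs_Store: "bits (fst s a) + bits (fst s r) \<le> T \<Longrightarrow>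
    Q (fst s, (snd s)(fst s a := fst s r)) \<Longrightarrow> runs (Store a r) s T Q"
  unfolding runs_def using exec.Store[of a r "fst s" "snd s"] by auto

lemma runs_If: "(fst s r \<noteq> 0 \<Longrightarrow> runs p s T Q) \<Longrightarrow> (fst s r = 0 \<Longrightarrow> runs q s T Q) \<Longrightarrow>
    runs (If r p q) s (bits (fst s r) + T) Q"
  unfolding runs_def using exec.IfTrue[of "fst s" r p "snd s"] exec.IfFalse[of "fst s" r q "snd s"]
  by (metis add_left_mono prod.collapse)

lemma runs_While_stop: "fst s r = 0 \<Longrightarrow> bits (fst s r) \<le> T \<Longrightarrow> Q s \<Longrightarrow> runs (While r p) s T Q"
  unfolding runs_def using exec.WhileFalse[of "fst s" r p "snd s"] by (metis prod.collapse)

lemma runs_While_step: "fst s r \<noteq> 0 \<Longrightarrow> runs p s T (\<lambda>s'. runs (While r p) s' U Q) \<Longrightarrow>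
    runs (While r p) s (bits (fst s r) + T + U) Q"
  unfolding runs_def using exec.WhileTrue[of "fst s" r p "snd s"]
  by (metis add_left_mono add_mono prod.collapse)

text \<open>One link of the chain costs a test, a constant and a subtraction, at most
  \<open>4 * b\<close>. The chain destroys \<open>r\<close> and register 3, so the selected entry
  must work in every state that differs only there.\<close>

lemma runs_switch:
  assumes "ps \<noteq> []" "r \<noteq> 3" "bits (fst s r) \<le> b" "bits 1 \<le> b"
    and "\<And>s'. (\<forall>x. x \<noteq> r \<longrightarrow> x \<noteq> 3 \<longrightarrow> fst s' x = fst s x) \<Longrightarrow> snd s' = snd s \<Longrightarrow>
       runs (ps ! min (fst s r) (length ps - 1)) s' T Q"
  shows "runs (switch r ps) s (length ps * (4 * b) + T) Q"
  using assms
proof (induction r ps arbitrary: s rule: switch.induct)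
  case (2 r p)
  have "runs p s T Q" using "2.prems"(5)[of s] by simp
  thus ?case unfolding switch.simps by (rule runs_le) simp
next
  case (3 r p q ps)
  let ?s = "((fst s)(3 := 1, r := fst s r - 1), snd s)"
  have "runs (Seq (Const 3 1) (Seq (Op r Minus r 3) (switch r (q # ps)))) s
     (b + (2 * b + (length (q # ps) * (4 * b) + T))) Q" if "fst s r \<noteq> 0"
  proof (intro runs_Seq runs_Const runs_Op)
    have "runs (switch r (q # ps)) ?s (length (q # ps) * (4 * b) + T) Q"
    proof (rule "3.IH")
      show "bits (fst ?s r) \<le> b" using "3.prems"(3) bits_mono[of "fst s r - 1" "fst s r"] by simp
      fix s' :: state assume s': "\<forall>x. x \<noteq> r \<longrightarrow> x \<noteq> 3 \<longrightarrow> fst s' x = fst ?s x" "snd s' = snd ?s"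
      have "runs ((p # q # ps) ! min (fst s r) (length (p # q # ps) - 1)) s' T Q"
        by (rule "3.prems"(5)) (use s' in auto)
      moreover have "(p # q # ps) ! min (fst s r) (length (p # q # ps) - 1)
         = (q # ps) ! min (fst ?s r) (length (q # ps) - 1)"
        using that by (cases "fst s r") auto
      ultimately show "runs ((q # ps) ! min (fst ?s r) (length (q # ps) - 1)) s' T Q" by simp
    qed (use "3.prems" in auto)
    thus "runs (switch r (q # ps)) ((fst ((fst s)(3 := 1), snd s))
       (r := apply_binop Minus (fst ((fst s)(3 := 1), snd s) r) (fst ((fst s)(3 := 1), snd s) 3)),
        snd ((fst s)(3 := 1), snd s)) (length (q # ps) * (4 * b) + T) Q"
      using "3.prems"(2) by simp
  qed (use "3.prems" in auto)
  hence "fst s r \<noteq> 0 \<Longrightarrow> runs (Seq (Const 3 1) (Seq (Op r Minus r 3) (switch r (q # ps)))) s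
     (3 * b + (length (q # ps) * (4 * b) + T)) Q"
    by (auto elim!: runs_weaken)
  moreover have "fst s r = 0 \<Longrightarrow> runs p s (3 * b + (length (q # ps) * (4 * b) + T)) Q"
    using "3.prems"(5)[of s] by (auto elim!: runs_weaken)
  ultimately have "runs (switch r (p # q # ps)) s
     (bits (fst s r) + (3 * b + (length (q # ps) * (4 * b) + T))) Q"
    unfolding switch.simps by (intro runs_If) auto
  thus ?case by (rule runs_weaken) (use "3.prems"(3) in auto)
qed simp

lemma nth_map_min: "map f [0..<8] ! min k (length (map f [0..<8]) - 1) = f (min k 7)"
  by (subst nth_map) auto

text \<open>Values grow by at most the cost, so all of them stay below \<open>W\<close> and all
  addresses below the square of \<open>W + 1\<close>. A single bit bound \<open>b\<close> then
  covers every operand, and \<open>cost\<close> only has to count operands.\<close>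

lemma exec_compile:
  assumes "wf_cmd c" "represents n s C" "bounded_by V s" "n \<le> V" "7 \<le> V" "V + cost n c \<le> W" "0 < n"
  shows "runs (compile c) C (cost n c * bits ((W + 1) * (W + 1))) (represents n (sem n c s))"
proof -
  define b where "b = bits ((W + 1) * (W + 1))"
  have bW: "bits k \<le> b" if "k \<le> (W + 1) * (W + 1)" for k unfolding b_def using that by (rule bits_mono)
  have bW': "bits k \<le> b" if "k \<le> W" for k by (rule bW) (use that in \<open>simp add: trans_le_add1\<close>)
  have b1: "1 \<le> b" unfolding b_def by (rule bits_pos)
  have addr: "r * n + v \<le> (W + 1) * (W + 1)" "r * n \<le> (W + 1) * (W + 1)"
    if "r \<le> W" "v \<le> W" "n \<le> W" for r v
  proof -
    have "r * n \<le> W * W" using that by (intro mult_mono) auto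
    thus "r * n + v \<le> (W + 1) * (W + 1)" "r * n \<le> (W + 1) * (W + 1)"
      using that by (auto simp: algebra_simps)
  qed
  show ?thesis
    using assms unfolding b_def[symmetric]
  proof (induction c arbitrary: s C V)
    case CSkip
    thus ?case using b1 by (auto intro: runs_Skip)
  next
    case (Cst x k)
    have "bits k \<le> b" by (rule bW') (use Cst in simp)
    hence "bits k \<le> cost n (Cst x k) * b" by simp
    thus ?case unfolding compile.simps by (rule runs_Const) (use Cst in \<open>auto simp: represents_def\<close>)
  next
    case (Len x)
    show ?case unfolding compile.simps
      by (rule runs_le[where T = "b + 2 * b"], intro runs_Seq runs_Const runs_Op)
        (use Len in \<open>auto simp: represents_def intro!: bW' add_mono[of _ b _ b, folded mult_2]\<close>)
  next
    case (Copy x y)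
    have le: "fst s y \<le> W" using Copy.prems bounded_by_mono[of V s W] by (auto simp: bounded_by_def)
    show ?case unfolding compile.simps
      by (rule runs_le[where T = "b + 2 * b"], intro runs_Seq runs_Const runs_Op)
        (use Copy le in \<open>auto simp: represents_def intro!: bW' add_mono[of _ b _ b, folded mult_2]\<close>)
  next
    case (Inc x)
    have le: "fst s x \<le> W" using Inc.prems bounded_by_mono[of V s W] by (auto simp: bounded_by_def)
    show ?case unfolding compile.simps
      by (rule runs_le[where T = "b + 2 * b"], intro runs_Seq runs_Const runs_Op)
        (use Inc le in \<open>auto simp: represents_def intro!: bW' add_mono[of _ b _ b, folded mult_2]\<close>)
  next
    case (Sub z x y)
    have le: "fst s x \<le> W" "fst s y \<le> W" using Sub.prems bounded_by_mono[of V s W] by (auto simp: bounded_by_def)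
    show ?case unfolding compile.simps
      by (rule runs_le[where T = "2 * b"], intro runs_Op)
        (use Sub le in \<open>auto simp: represents_def intro!: bW' add_mono[of _ b _ b, folded mult_2]\<close>)
  next
    case (Get x r v)
    have le: "fst s r \<le> W" "fst s v \<le> W" "n \<le> W" "snd s i j \<le> W" for i j
      using Get.prems bounded_by_mono[of V s W] by (auto simp: bounded_by_def)
    have bt: "bits (fst s r * n) \<le> b" "bits (fst s r * n + fst s v) \<le> b" "bits n \<le> b"
      "bits (fst s r) \<le> b" "bits (fst s v) \<le> b" "\<And>i j. bits (snd s i j) \<le> b"
      using le addr[OF le(1-3)] by (auto intro: bW bW')
    have eq: "snd C (fst s r * n + fst s v) = snd s (fst s r + fst s v div n) (fst s v mod n)"
    proof -
      have "fst s r * n + fst s v = (fst s r + fst s v div n) * n + fst s v mod n"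
        by (simp add: algebra_simps)
      thus ?thesis using Get.prems by (simp add: represents_def)
    qed
    show ?case unfolding compile.simps
      by (rule runs_le[where T = "2 * b + (2 * b + 2 * b)"], intro runs_Seq runs_Op runs_Load)
        (use Get.prems bt eq in \<open>auto simp: represents_def intro: add_mono[of _ b _ b, folded mult_2]\<close>)
  next
    case (Put r v x)
    have le: "fst s r \<le> W" "fst s v \<le> W" "n \<le> W" "fst s x \<le> W"
      using Put.prems bounded_by_mono[of V s W] by (auto simp: bounded_by_def)
    have bt: "bits (fst s r * n) \<le> b" "bits (fst s r * n + fst s v) \<le> b" "bits n \<le> b"
      "bits (fst s r) \<le> b" "bits (fst s v) \<le> b" "bits (fst s x) \<le> b"
      using le addr[OF le(1-3)] by (auto intro: bW bW')
    have eq: "(i * n + j = fst s r * n + fst s v) \<longleftrightarrow> i = fst s r + fst s v div n \<and> j = fst s v mod n"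
      if "j < n" for i j
    proof -
      have *: "fst s r * n + fst s v = (fst s r + fst s v div n) * n + fst s v mod n"
        by (simp add: algebra_simps)
      show ?thesis
      proof
        assume "i * n + j = fst s r * n + fst s v"
        hence "(i * n + j) div n = ((fst s r + fst s v div n) * n + fst s v mod n) div n"
          "(i * n + j) mod n = ((fst s r + fst s v div n) * n + fst s v mod n) mod n" by (simp_all add: *)
        thus "i = fst s r + fst s v div n \<and> j = fst s v mod n" using that by simp
      qed (simp add: *)
    qed
    show ?case unfolding compile.simps
      by (rule runs_le[where T = "2 * b + (2 * b + 2 * b)"], intro runs_Seq runs_Op runs_Store)
        (use Put.prems bt eq in \<open>auto simp: represents_def intro: add_mono[of _ b _ b, folded mult_2]\<close>)
  next
    case (Tab z g x y)
    have le: "fst s x \<le> W" "fst s y \<le> W" "7 \<le> W"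
      using Tab.prems bounded_by_mono[of V s W] by (auto simp: bounded_by_def)
    have g: "g i j \<le> W" for i j using Tab.prems(1) le(3) by (meson le_trans wf_cmd.simps(7))
    let ?C = "((fst C)(3 := 0, 1 := fst s x, 2 := fst s y), snd C)"
    let ?row = "\<lambda>i. switch 2 (map (\<lambda>j. Const (z + 4) (g i j)) [0..<8])"
    let ?Q = "represents n (sem n (Tab z g x y) s)"
    have sw: "runs (switch 1 (map ?row [0..<8])) ?C (length (map ?row [0..<8]) * (4 * b) + (8 * (4 * b) + b)) ?Q"
    proof (rule runs_switch)
      fix s1 :: state
      assume s1: "\<forall>x. x \<noteq> 1 \<longrightarrow> x \<noteq> 3 \<longrightarrow> fst s1 x = fst ?C x" "snd s1 = snd ?C"
      let ?i = "min (fst s x) 7"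
      have "runs (?row ?i) s1
         (length (map (\<lambda>j. Const (z + 4) (g ?i j)) [0..<8]) * (4 * b) + b) ?Q"
      proof (rule runs_switch)
        fix s2 :: state
        assume s2: "\<forall>x. x \<noteq> 2 \<longrightarrow> x \<noteq> 3 \<longrightarrow> fst s2 x = fst s1 x" "snd s2 = snd s1"
        have "runs (Const (z + 4) (g ?i (min (fst s y) 7))) s2 b ?Q"
          by (rule runs_Const) (use s1 s2 Tab.prems g in \<open>auto simp: represents_def intro!: bW'\<close>)
        thus "runs (map (\<lambda>j. Const (z + 4) (g ?i j)) [0..<8] !
           min (fst s1 2) (length (map (\<lambda>j. Const (z + 4) (g ?i j)) [0..<8]) - 1)) s2 b ?Q"
          unfolding nth_map_min using s1 by simp
      qed (use s1 le in \<open>auto intro!: bW'\<close>)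
      thus "runs (map ?row [0..<8] ! min (fst ?C 1) (length (map ?row [0..<8]) - 1)) s1
         (8 * (4 * b) + b) ?Q"
        unfolding nth_map_min by simp
    qed (use le in \<open>auto intro!: bW'\<close>)
    have rc: "fst C (x + 4) = fst s x" "fst C (y + 4) = fst s y" using Tab.prems by (simp_all add: represents_def)
    \<comment> \<open>Two chains of eight links at \<open>4 * b\<close> each, and one
      assignment.\<close>
    from sw have sw: "runs (switch 1 (map ?row [0..<8])) ?C (65 * b) ?Q"
      by (rule runs_le) simp
    show ?case unfolding compile.simps
      by (rule runs_le[where T = "b + (2 * b + (2 * b + 65 * b))"], intro runs_Seq runs_Const runs_Op)
        (use Tab.prems(6) le sw rc in \<open>auto simp del: upt_Suc switch.simps intro!: bW' add_mono[of _ b _ b, folded mult_2]\<close>)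
  next
    case (CSeq c d)
    have bd: "bounded_by (V + cost n c) (sem n c s)" using CSeq.prems by (intro bounded_by_sem) auto
    have "runs (Seq (compile c) (compile d)) C (cost n c * b + cost n d * b) (represents n (sem n (CSeq c d) s))"
    proof (intro runs_Seq)
      have "runs (compile c) C (cost n c * b) (represents n (sem n c s))"
        using CSeq.prems by (intro CSeq.IH(1)) auto
      moreover have "runs (compile d) C' (cost n d * b) (represents n (sem n (CSeq c d) s))"
        if "represents n (sem n c s) C'" for C'
        using CSeq.prems CSeq.IH(2)[OF _ that bd] by (simp add: add.assoc)
      ultimately show "runs (compile c) C (cost n c * b)
         (\<lambda>s'. runs (compile d) s' (cost n d * b) (represents n (sem n (CSeq c d) s)))"
        by (auto elim: runs_weaken)
    qed
    thus ?case by (simp add: algebra_simps)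
  next
    case (CIf x c d)
    have "fst s x \<le> W" using CIf.prems bounded_by_mono[of V s W] by (auto simp: bounded_by_def)
    hence bx: "bits (fst C (x + 4)) \<le> b" using CIf.prems by (auto simp: represents_def intro!: bW')
    have "runs (compile c) C (cost n c * b) (represents n (sem n c s))"
      using CIf.prems by (intro CIf.IH(1)) auto
    moreover have "runs (compile d) C (cost n d * b) (represents n (sem n d s))"
      using CIf.prems by (intro CIf.IH(2)) auto
    ultimately have "runs (compile (CIf x c d)) C (bits (fst C (x + 4)) + (cost n c * b + cost n d * b))
       (represents n (sem n (CIf x c d) s))"
      unfolding compile.simps
      by (intro runs_If) (use CIf.prems in \<open>auto simp: represents_def elim!: runs_weaken\<close>)
    thus ?case by (rule runs_weaken) (use bx in \<open>auto simp: algebra_simps\<close>)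
  next
    case (For i c)
    define F where "F m = fold (\<lambda>k s. sem n c ((fst s)(i := k), snd s)) [0..<m] s" for m
    have F_Suc: "F (Suc m) = sem n c ((fst (F m))(i := m), snd (F m))" for m by (simp add: F_def)
    have F_0: "F 0 = s" by (simp add: F_def)
    have F_n: "sem n (For i c) s = ((fst (F n))(i := n), snd (F n))" by (simp add: F_def Let_def)
    let ?body = "Seq (compile c) (Seq (Const 1 1) (Seq (Op (i + 4) Plus (i + 4) 1) (Op 1 Minus 0 (i + 4))))"
    let ?S = "\<lambda>m. ((fst (F m))(i := m), snd (F m))"
    have i: "i \<notin> writes c" using For.prems by simp
    have bd: "m \<le> n \<Longrightarrow> bounded_by (V + m * cost n c) (F m)" for m
    proof (induction m)
      case (Suc m)
      hence "bounded_by (V + m * cost n c) (?S m)"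
        using For.prems by (intro bounded_by_upd[of "V + m * cost n c"]) auto
      from bounded_by_sem[OF _ this, of c n] show ?case
        using For.prems by (simp add: F_Suc algebra_simps)
    qed (use For.prems F_0 in simp)
    \<comment> \<open>Register 1 holds the number of remaining rounds. It is recomputed from the
      counter after each round, because the body uses it as scratch.\<close>
    have loop: "m \<le> n \<Longrightarrow> represents n (?S m) C' \<Longrightarrow> fst C' 1 = n - m \<Longrightarrow>
       runs (While 1 ?body) C' ((n - m) * ((cost n c + 7) * b) + b) (represents n (?S n))" for m C'
    proof (induction "n - m" arbitrary: m C')
      case 0
      hence "fst C' 1 = 0" "m = n" by auto
      moreover have "bits 0 \<le> b" by (rule bW') simp
      ultimately show ?case using 0 by (intro runs_While_stop) auto
    next
      case (Suc l)
      hence m: "m < n" by simp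
      have bm: "bounded_by (V + m * cost n c) (?S m)"
        using bd[of m] m For.prems by (intro bounded_by_upd[of "V + m * cost n c"]) auto
      have "m * cost n c + cost n c \<le> n * cost n c"
        using mult_le_mono1[of "Suc m" n "cost n c"] m by simp
      hence ub: "V + m * cost n c + cost n c \<le> W" using For.prems by (simp add: algebra_simps)
      have "n \<le> W" using For.prems by simp
      have 1: "runs (compile c) C' (cost n c * b) (represents n (F (Suc m)))"
        unfolding F_Suc using For.prems bm ub m Suc.prems by (intro For.IH) auto
      have 2: "runs (Seq (Const 1 1) (Seq (Op (i + 4) Plus (i + 4) 1) (Op 1 Minus 0 (i + 4)))) D
          (b + (2 * b + 2 * b)) (\<lambda>D'. represents n (?S (Suc m)) D' \<and> fst D' 1 = n - Suc m)"
        if D: "represents n (F (Suc m)) D" for D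
      proof -
        have "fst (F (Suc m)) i = m" unfolding F_Suc using i by (simp add: sem_frame)
        hence "fst D (i + 4) = m" using D by (simp only: represents_def)
        moreover have "fst D 0 = n" using D by (simp add: represents_def)
        moreover have D': "fst D (x + 4) = fst (F (Suc m)) x" "v < n \<Longrightarrow> snd D (r * n + v) = snd (F (Suc m)) r v" for x r v
          using D by (simp_all add: represents_def)
        ultimately show ?thesis
          by (intro runs_Seq runs_Const runs_Op)
            (use m \<open>n \<le> W\<close> in \<open>auto simp: represents_def intro!: bW' add_mono[of _ b _ b, folded mult_2]\<close>)
      qed
      have 3: "runs (While 1 ?body) D' ((n - Suc m) * ((cost n c + 7) * b) + b) (represents n (?S n))"
        if "represents n (?S (Suc m)) D' \<and> fst D' 1 = n - Suc m" for D'
        using Suc(1)[of "Suc m" D'] Suc.hyps(2) m that by simp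
      have 4: "runs ?body C' (cost n c * b + (b + (2 * b + 2 * b)))
          (\<lambda>D'. runs (While 1 ?body) D' ((n - Suc m) * ((cost n c + 7) * b) + b) (represents n (?S n)))"
        by (rule runs_Seq, rule runs_weaken[OF 1], simp, rule runs_weaken[OF 2], assumption, simp, rule 3)
      have "runs (While 1 ?body) C' (bits (fst C' 1) + (cost n c * b + (b + (2 * b + 2 * b)))
          + ((n - Suc m) * ((cost n c + 7) * b) + b)) (represents n (?S n))"
        by (rule runs_While_step[OF _ 4]) (use Suc.prems m in simp)
      moreover have "bits (fst C' 1) \<le> b" by (rule bW') (use Suc.prems \<open>n \<le> W\<close> in simp)
      moreover have "n - m = Suc (n - Suc m)" using m by simp
      ultimately show ?case by (elim runs_le) (simp add: add_mult_distrib)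
    qed
    have n: "n \<le> W" using For.prems by simp
    have "runs (compile (For i c)) C (b + (2 * b + ((n - 0) * ((cost n c + 7) * b) + b))) (represents n (?S n))"
      unfolding compile.simps
      by (intro runs_Seq runs_Const runs_Op loop)
        (use For.prems n F_0 in \<open>auto simp: represents_def intro!: bW' add_mono[of _ b _ b, folded mult_2]\<close>)
    thus ?case unfolding F_n by (rule runs_le) (simp add: algebra_simps)
  qed
qed

text \<open>\<open>Tab\<close> truncates its arguments at 7, and decoding does the same, so that decoding commutes with
  \<open>Tab\<close> without any invariant on the stored values.\<close>

definition dec :: "nat \<Rightarrow> nat set" where
  "dec m = {c. c < 3 \<and> odd (min m 7 div 2 ^ c)}"

definition enc :: "nat set \<Rightarrow> nat" where
  "enc A = of_bool (0 \<in> A) + 2 * of_bool (1 \<in> A) + 4 * of_bool (2 \<in> A)"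

section \<open>Color lists as bit masks\<close>

lemma dec_subset: "dec m \<subseteq> {0,1,2}"
  by (auto simp: dec_def)

lemma finite_dec [simp]: "finite (dec m)"
  using dec_subset finite_subset by blast

lemma dec_min [simp]: "dec (min m 7) = dec m"
  by (simp add: dec_def)

lemma dec_enc [simp]: "A \<subseteq> {0,1,2} \<Longrightarrow> dec (enc A) = A"
proof -
  assume A: "A \<subseteq> {0,1,2}"
  have "0 \<in> dec (enc A) \<longleftrightarrow> 0 \<in> A" "1 \<in> dec (enc A) \<longleftrightarrow> 1 \<in> A" "2 \<in> dec (enc A) \<longleftrightarrow> 2 \<in> A"
    by (simp_all add: dec_def enc_def of_bool_def)
  moreover have "dec (enc A) \<subseteq> {0,1,2}" by (auto simp: dec_def)
  ultimately show ?thesis using A by (intro set_eqI) (metis empty_iff insert_iff subsetD)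
qed

lemma enc_le [simp]: "enc A \<le> 7"
  by (simp add: enc_def)

lemma card_dec_le: "card (dec m) \<le> 3"
  using card_mono[OF _ dec_subset, of m] by simp

lemma dec_diff_subset: "dec m - X \<subseteq> {0,1,2}"
  using dec_subset by blast

lemma dec_enc_dec [simp]: "dec (enc (dec m)) = dec m" "dec (enc (dec m - X)) = dec m - X"
  using dec_subset dec_diff_subset by (auto intro!: dec_enc simp del: insert_iff)

section \<open>The program\<close>

text \<open>
  Rows 0 to \<open>n - 1\<close> of the memory matrix hold the adjacency matrix. Row \<open>n\<close> (in register \<open>LR\<close>) holds the
  list assignment being processed and row \<open>n + 1\<close> (\<open>PR\<close>) the result of a tentative coloring. The stack
  consists of the rows from \<open>n + 2\<close> (\<open>BASE\<close>) up to, but excluding, row \<open>SP\<close>. Lists are bit masks.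
  \<open>GO\<close> is the height of the stack, \<open>BV\<close> the branching vertex, and \<open>PW\<close> a vertex among the \<open>NP\<close> vertices
  that are counted by \<open>partial\<close>.
\<close>

abbreviation (input) "SP \<equiv> 0::nat"
abbreviation (input) "BASE \<equiv> 1::nat"
abbreviation (input) "LR \<equiv> 2::nat"
abbreviation (input) "PR \<equiv> 3::nat"
abbreviation (input) "ANS \<equiv> 4::nat"
abbreviation (input) "ONE \<equiv> 5::nat"
abbreviation (input) "GO \<equiv> 6::nat"
abbreviation (input) "I \<equiv> 7::nat"
abbreviation (input) "J \<equiv> 8::nat"
abbreviation (input) "V \<equiv> 9::nat"
abbreviation (input) "W \<equiv> 10::nat"
abbreviation (input) "D \<equiv> 11::nat"
abbreviation (input) "X \<equiv> 12::nat"
abbreviation (input) "Y \<equiv> 13::nat"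
abbreviation (input) "T \<equiv> 14::nat"
abbreviation (input) "BAD \<equiv> 15::nat"
abbreviation (input) "SC \<equiv> 16::nat"
abbreviation (input) "BEST \<equiv> 17::nat"
abbreviation (input) "BV \<equiv> 18::nat"
abbreviation (input) "FND \<equiv> 19::nat"
abbreviation (input) "NP \<equiv> 20::nat"
abbreviation (input) "PW \<equiv> 21::nat"
abbreviation (input) "REM \<equiv> 22::nat"

definition copy_row :: "nat \<Rightarrow> nat \<Rightarrow> cmd" where
  "copy_row a d = For V (Get X a V ;; Put d V X)"

definition strike :: "nat \<Rightarrow> nat \<Rightarrow> nat" where
  "strike x y = enc (if card (dec x) = 1 then dec y - dec x else dec y)"

definition visit :: "nat \<Rightarrow> cmd" where
  "visit r = Get D V W ;; CIf D (Get X r V ;; Get Y r W ;; Tab Y strike X Y ;; Put r W Y) CSkip"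

text \<open>Each of the \<open>n\<^sup>2\<close> passes shortens a list unless nothing is left to strike, and \<open>3 n < n\<^sup>2\<close>.\<close>

definition propagate :: "nat \<Rightarrow> cmd" where
  "propagate r = For I (For J (For V (For W (visit r))))"

definition check_empty :: "nat \<Rightarrow> cmd" where
  "check_empty r = Cst BAD 0 ;;
     For V (Get X r V ;; Tab T (\<lambda>x _. of_bool (dec x = {})) X X ;; CIf T (Cst BAD 1) CSkip)"

text \<open>Leaves the mask of the vertex in \<open>X\<close>, where \<open>find_score\<close> tests
  it afterwards.\<close>

definition score_one :: cmd where
  "score_one = Get X LR V ;; Tab SC (\<lambda>x _. of_bool (card (dec x) = 2)) X X ;;
     For W (Get D V W ;; CIf D (Get Y LR W ;; Tab Y (\<lambda>y _. of_bool (card (dec y) = 3)) Y Y ;;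
       CIf Y (Inc SC) CSkip) CSkip)"

text \<open>\<open>BEST\<close> starts at 3, so only scores of at least 4 are ever recorded. In the
  same way \<open>find_size\<close> starts at 1 to ignore decided vertices.\<close>

definition find_score :: cmd where
  "find_score = Cst BEST 3 ;; Cst FND 0 ;;
     For V (score_one ;; Tab T (\<lambda>x _. of_bool (card (dec x) \<ge> 2)) X X ;;
       CIf T (Sub T SC BEST ;; CIf T (Copy BEST SC ;; Copy BV V ;; Cst FND 1) CSkip) CSkip)"

definition branch_color :: "nat \<Rightarrow> cmd" where
  "branch_color a = Get X LR BV ;; Tab T (\<lambda>x _. of_bool (a \<in> dec x)) X X ;;
     CIf T (copy_row LR SP ;; Cst X (enc {a}) ;; Put SP BV X ;; Inc SP) CSkip"

definition find_size :: cmd where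
  "find_size = Cst BEST 1 ;; Cst FND 0 ;;
     For V (Get X LR V ;; Tab SC (\<lambda>x _. card (dec x)) X X ;; Sub T SC BEST ;;
       CIf T (Copy BEST SC ;; Copy BV V ;; Cst FND 1) CSkip)"

definition count_partial :: cmd where
  "count_partial = Cst NP 0 ;;
     For V (Get X LR V ;; Get Y PR V ;;
       Tab T (\<lambda>x y. of_bool (dec y \<noteq> dec x \<and> card (dec y) \<noteq> 1)) X Y ;;
       CIf T (Inc NP ;; Copy PW V) CSkip)"

text \<open>\<open>Min\<close> merely makes the choice of a color definite. The other colors are
  kept in \<open>REM\<close>, which propagation does not touch, unlike \<open>X\<close> and
  \<open>Y\<close>.\<close>

definition try_color :: cmd where
  "try_color = Get X LR BV ;; Tab Y (\<lambda>x _. enc {Min (dec x)}) X X ;;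
     Tab REM (\<lambda>x _. enc (dec x - {Min (dec x)})) X X ;;
     copy_row LR PR ;; Put PR BV Y ;; propagate PR ;; check_empty PR"

text \<open>\<open>T\<close> is 0 exactly if a single list became partial; only then is the second
  child restricted at \<open>PW\<close> as well, while its row still lies at the top of the
  stack.\<close>

definition branch_try :: cmd where
  "branch_try = try_color ;;
     CIf BAD (copy_row LR SP ;; Put SP BV REM ;; Inc SP)
       (count_partial ;; copy_row PR SP ;; Inc SP ;;
        CIf NP (copy_row LR SP ;; Put SP BV REM ;; Sub T NP ONE ;;
          CIf T CSkip (Get X LR PW ;; Get Y PR PW ;; Tab X (\<lambda>x y. enc (dec x - dec y)) X Y ;; Put SP PW X) ;;
          Inc SP) CSkip)"

text \<open>Accepting sets \<open>ANS\<close> but does not stop the search; the flag is never reset,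
  and the stack is emptied in any case.\<close>

definition body :: cmd where
  "body = Sub SP SP ONE ;; copy_row SP LR ;; propagate LR ;; check_empty LR ;;
     CIf BAD CSkip (find_score ;;
       CIf FND (branch_color 0 ;; branch_color 1 ;; branch_color 2)
         (find_size ;; CIf FND branch_try (Cst ANS 1))) ;;
     Sub GO SP BASE"

text \<open>The mask 7 is the full list, so the stack starts with the full assignment in row
  \<open>n + 2\<close>.\<close>

definition init :: cmd where
  "init = Cst ONE 1 ;; Len LR ;; Copy PR LR ;; Inc PR ;; Copy BASE PR ;; Inc BASE ;; Copy SP BASE ;;
     Cst X 7 ;; For V (Put SP V X) ;; Inc SP ;; Cst GO 1"

lemmas cmd_defs = copy_row_def visit_def propagate_def check_empty_def score_one_def find_score_def
  branch_color_def find_size_def count_partial_def try_color_def branch_try_def body_def init_def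

lemma Min_le_card: "card (dec x) \<le> 7" using card_dec_le[of x] by simp

lemma wf_init: "wf_cmd init" by (simp add: cmd_defs)
lemma wf_body: "wf_cmd body" by (simp add: cmd_defs strike_def Min_le_card)

section \<open>Memory frames and copying of rows\<close>

primrec puts :: "cmd \<Rightarrow> bool" where
  "puts CSkip = False"
| "puts (Cst x k) = False"
| "puts (Len x) = False"
| "puts (Copy x y) = False"
| "puts (Inc x) = False"
| "puts (Sub z x y) = False"
| "puts (Tab z g x y) = False"
| "puts (Get x r v) = False"
| "puts (Put r v x) = True"
| "puts (CSeq c d) = (puts c \<or> puts d)"
| "puts (CIf x c d) = (puts c \<or> puts d)"
| "puts (For i c) = puts c"

lemma sem_no_puts: "\<not> puts c \<Longrightarrow> snd (sem n c s) = snd s"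
proof (induction c arbitrary: s)
  case (For i c)
  have "snd (fold (\<lambda>k s. sem n c ((fst s)(i := k), snd s)) ks s) = snd s" for ks s
    by (induction ks arbitrary: s) (use For in auto)
  thus ?case by (simp add: Let_def)
qed auto

lemma copy_row_fst [simp]: "x \<noteq> V \<Longrightarrow> x \<noteq> X \<Longrightarrow> fst (sem n (copy_row a d) s) x = fst s x"
  by (rule sem_frame) (simp add: copy_row_def)

lemma copy_row_snd [simp]:
  assumes "a \<noteq> V" "a \<noteq> X" "d \<noteq> V" "d \<noteq> X" "fst s a \<noteq> fst s d"
  shows "snd (sem n (copy_row a d) s) =
    (snd s)(fst s d := \<lambda>v. if v < n then snd s (fst s a) v else snd s (fst s d) v)"
  unfolding copy_row_def
proof (rule sem_For_rule[where I = "\<lambda>k s'. fst s' a = fst s a \<and> fst s' d = fst s d \<and>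
     snd s' = (snd s)(fst s d := \<lambda>v. if v < k then snd s (fst s a) v else snd s (fst s d) v)"])
  fix k s' assume "k < n" and s': "fst s' a = fst s a \<and> fst s' d = fst s d \<and>
     snd s' = (snd s)(fst s d := \<lambda>v. if v < k then snd s (fst s a) v else snd s (fst s d) v)"
  moreover have "(\<lambda>v. if v < k then snd s (fst s a) v else snd s (fst s d) v)(k := snd s (fst s a) k) =
    (\<lambda>v. if v < Suc k then snd s (fst s a) v else snd s (fst s d) v)"
    by (auto simp: fun_eq_iff)
  ultimately show "fst (sem n (Get X a V ;; Put d V X) ((fst s')(V := k), snd s')) a = fst s a \<and>
    fst (sem n (Get X a V ;; Put d V X) ((fst s')(V := k), snd s')) d = fst s d \<and>
    snd (sem n (Get X a V ;; Put d V X) ((fst s')(V := k), snd s')) =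
     (snd s)(fst s d := \<lambda>v. if v < Suc k then snd s (fst s a) v else snd s (fst s d) v)"
    using assms by simp
qed auto

section \<open>Correctness of the program\<close>

context list_coloring
begin

section \<open>Propagation: its invariants and its implementation\<close>

definition visit_list :: "nat \<Rightarrow> nat \<Rightarrow> (nat \<Rightarrow> nat set) \<Rightarrow> (nat \<Rightarrow> nat set)" where
  "visit_list v w B = (if E v w \<and> card (B v) = 1 then B(w := B w - B v) else B)"

definition settled :: "nat \<Rightarrow> nat \<Rightarrow> (nat \<Rightarrow> nat set) \<Rightarrow> bool" where
  "settled v w B \<longleftrightarrow> (E v w \<longrightarrow> card (B v) = 1 \<longrightarrow> B v \<inter> B w = {})"

text \<open>A pass either has changed nothing, and then all visited pairs are settled, or has struck
  a color. When \<open>S\<close> contains all pairs, the first case says that \<open>B0\<close> is a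
  fixpoint.\<close>

definition pass_inv :: "(nat \<Rightarrow> nat set) \<Rightarrow> (nat \<times> nat) set \<Rightarrow> (nat \<Rightarrow> nat set) \<Rightarrow> bool" where
  "pass_inv B0 S B \<longleftrightarrow> (\<forall>v<n. B v \<subseteq> B0 v) \<and> (\<forall>c. sol B0 c \<longrightarrow> sol B c) \<and> lists B \<and>
     ((B = B0 \<and> (\<forall>(v,w)\<in>S. settled v w B0)) \<or> (size_sum B < size_sum B0 \<and> \<not> stuck B0))"

text \<open>The last conjunct measures progress: until a fixpoint is reached, each of the
  \<open>k\<close> passes has struck a color.\<close>

definition passes_inv :: "(nat \<Rightarrow> nat set) \<Rightarrow> nat \<Rightarrow> (nat \<Rightarrow> nat set) \<Rightarrow> bool" where
  "passes_inv C k B \<longleftrightarrow> (\<forall>v<n. B v \<subseteq> C v) \<and> (\<forall>c. sol C c \<longrightarrow> sol B c) \<and> lists B \<and>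
     (stuck C \<longrightarrow> B = C) \<and> (stuck B \<or> size_sum B + k \<le> size_sum C)"

lemma pass_inv_start: "lists B \<Longrightarrow> pass_inv B {} B"
  by (simp add: pass_inv_def)

text \<open>An unsettled pair loses a color when it is visited, and while \<open>B = B0\<close> it
  also witnesses that \<open>B0\<close> is no fixpoint. The struck color belongs to \<open>v\<close>
  in every solution, so no solution uses it at \<open>w\<close>.\<close>

lemma pass_inv_visit:
  assumes "pass_inv B0 S B" "v < n" "w < n"
  shows "pass_inv B0 (insert (v,w) S) (visit_list v w B)"
proof -
  let ?B = "visit_list v w B"
  have lB: "lists B" using assms by (simp add: pass_inv_def)
  have sub: "?B u \<subseteq> B u" for u by (auto simp: visit_list_def)
  hence l: "lists ?B" using lB by (fastforce simp: lists_def)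
  have sl: "sol B c \<Longrightarrow> sol ?B c" for c
  proof -
    assume c: "sol B c"
    have "c w \<notin> B v" if "E v w" "card (B v) = 1"
    proof -
      have "c v \<in> B v" using c assms(2) by (simp add: sol_def)
      hence "B v = {c v}" using that(2) by (metis card_1_singletonE singletonD)
      moreover have "c v \<noteq> c w" using c that(1) assms by (simp add: sol_def)
      ultimately show ?thesis by simp
    qed
    thus "sol ?B c" using c by (auto simp: sol_def visit_list_def)
  qed
  show ?thesis
  proof (cases "settled v w B")
    case True
    hence "E v w \<Longrightarrow> card (B v) = 1 \<Longrightarrow> B w - B v = B w" by (auto simp: settled_def)
    hence "?B = B" by (simp add: visit_list_def)
    thus ?thesis using assms(1) True unfolding pass_inv_def by auto
  next
    case False
    hence "?B w \<noteq> B w" "\<not> stuck B"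
      using assms by (auto simp: settled_def visit_list_def stuck_def)
    hence "size_sum ?B < size_sum B"
      by (intro size_sum_less[OF lB _ assms(3)]) (use sub in auto)
    moreover have "\<forall>v<n. ?B v \<subseteq> B0 v" "\<forall>c. sol B0 c \<longrightarrow> sol ?B c"
      using sub sl assms(1) by (auto simp: pass_inv_def) blast
    ultimately show ?thesis using assms(1) l \<open>\<not> stuck B\<close> by (auto simp: pass_inv_def)
  qed
qed

text \<open>A complete pass leaves a fixpoint unchanged and shrinks everything else.\<close>

lemma passes_inv_step:
  assumes "passes_inv C k B0" "pass_inv B0 ({..<n} \<times> {..<n}) B"
  shows "passes_inv C (Suc k) B"
proof -
  have "stuck B0 \<longleftrightarrow> (\<forall>(v,w)\<in>{..<n} \<times> {..<n}. settled v w B0)"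
    by (auto simp: stuck_def settled_def)
  hence c: "(B = B0 \<and> stuck B0) \<or> (size_sum B < size_sum B0 \<and> \<not> stuck B0)"
    using assms(2) by (auto simp: pass_inv_def)
  show ?thesis
    using assms c unfolding passes_inv_def pass_inv_def by (smt (verit) Suc_leI add_Suc_right add_mono_thms_linordered_field(1) order_trans)
qed

lemma passes_inv_done:
  assumes "passes_inv C (n * n) B" "lists C" shows "propagated C B"
proof -
  have "size_sum C \<le> (\<Sum>v<n. 3)"
    unfolding size_sum_def using lists_card[OF assms(2)] by (intro sum_mono) auto
  hence "size_sum C \<le> n * 3" by (simp add: mult.commute)
  moreover have "n * 3 < n * n" using n_ge by (intro mult_strict_left_mono) auto
  moreover have "stuck B \<or> size_sum B + n * n \<le> size_sum C" using assms by (simp add: passes_inv_def)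
  ultimately have "stuck B" by linarith
  thus ?thesis using assms by (auto simp: passes_inv_def propagated_def)
qed

definition adj_ok :: "(nat \<Rightarrow> nat \<Rightarrow> nat) \<Rightarrow> bool" where
  "adj_ok M \<longleftrightarrow> (\<forall>v<n. \<forall>w<n. M v w \<noteq> 0 \<longleftrightarrow> E v w)"

lemma adj_ok_upd: "adj_ok M \<Longrightarrow> r \<ge> n \<Longrightarrow> adj_ok (M(r := f))"
  by (auto simp: adj_ok_def)

text \<open>Expresses the invariants of nested loops relative to the state \<open>s\<close> in which
  they started: only the row under propagation may differ.\<close>

definition held :: "cstate \<Rightarrow> nat \<Rightarrow> cstate \<Rightarrow> (nat \<Rightarrow> nat) \<Rightarrow> bool" where
  "held s r s' row \<longleftrightarrow> fst s' r = fst s r \<and> snd s' = (snd s)(fst s r := row)"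

lemma lists_dec: "lists (\<lambda>v. dec (row v))"
  using dec_subset by (simp add: lists_def)

lemma visit_sem:
  assumes "held s r s' row" "adj_ok (snd s)" "fst s r \<ge> n" "r \<notin> {I,J,V,W,D,X,Y}"
    and "v < n" "w < n" "fst s' V = v"
  shows "\<exists>row'. held s r (sem n (visit r) ((fst s')(W := w), snd s')) row' \<and>
    (\<lambda>u. dec (row' u)) = visit_list v w (\<lambda>u. dec (row u))"
proof -
  have E: "snd s v w \<noteq> 0 \<longleftrightarrow> E v w" using assms by (simp add: adj_ok_def)
  have rv: "fst s r \<noteq> v" using assms by simp
  show ?thesis
  proof (cases "E v w")
    case True
    have "held s r (sem n (visit r) ((fst s')(W := w), snd s')) (row(w := strike (min (row v) 7) (min (row w) 7)))"
      using True assms E rv by (auto simp: held_def visit_def)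
    moreover have "(\<lambda>u. dec ((row(w := strike (min (row v) 7) (min (row w) 7))) u))
        = visit_list v w (\<lambda>u. dec (row u))"
      using True by (auto simp: fun_eq_iff visit_list_def strike_def)
    ultimately show ?thesis by blast
  next
    case False
    have "held s r (sem n (visit r) ((fst s')(W := w), snd s')) row"
      using False assms E rv by (auto simp: held_def visit_def)
    thus ?thesis using False by (auto simp: visit_list_def)
  qed
qed

lemma visit_V: "r \<noteq> V \<Longrightarrow> fst (sem n (visit r) s) V = fst s V"
  by (rule sem_frame) (simp add: visit_def)

lemma pass_row_sem:
  assumes "held s r s' row" "adj_ok (snd s)" "fst s r \<ge> n" "r \<notin> {I,J,V,W,D,X,Y}"
    and v: "v < n" "fst s' V = v" and p: "pass_inv B0 ({..<v} \<times> {..<n}) (\<lambda>u. dec (row u))"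
  shows "\<exists>row'. held s r (sem n (For W (visit r)) s') row' \<and>
    pass_inv B0 ({..<Suc v} \<times> {..<n}) (\<lambda>u. dec (row' u))"
proof (rule sem_For_rule[where I = "\<lambda>k s'. fst s' V = v \<and> (\<exists>row. held s r s' row \<and>
     pass_inv B0 ({..<v} \<times> {..<n} \<union> {v} \<times> {..<k}) (\<lambda>u. dec (row u)))"])
  show "fst s' V = v \<and> (\<exists>row. held s r s' row \<and>
     pass_inv B0 ({..<v} \<times> {..<n} \<union> {v} \<times> {..<0}) (\<lambda>u. dec (row u)))"
    using assms by auto
next
  fix k s1 assume k: "k < n" and s1: "fst s1 V = v \<and> (\<exists>row. held s r s1 row \<and>
     pass_inv B0 ({..<v} \<times> {..<n} \<union> {v} \<times> {..<k}) (\<lambda>u. dec (row u)))"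
  then obtain row where row: "held s r s1 row"
    "pass_inv B0 ({..<v} \<times> {..<n} \<union> {v} \<times> {..<k}) (\<lambda>u. dec (row u))" by blast
  obtain row' where row': "held s r (sem n (visit r) ((fst s1)(W := k), snd s1)) row'"
    "(\<lambda>u. dec (row' u)) = visit_list v k (\<lambda>u. dec (row u))"
    using visit_sem[OF row(1) assms(2-4) v(1) k] s1 by blast
  have "insert (v, k) ({..<v} \<times> {..<n} \<union> {v} \<times> {..<k}) = {..<v} \<times> {..<n} \<union> {v} \<times> {..<Suc k}" by auto
  hence "pass_inv B0 ({..<v} \<times> {..<n} \<union> {v} \<times> {..<Suc k}) (\<lambda>u. dec (row' u))"
    using pass_inv_visit[OF row(2) v(1) k] row'(2) by simp
  thus "fst (sem n (visit r) ((fst s1)(W := k), snd s1)) V = v \<and>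
    (\<exists>row. held s r (sem n (visit r) ((fst s1)(W := k), snd s1)) row \<and>
     pass_inv B0 ({..<v} \<times> {..<n} \<union> {v} \<times> {..<Suc k}) (\<lambda>u. dec (row u)))"
    using row' s1 assms(4) by (auto simp: visit_V)
next
  fix s1 assume "fst s1 V = v \<and> (\<exists>row. held s r s1 row \<and>
     pass_inv B0 ({..<v} \<times> {..<n} \<union> {v} \<times> {..<n}) (\<lambda>u. dec (row u)))"
  moreover have "{..<v} \<times> {..<n} \<union> {v} \<times> {..<n} = {..<Suc v} \<times> {..<n}" by auto
  ultimately show "\<exists>row'. held s r ((fst s1)(W := n), snd s1) row' \<and>
     pass_inv B0 ({..<Suc v} \<times> {..<n}) (\<lambda>u. dec (row' u))"
    using assms(4) by (auto simp: held_def)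
qed

lemma pass_sem:
  assumes "held s r s' row" "adj_ok (snd s)" "fst s r \<ge> n" "r \<notin> {I,J,V,W,D,X,Y}"
    and "passes_inv C k (\<lambda>u. dec (row u))"
  shows "\<exists>row'. held s r (sem n (For V (For W (visit r))) s') row' \<and> passes_inv C (Suc k) (\<lambda>u. dec (row' u))"
proof -
  let ?B0 = "\<lambda>u. dec (row u)"
  have "\<exists>row'. held s r (sem n (For V (For W (visit r))) s') row' \<and>
    pass_inv ?B0 ({..<n} \<times> {..<n}) (\<lambda>u. dec (row' u))"
  proof (rule sem_For_rule[where I = "\<lambda>v s'. \<exists>row'. held s r s' row' \<and>
      pass_inv ?B0 ({..<v} \<times> {..<n}) (\<lambda>u. dec (row' u))"])
    show "\<exists>row'. held s r s' row' \<and> pass_inv ?B0 ({..<0} \<times> {..<n}) (\<lambda>u. dec (row' u))"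
      using assms(1) pass_inv_start[OF lists_dec] by auto
  next
    fix v s1 assume v: "v < n" and "\<exists>row'. held s r s1 row' \<and> pass_inv ?B0 ({..<v} \<times> {..<n}) (\<lambda>u. dec (row' u))"
    then obtain row1 where row1: "held s r s1 row1" "pass_inv ?B0 ({..<v} \<times> {..<n}) (\<lambda>u. dec (row1 u))" by blast
    have "held s r ((fst s1)(V := v), snd s1) row1" using row1 assms(4) by (simp add: held_def)
    from pass_row_sem[OF this assms(2-4) v _ row1(2)]
    show "\<exists>row'. held s r (sem n (For W (visit r)) ((fst s1)(V := v), snd s1)) row' \<and>
      pass_inv ?B0 ({..<Suc v} \<times> {..<n}) (\<lambda>u. dec (row' u))" by (simp del: sem.simps)
  qed (use assms(4) in \<open>auto simp: held_def\<close>)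
  thus ?thesis using passes_inv_step[OF assms(5)] by blast
qed

text \<open>The two outer loops are a mere counter: in round \<open>j\<close> of block
  \<open>i\<close>, exactly \<open>i * n + j\<close> passes are complete.\<close>

lemma propagate_sem:
  assumes "adj_ok (snd s)" "fst s r \<ge> n" "r \<notin> {I,J,V,W,D,X,Y}"
  shows "\<exists>row. snd (sem n (propagate r) s) = (snd s)(fst s r := row) \<and>
    propagated (\<lambda>u. dec (snd s (fst s r) u)) (\<lambda>u. dec (row u))"
proof -
  let ?C = "\<lambda>u. dec (snd s (fst s r) u)"
  have C0: "passes_inv ?C 0 ?C" using lists_dec by (simp add: passes_inv_def)
  have "\<exists>row. held s r (sem n (propagate r) s) row \<and> passes_inv ?C (n * n) (\<lambda>u. dec (row u))"
    unfolding propagate_def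
  proof (rule sem_For_rule[where I = "\<lambda>i s'. \<exists>row. held s r s' row \<and> passes_inv ?C (i * n) (\<lambda>u. dec (row u))"])
    have "held s r s (snd s (fst s r))" by (simp add: held_def)
    thus "\<exists>row. held s r s row \<and> passes_inv ?C (0 * n) (\<lambda>u. dec (row u))"
      using C0 by auto
  next
    fix i s1 assume "\<exists>row. held s r s1 row \<and> passes_inv ?C (i * n) (\<lambda>u. dec (row u))"
    then obtain row1 where row1: "held s r s1 row1" "passes_inv ?C (i * n) (\<lambda>u. dec (row1 u))" by blast
    show "\<exists>row. held s r (sem n (For J (For V (For W (visit r)))) ((fst s1)(I := i), snd s1)) row \<and>
       passes_inv ?C (Suc i * n) (\<lambda>u. dec (row u))"
    proof (rule sem_For_rule[where I = "\<lambda>j s'. \<exists>row. held s r s' row \<and> passes_inv ?C (i * n + j) (\<lambda>u. dec (row u))"])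
      show "\<exists>row. held s r ((fst s1)(I := i), snd s1) row \<and> passes_inv ?C (i * n + 0) (\<lambda>u. dec (row u))"
        using row1 assms(3) by (auto simp: held_def)
    next
      fix j s2 assume "\<exists>row. held s r s2 row \<and> passes_inv ?C (i * n + j) (\<lambda>u. dec (row u))"
      then obtain row2 where row2: "held s r s2 row2" "passes_inv ?C (i * n + j) (\<lambda>u. dec (row2 u))" by blast
      have "held s r ((fst s2)(J := j), snd s2) row2" using row2 assms(3) by (simp add: held_def)
      from pass_sem[OF this assms row2(2)]
      show "\<exists>row. held s r (sem n (For V (For W (visit r))) ((fst s2)(J := j), snd s2)) row \<and>
         passes_inv ?C (i * n + Suc j) (\<lambda>u. dec (row u))" by (simp del: sem.simps)
    next
      fix s2 assume "\<exists>row. held s r s2 row \<and> passes_inv ?C (i * n + n) (\<lambda>u. dec (row u))"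
      thus "\<exists>row. held s r ((fst s2)(J := n), snd s2) row \<and> passes_inv ?C (Suc i * n) (\<lambda>u. dec (row u))"
        using assms(3) by (auto simp: held_def add.commute)
    qed
  qed (use assms(3) in \<open>auto simp: held_def\<close>)
  thus ?thesis using passes_inv_done[OF _ lists_dec] by (auto simp: held_def)
qed

lemma propagate_fst: "x \<notin> {I,J,V,W,D,X,Y} \<Longrightarrow> fst (sem n (propagate r) s) x = fst s x"
  by (rule sem_frame) (simp add: propagate_def visit_def)

section \<open>The stack and the subroutines of the main loop\<close>

lemma check_empty_snd: "snd (sem n (check_empty r) s) = snd s"
  by (rule sem_no_puts) (simp add: check_empty_def)

lemma check_empty_fst: "x \<notin> {V,X,T,BAD} \<Longrightarrow> fst (sem n (check_empty r) s) x = fst s x"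
  by (rule sem_frame) (simp add: check_empty_def)

lemma check_empty_sem:
  assumes "r \<notin> {V,X,T,BAD}"
  shows "fst (sem n (check_empty r) s) BAD = 0 \<longleftrightarrow> all_ne (\<lambda>v. dec (snd s (fst s r) v))"
  unfolding check_empty_def sem.simps(10)
proof (rule sem_For_rule[where I = "\<lambda>k s'. snd s' = snd s \<and> fst s' r = fst s r \<and>
    (fst s' BAD = 0 \<longleftrightarrow> (\<forall>v<k. dec (snd s (fst s r) v) \<noteq> {}))"])
  fix k s' assume "k < n" "snd s' = snd s \<and> fst s' r = fst s r \<and>
    (fst s' BAD = 0 \<longleftrightarrow> (\<forall>v<k. dec (snd s (fst s r) v) \<noteq> {}))"
  thus "snd (sem n (Get X r V;; (Tab T (\<lambda>x _. of_bool (dec x = {})) X X;; CIf T (Cst BAD 1) CSkip)) ((fst s')(V := k), snd s')) = snd s \<and>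
    fst (sem n (Get X r V;; (Tab T (\<lambda>x _. of_bool (dec x = {})) X X;; CIf T (Cst BAD 1) CSkip)) ((fst s')(V := k), snd s')) r = fst s r \<and>
    (fst (sem n (Get X r V;; (Tab T (\<lambda>x _. of_bool (dec x = {})) X X;; CIf T (Cst BAD 1) CSkip)) ((fst s')(V := k), snd s')) BAD = 0 \<longleftrightarrow>
      (\<forall>v<Suc k. dec (snd s (fst s r) v) \<noteq> {}))"
    using assms by (auto simp: less_Suc_eq)
qed (use assms in \<open>auto simp: all_ne_def\<close>)

text \<open>The top of the stack is the end of \<open>fs\<close>. Rows are compared only after
  decoding and on columns below \<open>n\<close>; the two work rows are unconstrained.\<close>

definition stack_inv :: "cstate \<Rightarrow> (nat \<Rightarrow> nat set) list \<Rightarrow> bool" where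
  "stack_inv s fs \<longleftrightarrow> adj_ok (snd s) \<and> fst s LR = n \<and> fst s PR = Suc n \<and> fst s BASE = n + 2 \<and>
     fst s ONE = 1 \<and> fst s SP = n + 2 + length fs \<and>
     (\<forall>j<length fs. \<forall>v<n. dec (snd s (n + 2 + j) v) = (fs ! j) v)"

lemma stack_inv_mono:
  assumes "stack_inv s fs" "\<And>x. x \<in> {SP,BASE,LR,PR,ONE} \<Longrightarrow> fst s' x = fst s x"
    and "\<And>r. r \<noteq> n \<Longrightarrow> r \<noteq> Suc n \<Longrightarrow> r < n + 2 + length fs \<Longrightarrow> snd s' r = snd s r"
  shows "stack_inv s' fs"
  using assms by (auto simp: stack_inv_def adj_ok_def)

lemma stack_inv_pop:
  assumes "stack_inv s (fs @ [C])" "fst s' SP = fst s SP - 1" "snd s' = snd s"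
    "\<And>x. x \<in> {BASE,LR,PR,ONE} \<Longrightarrow> fst s' x = fst s x"
  shows "stack_inv s' fs" "\<forall>v<n. dec (snd s' (fst s' SP) v) = C v"
  using assms by (auto simp: stack_inv_def nth_append less_Suc_eq)

lemma stack_inv_push:
  assumes "stack_inv s fs" "fst s' SP = Suc (fst s SP)"
    and "\<And>x. x \<in> {BASE,LR,PR,ONE} \<Longrightarrow> fst s' x = fst s x"
    and "\<And>r. r < n + 2 + length fs \<Longrightarrow> snd s' r = snd s r"
    and "\<And>v. v < n \<Longrightarrow> dec (snd s' (fst s SP) v) = A v"
  shows "stack_inv s' (fs @ [A])"
proof -
  have "snd s' (n + 2 + j) = snd s (n + 2 + j)" if "j < length fs" for j
    using that by (intro assms(4)) simp
  moreover have "adj_ok (snd s')" using assms(1,4) by (auto simp: stack_inv_def adj_ok_def)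
  moreover have "dec (snd s' (n + 2 + j) v) = ((fs @ [A]) ! j) v" if "j < length (fs @ [A])" "v < n" for j v
  proof (cases "j < length fs")
    case True
    thus ?thesis using calculation(1) assms(1) that by (simp add: stack_inv_def nth_append)
  next
    case False
    hence "j = length fs" using that by simp
    thus ?thesis using assms(1,5) that by (simp add: stack_inv_def)
  qed
  ultimately show ?thesis using assms(1-3) by (simp add: stack_inv_def)
qed

text \<open>Decoding yields colors below 3 whatever number is stored, so this needs no invariant of
  its own.\<close>

lemma stack_inv_lists:
  assumes "stack_inv s fs" "A \<in> set fs" shows "lists A"
proof -
  obtain j where "j < length fs" "fs ! j = A" using assms(2) by (auto simp: in_set_conv_nth)
  thus ?thesis using assms(1) dec_subset unfolding stack_inv_def lists_def by metis
qed

definition row_list :: "cstate \<Rightarrow> nat \<Rightarrow> (nat \<Rightarrow> nat set)" where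
  "row_list s r = (\<lambda>v. dec (snd s r v))"

lemma score_one_sem:
  assumes "adj_ok (snd s)" "fst s LR = n" "fst s V = v" "v < n"
  shows "fst (sem n score_one s) SC = score (row_list s n) v \<and> fst (sem n score_one s) X = snd s n v"
proof -
  let ?A = "row_list s n"
  let ?S = "\<lambda>k. of_bool (card (?A v) = 2) + card (nbrs v \<inter> threes ?A \<inter> {..<k})"
  have full: "nbrs v \<inter> threes ?A \<inter> {..<n} = nbrs v \<inter> threes ?A" by (auto simp: nbrs_def)
  show ?thesis
    unfolding score_one_def sem.simps(10)
  proof (rule sem_For_rule[where I = "\<lambda>k s'. snd s' = snd s \<and> fst s' LR = n \<and> fst s' V = v \<and>
      fst s' X = snd s n v \<and> fst s' SC = ?S k"], goal_cases)
    case 1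
    show ?case using assms by (simp add: row_list_def)
  next
    case (2 k s')
    hence k: "k < n" and s': "snd s' = snd s" "fst s' LR = n" "fst s' V = v" "fst s' X = snd s n v" "fst s' SC = ?S k"
      by auto
    have E: "snd s v k \<noteq> 0 \<longleftrightarrow> E v k" using assms k by (simp add: adj_ok_def)
    have "nbrs v \<inter> threes ?A \<inter> {..<Suc k} =
       (if E v k \<and> card (?A k) = 3 then insert k (nbrs v \<inter> threes ?A \<inter> {..<k}) else nbrs v \<inter> threes ?A \<inter> {..<k})"
      using k by (auto simp: nbrs_def threes_def less_Suc_eq)
    hence "?S (Suc k) = ?S k + of_bool (E v k \<and> card (?A k) = 3)" by simp
    thus ?case using s' k E assms by (auto simp: row_list_def)
  next
    case (3 s')
    thus ?case by (simp add: score_def full)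
  qed
qed

lemma score_one_frame: "x \<notin> {X,SC,W,D,Y} \<Longrightarrow> fst (sem n score_one s) x = fst s x"
  "snd (sem n score_one s) = snd s"
  by (rule sem_frame, simp add: score_one_def) (rule sem_no_puts, simp add: score_one_def)

lemma find_score_frame: "x \<notin> {X,SC,W,D,Y,V,T,BEST,BV,FND} \<Longrightarrow> fst (sem n find_score s) x = fst s x"
  "snd (sem n find_score s) = snd s"
  by (rule sem_frame, simp add: find_score_def score_one_def)
    (rule sem_no_puts, simp add: find_score_def score_one_def)

text \<open>As long as \<open>FND\<close> is 0, \<open>BEST\<close> still has its starting value 3,
  and \<open>BEST\<close> bounds the scores of all undecided vertices seen so far.\<close>

lemma find_score_sem:
  fixes s defines "A \<equiv> row_list s n" and "s1 \<equiv> sem n find_score s"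
  assumes "adj_ok (snd s)" "fst s LR = n"
  shows "if fst s1 FND = 0 then \<forall>w<n. card (A w) \<ge> 2 \<longrightarrow> score A w \<le> 3
    else fst s1 BV < n \<and> card (A (fst s1 BV)) \<ge> 2 \<and> score A (fst s1 BV) \<ge> 4 \<and>
      (\<forall>w<n. card (A w) \<ge> 2 \<longrightarrow> score A w \<le> score A (fst s1 BV))"
  unfolding s1_def find_score_def sem.simps(10)
proof (rule sem_For_rule[where I = "\<lambda>k s'. snd s' = snd s \<and> fst s' LR = n \<and> fst s' BEST \<ge> 3 \<and>
    (\<forall>w<k. card (A w) \<ge> 2 \<longrightarrow> score A w \<le> fst s' BEST) \<and> (fst s' FND = 0 \<longrightarrow> fst s' BEST = 3) \<and>
    (fst s' FND \<noteq> 0 \<longrightarrow> fst s' BV < n \<and> card (A (fst s' BV)) \<ge> 2 \<and> score A (fst s' BV) = fst s' BEST \<and>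
      fst s' BEST \<ge> 4)"], goal_cases)
  case 1
  show ?case using assms by simp
next
  case (2 k s')
  define s2 where "s2 = sem n score_one ((fst s')(V := k), snd s')"
  have r: "row_list ((fst s')(V := k), snd s') n = A" using 2 by (simp add: A_def row_list_def)
  have s2: "fst s2 SC = score A k" "fst s2 X = snd s n k" "snd s2 = snd s"
    "\<And>x. x \<notin> {X,SC,W,D,Y,V} \<Longrightarrow> fst s2 x = fst s' x" "fst s2 V = k"
    using score_one_sem[of "((fst s')(V := k), snd s')" k] 2 assms r
    by (simp_all add: s2_def score_one_frame)
  have "card (dec (snd s n k)) = card (A k)" by (simp add: A_def row_list_def)
  thus ?case using 2 s2 unfolding sem.simps(10) s2_def[symmetric]
    by (auto simp: less_Suc_eq)
next
  case (3 s')
  thus ?case by auto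
qed

lemma branch_color_sem:
  fixes s a defines "s1 \<equiv> sem n (branch_color a) s"
  assumes A_def: "row_list s n = A" and v_def: "fst s BV = v" and "stack_inv s fs" "v < n" "a \<in> {0,1,2}"
  shows "stack_inv s1 (fs @ (if a \<in> A v then [A(v := {a})] else []))" "row_list s1 n = A"
    "fst s1 BV = v" "fst s1 ANS = fst s ANS"
proof -
  have d: "dec (enc {a}) = {a}" using assms by (intro dec_enc) auto
  have r: "fst s LR = n" "fst s SP = n + 2 + length fs" "A u = dec (snd s n u)" for u
    using assms by (auto simp: stack_inv_def A_def[symmetric] row_list_def)
  show "stack_inv s1 (fs @ (if a \<in> A v then [A(v := {a})] else []))"
  proof (cases "a \<in> A v")
    case True
    have "stack_inv s1 (fs @ [A(v := {a})])"
      by (rule stack_inv_push[OF assms(4)])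
        (use True r d assms(5) in \<open>auto simp: s1_def branch_color_def v_def\<close>)
    thus ?thesis using True by simp
  next
    case False
    have "stack_inv s1 fs"
      by (rule stack_inv_mono[OF assms(4)])
        (use False r d assms(5) in \<open>auto simp: s1_def branch_color_def v_def\<close>)
    thus ?thesis using False by simp
  qed
  show "row_list s1 n = A" "fst s1 BV = v" "fst s1 ANS = fst s ANS"
    using r assms(5) by (auto simp: s1_def branch_color_def v_def row_list_def A_def[symmetric])
qed

lemma find_size_frame: "x \<notin> {X,SC,V,T,BEST,BV,FND} \<Longrightarrow> fst (sem n find_size s) x = fst s x"
  "snd (sem n find_size s) = snd s"
  by (rule sem_frame, simp add: find_size_def) (rule sem_no_puts, simp add: find_size_def)

lemma find_size_sem:
  fixes s defines "A \<equiv> row_list s n" and "s1 \<equiv> sem n find_size s"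
  assumes "fst s LR = n"
  shows "if fst s1 FND = 0 then \<forall>w<n. card (A w) \<le> 1
    else fst s1 BV < n \<and> card (A (fst s1 BV)) \<ge> 2 \<and> (\<forall>w<n. card (A w) \<le> card (A (fst s1 BV)))"
  unfolding s1_def find_size_def sem.simps(10)
proof (rule sem_For_rule[where I = "\<lambda>k s'. snd s' = snd s \<and> fst s' LR = n \<and> fst s' BEST \<ge> 1 \<and>
    (\<forall>w<k. card (A w) \<le> fst s' BEST) \<and> (fst s' FND = 0 \<longrightarrow> fst s' BEST = 1) \<and>
    (fst s' FND \<noteq> 0 \<longrightarrow> fst s' BV < n \<and> card (A (fst s' BV)) = fst s' BEST \<and> fst s' BEST \<ge> 2)"], goal_cases)
  case 1
  show ?case using assms by simp
next
  case (2 k s')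
  have "dec (snd s n k) = A k" by (simp add: A_def row_list_def)
  thus ?case using 2 by (auto simp: less_Suc_eq)
next
  case (3 s')
  thus ?case by auto
qed

lemma count_partial_frame: "x \<notin> {X,Y,V,T,NP,PW} \<Longrightarrow> fst (sem n count_partial s) x = fst s x"
  "snd (sem n count_partial s) = snd s"
  by (rule sem_frame, simp add: count_partial_def) (rule sem_no_puts, simp add: count_partial_def)

lemma count_partial_sem:
  fixes s defines "P \<equiv> partial (row_list s n) (row_list s (Suc n))" and "s1 \<equiv> sem n count_partial s"
  assumes "fst s LR = n" "fst s PR = Suc n"
  shows "fst s1 NP = card P \<and> (P \<noteq> {} \<longrightarrow> fst s1 PW \<in> P)"
  unfolding s1_def count_partial_def sem.simps(10)
proof (rule sem_For_rule[where I = "\<lambda>k s'. snd s' = snd s \<and> fst s' LR = n \<and> fst s' PR = Suc n \<and>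
    fst s' NP = card (P \<inter> {..<k}) \<and> (P \<inter> {..<k} \<noteq> {} \<longrightarrow> fst s' PW \<in> P)"], goal_cases)
  case 1
  show ?case using assms by simp
next
  case (2 k s')
  have P: "k \<in> P \<longleftrightarrow> dec (snd s (Suc n) k) \<noteq> dec (snd s n k) \<and> card (dec (snd s (Suc n) k)) \<noteq> 1"
    using 2 by (auto simp: P_def partial_def row_list_def)
  have "P \<inter> {..<Suc k} = (if k \<in> P then insert k (P \<inter> {..<k}) else P \<inter> {..<k})"
    by (auto simp: less_Suc_eq)
  moreover have "finite (P \<inter> {..<k})" by simp
  ultimately show ?case using 2 P by (auto simp: split: if_splits)
next
  case (3 s')
  moreover have "P \<inter> {..<n} = P" by (auto simp: P_def partial_def)
  ultimately show ?case by simp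
qed

text \<open>Bridges between stack entries and decoded rows, which agree only below
  \<open>n\<close>.\<close>

lemma propagated_cong:
  assumes "propagated C B" "\<And>v. v < n \<Longrightarrow> C v = C' v" shows "propagated C' B"
proof -
  have "sol C c = sol C' c" "stuck C = stuck C'" for c
    using assms(2) by (auto simp: sol_def stuck_def)
  thus ?thesis using assms by (simp add: propagated_def)
qed

lemma try_color_sem:
  fixes s defines "A \<equiv> row_list s n" and "v \<equiv> fst s BV" and "s1 \<equiv> sem n try_color s"
  defines "a \<equiv> Min (A v)"
  assumes st: "stack_inv s fs" and v: "v < n" "A v \<noteq> {}"
  shows "stack_inv s1 fs" "row_list s1 n = A" "fst s1 BV = v" "fst s1 ANS = fst s ANS"
    "propagated (A(v := {a})) (row_list s1 (Suc n))" "dec (fst s1 REM) = A v - {a}"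
    "fst s1 BAD = 0 \<longleftrightarrow> all_ne (row_list s1 (Suc n))"
proof -
  have r: "fst s LR = n" "fst s PR = Suc n" using st by (auto simp: stack_inv_def)
  have dv: "dec (snd s n v) = A v" by (simp add: A_def row_list_def)
  have "a \<in> A v" unfolding a_def using v(2) dv by (intro Min_in) (metis finite_dec)
  hence da: "dec (enc {a}) = {a}" using dec_subset[of "snd s n v"] dv by (intro dec_enc) auto
  have dA: "dec (enc (A v - Z)) = A v - Z" for Z using dec_enc_dec(2)[of "snd s n v" Z] dv by simp
  define s0 where "s0 = sem n (Get X LR BV ;; Tab Y (\<lambda>x _. enc {Min (dec x)}) X X ;;
     Tab REM (\<lambda>x _. enc (dec x - {Min (dec x)})) X X ;; copy_row LR PR ;; Put PR BV Y) s"
  have s0: "fst s0 x = fst s x" if "x \<notin> {X,Y,REM,V}" for x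
    using that by (simp add: s0_def)
  have s0R: "dec (fst s0 REM) = A v - {a}"
    using r v by (simp add: s0_def v_def[symmetric] dv dA a_def)
  have s0M: "snd s0 = (snd s)(Suc n := snd s0 (Suc n))"
    using r v by (simp add: s0_def v_def[symmetric])
  have s0P: "dec (snd s0 (Suc n) u) = (A(v := {a})) u" if "u < n" for u
    using r v that da by (simp add: s0_def v_def[symmetric] dv a_def) (simp add: A_def row_list_def)
  have st0: "stack_inv s0 fs"
    by (rule stack_inv_mono[OF st]) (use s0 in auto, subst s0M, simp)
  have r0: "fst s0 LR = n" "fst s0 PR = Suc n" "adj_ok (snd s0)" using st0 by (auto simp: stack_inv_def)
  define s2 where "s2 = sem n (propagate PR) s0"
  obtain row where row: "snd s2 = (snd s0)(Suc n := row)"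
    "propagated (\<lambda>u. dec (snd s0 (Suc n) u)) (\<lambda>u. dec (row u))"
    using propagate_sem[of s0 PR] r0 by (auto simp: s2_def)
  have s1: "s1 = sem n (check_empty PR) s2" by (simp add: s1_def s2_def s0_def try_color_def)
  have M1: "snd s1 = (snd s0)(Suc n := row)" unfolding s1 by (simp add: check_empty_snd row)
  have R1: "fst s1 x = fst s0 x" if "x \<notin> {I,J,V,W,D,X,Y,T,BAD}" for x
    using that by (simp add: s1 s2_def check_empty_fst propagate_fst)
  show "stack_inv s1 fs" by (rule stack_inv_mono[OF st0]) (auto simp: R1 M1)
  show "row_list s1 n = A"
    unfolding row_list_def M1 by (subst s0M) (simp add: A_def row_list_def)
  show "fst s1 BV = v" "fst s1 ANS = fst s ANS" "dec (fst s1 REM) = A v - {a}"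
    using s0R by (simp_all add: R1 s0 v_def)
  have B: "row_list s1 (Suc n) = (\<lambda>u. dec (row u))" by (simp add: row_list_def M1)
  show "propagated (A(v := {a})) (row_list s1 (Suc n))"
    unfolding B by (rule propagated_cong[OF row(2)]) (rule s0P)
  have "fst s2 PR = Suc n" using r0 by (simp add: s2_def propagate_fst)
  thus "fst s1 BAD = 0 \<longleftrightarrow> all_ne (row_list s1 (Suc n))"
    unfolding s1 using check_empty_sem[of PR s2] by (simp add: row_list_def check_empty_snd)
qed

lemma branch_try_sem:
  fixes s defines "A \<equiv> row_list s n" and "v \<equiv> fst s BV" and "s1 \<equiv> sem n branch_try s"
  assumes st: "stack_inv s fs" and CA: "propagated C A" "lists C" "all_ne A"
    and low: "\<And>w. w < n \<Longrightarrow> card (A w) \<ge> 2 \<Longrightarrow> score A w \<le> 3"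
    and v: "v < n" "card (A v) \<ge> 2" "\<And>w. w < n \<Longrightarrow> card (A w) \<le> card (A v)"
  shows "\<exists>Bs. stack_inv s1 (fs @ Bs) \<and> good_step C False Bs \<and> fst s1 ANS = fst s ANS"
proof -
  define a where "a = Min (A v)"
  have ne: "A v \<noteq> {}" using v by auto
  have a: "a \<in> A v" unfolding a_def using ne by (intro Min_in) (auto simp: A_def row_list_def)
  define s2 where "s2 = sem n try_color s"
  define B where "B = row_list s2 (Suc n)"
  note tc = try_color_sem[OF st, folded A_def v_def s2_def a_def, OF v(1) ne, folded a_def B_def]
  note ctx = CA low v a tc(5)
  have r2: "fst s2 LR = n" "fst s2 PR = Suc n" "fst s2 SP = n + 2 + length fs" "fst s2 ONE = 1"
    using tc(1) by (auto simp: stack_inv_def)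
  have A2: "dec (snd s2 n u) = A u" for u using tc(2) by (simp add: row_list_def fun_eq_iff)
  have B2: "dec (snd s2 (Suc n) u) = B u" for u by (simp add: row_list_def B_def)
  show ?thesis
  proof (cases "fst s2 BAD = 0")
    case False
    have s1: "s1 = sem n (copy_row LR SP ;; Put SP BV REM ;; Inc SP) s2"
      using False by (simp add: s1_def branch_try_def s2_def)
    have "stack_inv s1 (fs @ [A(v := A v - {a})])"
      by (rule stack_inv_push[OF tc(1)]) (use r2 tc v A2 in \<open>auto simp: s1\<close>)
    moreover have "fst s1 ANS = fst s ANS" using tc by (simp add: s1)
    moreover have nb: "\<not> all_ne B" using False tc(7) by metis
    have "good_step C False [A(v := A v - {a})]"
      by (rule good_conflict[OF ctx nb])
    ultimately show ?thesis by blast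
  next
    case True
    hence neB: "all_ne B" using tc(7) True by blast
    define s3 where "s3 = sem n count_partial s2"
    define P where "P = partial A B"
    have s3: "fst s3 NP = card P" "P \<noteq> {} \<Longrightarrow> fst s3 PW \<in> P" "snd s3 = snd s2"
      "\<And>x. x \<notin> {X,Y,V,T,NP,PW} \<Longrightarrow> fst s3 x = fst s2 x"
      using count_partial_sem[of s2] count_partial_frame tc(2) r2
      by (simp_all add: s3_def P_def B_def)
    define s4 where "s4 = sem n (copy_row PR SP ;; Inc SP) s3"
    have s4: "fst s4 x = fst s3 x" if "x \<notin> {V,X,SP}" for x using that by (simp add: s4_def)
    have s4P: "fst s4 SP = Suc (n + 2 + length fs)" using s3(4) r2 by (simp add: s4_def)
    have s4M: "snd s4 = (snd s2)(n + 2 + length fs := \<lambda>u. if u < n then snd s2 (Suc n) u else snd s2 (n + 2 + length fs) u)"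
      using s3(3,4) r2 by (simp add: s4_def cong: if_cong)
    have st4: "stack_inv s4 (fs @ [B])"
      by (rule stack_inv_push[OF tc(1)]) (use r2 s4P s4 s3(4) B2 in \<open>auto simp: s4M\<close>)
    have s1: "s1 = sem n (CIf NP (copy_row LR SP ;; Put SP BV REM ;; Sub T NP ONE ;;
          CIf T CSkip (Get X LR PW ;; Get Y PR PW ;; Tab X (\<lambda>x y. enc (dec x - dec y)) X Y ;; Put SP PW X) ;;
          Inc SP) CSkip) s4"
      using True by (simp add: s1_def branch_try_def s2_def s3_def s4_def)
    have r4: "fst s4 LR = n" "fst s4 PR = Suc n" "fst s4 ONE = 1" "fst s4 NP = card P" "fst s4 PW = fst s3 PW"
      "fst s4 BV = v" "dec (fst s4 REM) = A v - {a}" "fst s4 ANS = fst s ANS"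
      using s4 s3 r2 tc by auto
    \<comment> \<open>Pushing \<open>B\<close> changed only a stack row, so both work rows are still
      available for the second child.\<close>
    have A4: "dec (snd s4 n u) = A u" "dec (snd s4 (Suc n) u) = B u" for u
      using A2 B2 by (simp_all add: s4M)
    have dA: "dec (enc (A u - Z)) = A u - Z" for u Z by (simp add: A_def row_list_def)
    have ans: "fst s1 ANS = fst s ANS" using r4 by (simp add: s1)
    consider "P = {}" | "card P = 1" | "card P \<ge> 2"
    proof -
      have "card P = 0 \<or> card P = 1 \<or> card P \<ge> 2" by linarith
      thus ?thesis using that by (auto simp: P_def)
    qed
    thus ?thesis
    proof cases
      case 1
      hence "s1 = s4" using r4 by (simp add: s1)
      thus ?thesis using st4 good_autarky[OF ctx neB] 1 ans by (auto simp: P_def)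
    next
      case 2
      then obtain w where w: "P = {w}" by (auto simp: card_Suc_eq)
      hence pw: "fst s3 PW = w" using s3(2) by auto
      have wv: "w < n" "w \<noteq> v" using w v_partial[OF ctx neB] by (auto simp: P_def partial_def)
      have "stack_inv s1 ((fs @ [B]) @ [A(v := A v - {a}, w := A w - B w)])"
        by (rule stack_inv_push[OF st4])
          (use r4 A4 s4P pw 2 wv v dA in \<open>auto simp: s1\<close>)
      moreover have "good_step C False [B, A(v := A v - {a}, w := A w - B w)]"
        using good_one[OF ctx neB] w by (simp add: P_def)
      ultimately show ?thesis using ans by auto
    next
      case 3
      have "stack_inv s1 ((fs @ [B]) @ [A(v := A v - {a})])"
        by (rule stack_inv_push[OF st4])
          (use r4 A4 s4P 3 v in \<open>auto simp: s1\<close>)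
      moreover have "good_step C False [B, A(v := A v - {a})]"
        using good_many[OF ctx neB] 3 by (simp add: P_def)
      ultimately show ?thesis using ans by auto
    qed
  qed
qed

text \<open>Each path through the body corresponds to one of the \<open>good_\<close> lemmas: an
  empty list, a vertex of high score, only single colors, or a tentative coloring.\<close>

lemma body_sem:
  fixes s defines "s1 \<equiv> sem n body s"
  assumes st: "stack_inv s (fs @ [C])"
  shows "\<exists>acc Bs. stack_inv s1 (fs @ Bs) \<and> good_step C acc Bs \<and>
    (fst s1 ANS \<noteq> 0 \<longleftrightarrow> fst s ANS \<noteq> 0 \<or> acc) \<and> fst s1 GO = length (fs @ Bs)"
proof -
  have lC: "lists C" using stack_inv_lists[OF st] by simp
  define s2 where "s2 = sem n (Sub SP SP ONE) s"
  have one: "fst s ONE = 1" using st by (simp add: stack_inv_def)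
  have st2: "stack_inv s2 fs" by (rule stack_inv_pop(1)[OF st]) (auto simp: s2_def one)
  have C2: "\<forall>v<n. dec (snd s2 (fst s2 SP) v) = C v"
    by (rule stack_inv_pop(2)[OF st]) (auto simp: s2_def one)
  have r2: "fst s2 LR = n" "fst s2 SP = n + 2 + length fs" using st2 by (auto simp: stack_inv_def)
  define s3 where "s3 = sem n (copy_row SP LR) s2"
  have st3: "stack_inv s3 fs"
    by (rule stack_inv_mono[OF st2]) (use r2 in \<open>auto simp: s3_def\<close>)
  have C3: "dec (snd s3 n v) = C v" if "v < n" for v
    using r2 C2 that by (simp add: s3_def)
  have r3: "fst s3 LR = n" "adj_ok (snd s3)" using st3 by (auto simp: stack_inv_def)
  define s4 where "s4 = sem n (propagate LR) s3"
  obtain row where row: "snd s4 = (snd s3)(n := row)"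
    "propagated (\<lambda>u. dec (snd s3 n u)) (\<lambda>u. dec (row u))"
    using propagate_sem[of s3 LR] r3 by (auto simp: s4_def)
  have st4: "stack_inv s4 fs"
    by (rule stack_inv_mono[OF st3]) (use row in \<open>auto simp: s4_def propagate_fst\<close>)
  define A where "A = row_list s4 n"
  have CA: "propagated C A"
    unfolding A_def row_list_def using propagated_cong[OF row(2)] C3 row(1) by simp
  define s5 where "s5 = sem n (check_empty LR) s4"
  have st5: "stack_inv s5 fs"
    by (rule stack_inv_mono[OF st4]) (auto simp: s5_def check_empty_fst check_empty_snd)
  have A5: "row_list s5 n = A" by (simp add: A_def row_list_def s5_def check_empty_snd)
  have r5: "fst s5 LR = n" "adj_ok (snd s5)" using st5 by (auto simp: stack_inv_def)
  have bad: "fst s5 BAD = 0 \<longleftrightarrow> all_ne A"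
    using check_empty_sem[of LR s4] st4 by (simp add: s5_def A_def row_list_def stack_inv_def)
  have ans5: "fst s5 ANS = fst s ANS"
    by (simp add: s5_def s4_def s3_def s2_def check_empty_fst propagate_fst)
  define step where "step = CIf BAD CSkip (find_score ;;
       CIf FND (branch_color 0 ;; branch_color 1 ;; branch_color 2)
         (find_size ;; CIf FND branch_try (Cst ANS 1)))"
  define s6 where "s6 = sem n step s5"
  have s1: "s1 = sem n (Sub GO SP BASE) s6"
    by (simp add: s1_def s6_def s5_def s4_def s3_def s2_def body_def step_def)
  have "\<exists>acc Bs. stack_inv s6 (fs @ Bs) \<and> good_step C acc Bs \<and>
    (fst s6 ANS \<noteq> 0 \<longleftrightarrow> fst s5 ANS \<noteq> 0 \<or> acc)"
  proof (cases "fst s5 BAD = 0")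
    case False
    hence "s6 = s5" by (simp add: s6_def step_def)
    thus ?thesis using st5 good_dead[OF CA] bad False by (intro exI[of _ False] exI[of _ "[]"]) auto
  next
    case True
    hence neA: "all_ne A" using bad by blast
    define s7 where "s7 = sem n find_score s5"
    have st7: "stack_inv s7 fs"
      by (rule stack_inv_mono[OF st5]) (auto simp: s7_def find_score_frame)
    have A7: "row_list s7 n = A" using A5 by (simp add: row_list_def s7_def find_score_frame)
    have ans7: "fst s7 ANS = fst s5 ANS" by (simp add: s7_def find_score_frame)
    note sc = find_score_sem[OF r5(2,1), folded s7_def, unfolded A5]
    show ?thesis
    proof (cases "fst s7 FND = 0")
      case False
      define v where "v = fst s7 BV"
      have v: "v < n" "card (A v) \<ge> 2" "score A v \<ge> 4"
        "\<And>w. w < n \<Longrightarrow> card (A w) \<ge> 2 \<Longrightarrow> score A w \<le> score A v"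
        using sc False by (auto simp: v_def)
      have s6: "s6 = sem n (branch_color 2) (sem n (branch_color 1) (sem n (branch_color 0) s7))"
        using True False by (simp add: s6_def step_def s7_def)
      let ?B = "\<lambda>a. if a \<in> A v then [A(v := {a})] else []"
      have c: "0 \<in> {0,1,2::nat}" "1 \<in> {0,1,2::nat}" "2 \<in> {0,1,2::nat}" by auto
      note b0 = branch_color_sem[OF A7 v_def[symmetric] st7 v(1) c(1)]
      note b1 = branch_color_sem[OF b0(2,3,1) v(1) c(2)]
      note b2 = branch_color_sem[OF b1(2,3,1) v(1) c(3)]
      have "stack_inv s6 (((fs @ ?B 0) @ ?B 1) @ ?B 2)" unfolding s6 by (rule b2(1))
      moreover have "((fs @ ?B 0) @ ?B 1) @ ?B 2 =
          fs @ map (\<lambda>a. A(v := {a})) (filter (\<lambda>a. a \<in> A v) [0,1,2])" by simp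
      moreover have "fst s6 ANS = fst s5 ANS"
        unfolding s6 using b0(4) b1(4) b2(4) ans7 by simp
      ultimately show ?thesis using good_branch[OF CA lC neA v]
        by (intro exI[of _ False] exI[of _ "map (\<lambda>a. A(v := {a})) (filter (\<lambda>a. a \<in> A v) [0,1,2])"])
          (simp only: simp_thms)
    next
      case F: True
      have low: "score A w \<le> 3" if "w < n" "card (A w) \<ge> 2" for w using sc F that by auto
      define s8 where "s8 = sem n find_size s7"
      have st8: "stack_inv s8 fs"
        by (rule stack_inv_mono[OF st7]) (auto simp: s8_def find_size_frame)
      have A8: "row_list s8 n = A" using A7 by (simp add: row_list_def s8_def find_size_frame)
      have ans8: "fst s8 ANS = fst s5 ANS" using ans7 by (simp add: s8_def find_size_frame)
      have "fst s7 LR = n" using st7 by (simp add: stack_inv_def)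
      note sz = find_size_sem[OF this, folded s8_def, unfolded A7]
      have s6: "s6 = sem n (CIf FND branch_try (Cst ANS 1)) s8"
        using True F by (simp add: s6_def step_def s7_def s8_def)
      show ?thesis
      proof (cases "fst s8 FND = 0")
        case True
        have "stack_inv s6 fs" by (rule stack_inv_mono[OF st8]) (auto simp: s6 True)
        moreover have "fst s6 ANS \<noteq> 0" by (simp add: s6 True)
        moreover have "good_step C True []" by (rule good_accept[OF CA neA _ lC]) (use sz True in auto)
        ultimately show ?thesis by (intro exI[of _ True] exI[of _ "[]"]) auto
      next
        case False
        have "\<exists>Bs. stack_inv (sem n branch_try s8) (fs @ Bs) \<and> good_step C False Bs \<and>
            fst (sem n branch_try s8) ANS = fst s8 ANS"
          by (rule branch_try_sem[OF st8, unfolded A8]) (use CA lC neA low sz False in auto)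
        then obtain Bs where "stack_inv s6 (fs @ Bs)" "good_step C False Bs" "fst s6 ANS = fst s5 ANS"
          using ans8 False by (auto simp: s6)
        thus ?thesis by (intro exI[of _ False] exI[of _ Bs]) simp
      qed
    qed
  qed
  then obtain acc Bs where res: "stack_inv s6 (fs @ Bs)" "good_step C acc Bs"
    "fst s6 ANS \<noteq> 0 \<longleftrightarrow> fst s5 ANS \<noteq> 0 \<or> acc" by blast
  have "stack_inv s1 (fs @ Bs)" by (rule stack_inv_mono[OF res(1)]) (auto simp: s1)
  moreover have "fst s1 GO = length (fs @ Bs)" using res(1) by (simp add: s1 stack_inv_def)
  moreover have "fst s1 ANS = fst s6 ANS" by (simp add: s1)
  ultimately show ?thesis using res ans5 by (intro exI[of _ acc] exI[of _ Bs]) auto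
qed

end

section \<open>Running time\<close>

text \<open>Only loops multiply, each by a linear factor, so the degree depends on the command
  alone. For two commands the exponents are added, which dominates both.\<close>

lemma cost_poly: "\<exists>a d. \<forall>n. cost n c \<le> a * (n + 1) ^ d"
proof -
  have const: "\<exists>a d. \<forall>n. (k::nat) \<le> a * (n + 1) ^ d" for k
    by (rule exI[of _ k], rule exI[of _ 0]) simp
  show ?thesis
  proof (induction c)
  case (CSeq c e)
  then obtain a1 d1 a2 d2 where *: "\<And>n. cost n c \<le> a1 * (n + 1) ^ d1" "\<And>n. cost n e \<le> a2 * (n + 1) ^ d2" by blast
  have "cost n (c ;; e) \<le> (a1 + a2) * (n + 1) ^ (d1 + d2)" for n
  proof -
    have "(n + 1) ^ d1 \<le> (n + 1) ^ (d1 + d2)" "(n + 1) ^ d2 \<le> (n + 1) ^ (d1 + d2)"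
      by (intro power_increasing; simp)+
    hence "a1 * (n + 1) ^ d1 + a2 * (n + 1) ^ d2 \<le> a1 * (n + 1) ^ (d1 + d2) + a2 * (n + 1) ^ (d1 + d2)"
      by (intro add_mono mult_left_mono) auto
    thus ?thesis using add_mono[OF *(1)[of n] *(2)[of n]] by (simp add: add_mult_distrib)
  qed
  thus ?case by blast
next
  case (CIf x c e)
  then obtain a1 d1 a2 d2 where *: "\<And>n. cost n c \<le> a1 * (n + 1) ^ d1" "\<And>n. cost n e \<le> a2 * (n + 1) ^ d2" by blast
  have "cost n (CIf x c e) \<le> (1 + a1 + a2) * (n + 1) ^ (d1 + d2)" for n
  proof -
    have "(n + 1) ^ d1 \<le> (n + 1) ^ (d1 + d2)" "(n + 1) ^ d2 \<le> (n + 1) ^ (d1 + d2)"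
      by (intro power_increasing; simp)+
    hence "a1 * (n + 1) ^ d1 + a2 * (n + 1) ^ d2 \<le> a1 * (n + 1) ^ (d1 + d2) + a2 * (n + 1) ^ (d1 + d2)"
      by (intro add_mono mult_left_mono) auto
    moreover have "1 \<le> (n + 1) ^ (d1 + d2)" by simp
    moreover have "cost n (CIf x c e) = 1 + (cost n c + cost n e)" by simp
    ultimately show ?thesis using add_mono[OF *(1)[of n] *(2)[of n]] unfolding add_mult_distrib by linarith
  qed
  thus ?case by blast
next
  case (For i c)
  then obtain a d where *: "\<And>n. cost n c \<le> a * (n + 1) ^ d" by blast
  have "cost n (For i c) \<le> (a + 20) * (n + 1) ^ Suc d" for n
  proof -
    have "n * cost n c \<le> (n + 1) * (a * (n + 1) ^ d)" using *[of n] by (intro mult_mono) auto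
    moreover have "(n + 1) * 1 \<le> (n + 1) * (n + 1) ^ d" by (intro mult_left_mono) auto
    ultimately show ?thesis by (simp add: algebra_simps)
  qed
  thus ?case by blast
qed (simp_all only: cost.simps const)
qed

text \<open>With \<open>q\<close> the \<open>m\<close>-th root of \<open>r\<close>, the expression
  is the \<open>m\<close>-th power of \<open>(real n + 1) * q ^ n\<close>, which tends to 0 and
  hence is bounded.\<close>

lemma poly_times_power_bounded:
  assumes "0 < r" "r < (1::real)"
  shows "\<exists>c>0. \<forall>n. (real n + 1) ^ m * r ^ n \<le> c"
proof (cases "m = 0")
  case True
  thus ?thesis using assms by (intro exI[of _ 1]) (auto simp: power_le_one)
next
  case False
  define q where "q = root m r"
  have q: "0 < q" "q < 1" "q ^ m = r"
    using assms False by (simp_all add: q_def)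
  have "(\<lambda>n. real n * q ^ n) \<longlonglongrightarrow> 0" "(\<lambda>n. q ^ n) \<longlonglongrightarrow> 0"
    using q powser_times_n_limit_0[of q] by (auto intro!: LIMSEQ_power_zero)
  from tendsto_add[OF this] have "(\<lambda>n. (real n + 1) * q ^ n) \<longlonglongrightarrow> 0" by (simp add: algebra_simps)
  hence "Bseq (\<lambda>n. (real n + 1) * q ^ n)" using convergent_imp_Bseq convergentI by blast
  then obtain K where K: "K > 0" "\<And>n. norm ((real n + 1) * q ^ n) \<le> K" by (auto elim: BseqE)
  have "(real n + 1) ^ m * r ^ n \<le> K ^ m" for n
  proof -
    have "(real n + 1) ^ m * r ^ n = ((real n + 1) * q ^ n) ^ m"
      unfolding q(3)[symmetric] power_mult_distrib by (simp add: power_mult[symmetric] mult.commute)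
    also have "\<dots> \<le> K ^ m"
      using K(2)[of n] q by (intro power_mono) auto
    finally show ?thesis .
  qed
  thus ?thesis using K(1) by (intro exI[of _ "K ^ m"]) auto
qed

lemma powr_fraction: "x > 0 \<Longrightarrow> x powr (real a / real b) = (x ^ a) powr (1 / real b)"
  by (simp add: powr_powr flip: powr_realpow)

lemma powr_diff_nat: "x > 0 \<Longrightarrow> x powr (real n - b) = x ^ n * x powr (- b)"
  by (simp add: powr_diff powr_minus powr_realpow divide_inverse)

lemma powr_mult_nat: "x > 0 \<Longrightarrow> x powr (c * real n) = (x powr c) ^ n"
  by (simp add: powr_powr flip: powr_realpow)

lemma power_rescale: "b \<noteq> 0 \<Longrightarrow> p ^ n * (a ^ n * q) = (p * a / b) ^ n * (b ^ n * q)" for a b p q :: real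
  by (simp add: power_mult_distrib power_divide)

lemma bits_le_log: "a > 0 \<Longrightarrow> real (bits a) \<le> 1 + log 2 (real a)"
proof -
  assume "a > 0"
  hence "2 ^ floor_log a \<le> a" by (rule floor_log_exp2_le)
  hence "log 2 (real (2 ^ floor_log a)) \<le> log 2 (real a)" using \<open>a > 0\<close>
    by (subst log_le_cancel_iff) (auto simp del: of_nat_power)
  thus ?thesis by (simp add: bits_def log_nat_power)
qed

section \<open>Comparison of the branching bound with the target\<close>

context list_coloring
begin

text \<open>A crude estimate, used only inside a logarithm, where any single exponential
  suffices.\<close>

lemma bound_le_two_power: "bound m \<le> 2 ^ m"
proof -
  have "(1.4656 / 1.26 :: real) ^ min m (2 * n div 7) \<le> (1.4656 / 1.26) ^ m"
    by (intro power_increasing) auto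
  hence "bound m \<le> (1.4656 / 1.26) ^ m * 1.26 ^ m"
    unfolding bound_def by (intro mult_right_mono) auto
  also have "\<dots> = 1.4656 ^ m" by (simp flip: power_mult_distrib)
  also have "\<dots> \<le> 2 ^ m" by (intro power_mono) auto
  finally show ?thesis .
qed

lemma maxdeg_less: "maxdeg < n"
proof -
  have "card (nbrs v) < n" if "v < n" for v
  proof -
    have "nbrs v \<subseteq> {..<n} - {v}" using irrefl by (auto simp: nbrs_def)
    hence "card (nbrs v) \<le> card ({..<n} - {v})" by (intro card_mono) auto
    thus ?thesis using that by simp
  qed
  thus ?thesis unfolding maxdeg_def using n_pos by (subst Max_less_iff) auto
qed

text \<open>With the capped exponent at its maximum, \<open>n\<close> and \<open>maxdeg\<close>
  separate: the former contributes the ratio and the main power, while each unit of the latter takes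
  back a factor 1.26.\<close>

lemma bound_le_target:
  "bound (n - maxdeg - 1) \<le> ((1.4656 / 1.26) powr (2 / 7) * 1.26 / 1.3158) ^ n *
     1.3158 powr (real n - 0.7 * real maxdeg)"
proof -
  let ?m = "n - maxdeg - 1"
  have "bound ?m \<le> (1.4656 / 1.26) ^ (2 * n div 7) * 1.26 ^ ?m"
    unfolding bound_def by (intro mult_right_mono power_increasing) auto
  also have "(1.4656 / 1.26 :: real) ^ (2 * n div 7) = (1.4656 / 1.26) powr real (2 * n div 7)"
    by (subst powr_realpow) auto
  also have "\<dots> \<le> (1.4656 / 1.26) powr (2 / 7 * real n)"
  proof (rule powr_mono)
    have "real (2 * n div 7 * 7) \<le> real (2 * n)" by (rule of_nat_mono) simp
    thus "real (2 * n div 7) \<le> 2 / 7 * real n" by simp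
  qed simp
  also have "(1.26 :: real) ^ ?m = 1.26 powr real ?m" by (subst powr_realpow) auto
  also have "\<dots> \<le> 1.26 powr (real n - real maxdeg)"
    using maxdeg_less by (intro powr_mono) auto
  also have "(1.26 :: real) powr (real n - real maxdeg) = 1.26 powr real n * 1.26 powr (- real maxdeg)"
    by (simp add: powr_add[symmetric])
  \<comment> \<open>In tenth powers this is \<open>1.3158 ^ 7 \<le> 1.26 ^ 10\<close>; here the
    coefficient 0.7 enters.\<close>
  also have "(1.26 :: real) powr (- real maxdeg) \<le> 1.3158 powr (- (0.7 * real maxdeg))"
  proof -
    have "(1.3158 :: real) powr 0.7 = (1.3158 ^ 7) powr (1 / 10)"
      using powr_fraction[of "1.3158" 7 10] by simp
    also have "\<dots> \<le> (1.26 ^ 10) powr (1 / 10)"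
      by (intro powr_mono2) (simp_all add: power_divide)
    also have "\<dots> = 1.26" using powr_fraction[of "1.26" 10 10] by simp
    finally have "(1.3158 powr 0.7) powr real maxdeg \<le> (1.26 :: real) powr real maxdeg"
      by (intro powr_mono2) auto
    hence "(1.3158 :: real) powr (0.7 * real maxdeg) \<le> 1.26 powr real maxdeg" by (simp add: powr_powr)
    thus ?thesis by (simp add: powr_minus le_imp_inverse_le)
  qed
  also have "(1.4656 / 1.26) powr (2 / 7 * real n) * (1.26 powr real n * 1.3158 powr (- (0.7 * real maxdeg)))
     = ((1.4656 / 1.26) powr (2 / 7) * 1.26 / 1.3158) ^ n * 1.3158 powr (real n - 0.7 * real maxdeg)"
  proof -
    have 1: "(1.4656 / 1.26 :: real) powr (2 / 7 * real n) = ((1.4656 / 1.26) powr (2 / 7)) ^ n"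
      by (rule powr_mult_nat) simp
    have 2: "(1.26 :: real) powr real n = 1.26 ^ n" by (subst powr_realpow) auto
    have 3: "(1.3158 :: real) powr (real n - 0.7 * real maxdeg) = 1.3158 ^ n * 1.3158 powr (- (0.7 * real maxdeg))"
      by (rule powr_diff_nat) simp
    show ?thesis unfolding 1 2 3 by (rule power_rescale) simp
  qed
  finally show ?thesis by (simp add: mult_left_mono)
qed

end

text \<open>In seventh powers this is \<open>1.4656 ^ 2 * 1.26 ^ 5 < 1.3158 ^ 7\<close>. The
  strictness makes room for the polynomial factors.\<close>

lemma ratio_less_1: "(1.4656 / 1.26) powr (2 / 7) * 1.26 / 1.3158 < (1::real)"
proof -
  have "(1.4656 / 1.26 :: real) powr (2 / 7) = ((1.4656 / 1.26) ^ 2) powr (1 / 7)"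
    using powr_fraction[of "1.4656 / 1.26" 2 7] by simp
  also have "\<dots> < ((1.3158 / 1.26) ^ 7) powr (1 / 7)"
    by (intro powr_less_mono2) (simp_all add: power_divide)
  also have "\<dots> = 1.3158 / 1.26" using powr_fraction[of "1.3158 / 1.26" 7 7] by simp
  finally show ?thesis by (simp add: field_simps)
qed

section \<open>The complete program and its running time\<close>

lemma init_sem:
  "fst (sem n init s) ONE = 1" "fst (sem n init s) LR = n" "fst (sem n init s) PR = Suc n"
  "fst (sem n init s) BASE = n + 2" "fst (sem n init s) SP = n + 3" "fst (sem n init s) GO = 1"
  "fst (sem n init s) ANS = fst s ANS"
  "snd (sem n init s) = (snd s)(n + 2 := \<lambda>v. if v < n then 7 else snd s (n + 2) v)"
proof -
  define s1 where "s1 = sem n (Cst ONE 1 ;; Len LR ;; Copy PR LR ;; Inc PR ;; Copy BASE PR ;; Inc BASE ;;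
    Copy SP BASE ;; Cst X 7) s"
  have s1: "fst s1 ONE = 1" "fst s1 LR = n" "fst s1 PR = Suc n" "fst s1 BASE = n + 2" "fst s1 SP = n + 2"
    "fst s1 ANS = fst s ANS" "fst s1 X = 7" "snd s1 = snd s"
    by (simp_all add: s1_def)
  define s2 where "s2 = sem n (For V (Put SP V X)) s1"
  have s2: "fst s2 x = fst s1 x" if "x \<noteq> V" for x unfolding s2_def by (rule sem_frame) (simp add: that)
  have "fst s2 SP = n + 2 \<and> snd s2 = (snd s)(n + 2 := \<lambda>v. if v < n then 7 else snd s (n + 2) v)"
    unfolding s2_def
  proof (rule sem_For_rule[where I = "\<lambda>k s'. fst s' SP = n + 2 \<and> fst s' X = 7 \<and>
      snd s' = (snd s)(n + 2 := \<lambda>v. if v < k then 7 else snd s (n + 2) v)"], goal_cases)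
    case (2 k s')
    have "(\<lambda>v. if v < k then 7 else snd s (n + 2) v)(k := 7) = (\<lambda>v. if v < Suc k then 7 else snd s (n + 2) v)"
      by (auto simp: fun_eq_iff)
    thus ?case using 2 by simp
  qed (use s1 in auto)
  moreover have "sem n init s = sem n (Inc SP ;; Cst GO 1) s2"
    by (simp add: init_def s2_def s1_def)
  ultimately show "fst (sem n init s) ONE = 1" "fst (sem n init s) LR = n" "fst (sem n init s) PR = Suc n"
    "fst (sem n init s) BASE = n + 2" "fst (sem n init s) SP = n + 3" "fst (sem n init s) GO = 1"
    "fst (sem n init s) ANS = fst s ANS"
    "snd (sem n init s) = (snd s)(n + 2 := \<lambda>v. if v < n then 7 else snd s (n + 2) v)"
    using s1 s2 by simp_all
qed

text \<open>Contains the only loop with a variable number of rounds. Register 0 keeps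
  \<open>n\<close> until the very end, when the answer overwrites it.\<close>

definition coloring_prog :: prog where
  "coloring_prog = Seq (compile init) (Seq (While (GO + 4) (compile body))
     (Seq (Const 1 0) (Op 0 Plus (ANS + 4) 1)))"

context list_coloring
begin

text \<open>Induction on a bound \<open>k\<close> for the total potential of the stack: an iteration
  lowers it by at least 1, and every entry has at least 1, so the stack is empty after
  \<open>k\<close> iterations. \<open>U\<close> bounds the current values and rises by the cost of
  \<open>body\<close> in each round, while \<open>L\<close> is fixed for the whole run.\<close>

lemma loop_runs:
  assumes "stack_inv s fs" "fst s GO = length fs" "represents n s C" "bounded_by U s" "n \<le> U" "7 \<le> U"
    and "U + k * cost n body \<le> L" "(\<Sum>A\<leftarrow>fs. potential A) \<le> real k"
  shows "runs (While (GO + 4) (compile body)) C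
    (k * ((cost n body + 1) * bits ((L + 1) * (L + 1))) + bits ((L + 1) * (L + 1)))
    (\<lambda>C'. (fst C' (ANS + 4) \<noteq> 0 \<longleftrightarrow> fst s ANS \<noteq> 0 \<or> (\<exists>A\<in>set fs. solvable A)) \<and> fst C' (ANS + 4) \<le> L)"
  using assms
proof (induction k arbitrary: s fs C U)
  case (0 s fs C U)
  have ANS: "fst s ANS \<le> L" using bounded_byD(1)[OF "0.prems"(4), of ANS] "0.prems"(7) by simp
  have C: "fst C (GO + 4) = fst s GO" "fst C (ANS + 4) = fst s ANS"
    using "0.prems"(3) unfolding represents_def by blast+
  have "fs = []"
  proof (rule ccontr)
    assume "fs \<noteq> []"
    then obtain A gs where "fs = A # gs" by (cases fs) auto
    moreover have "0 \<le> (\<Sum>A\<leftarrow>gs. potential A)"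
      by (intro sum_list_nonneg) (use order_trans[OF zero_le_one potential_ge1] in auto)
    ultimately show HOL.False using "0.prems"(8) potential_ge1[of A] by simp
  qed
  thus ?case using "0.prems" bits_mono[of 0 "(L + 1) * (L + 1)"]
    by (intro runs_While_stop) (auto simp: C[simplified] ANS)
next
  case (Suc k s fs C U)
  have ANS: "fst s ANS \<le> L" using bounded_byD(1)[OF Suc.prems(4), of ANS] Suc.prems(7) by simp
  have C: "fst C (GO + 4) = fst s GO" "fst C (ANS + 4) = fst s ANS"
    using Suc.prems(3) unfolding represents_def by blast+
  let ?b = "bits ((L + 1) * (L + 1))"
  show ?case
  proof (cases fs rule: rev_cases)
    case Nil
    thus ?thesis using Suc.prems bits_mono[of 0 "(L + 1) * (L + 1)"]
      by (intro runs_While_stop) (auto simp: C[simplified] ANS)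
  next
    case (snoc gs A)
    obtain acc Bs where B: "stack_inv (sem n body s) (gs @ Bs)" "good_step A acc Bs"
      "fst (sem n body s) ANS \<noteq> 0 \<longleftrightarrow> fst s ANS \<noteq> 0 \<or> acc" "fst (sem n body s) GO = length (gs @ Bs)"
      using body_sem Suc.prems(1) unfolding snoc by blast
    have UL: "U + cost n body \<le> L" using Suc.prems(7) by simp
    have run: "runs (compile body) C (cost n body * ?b) (represents n (sem n body s))"
      by (rule exec_compile[OF wf_body Suc.prems(3-6) UL n_pos])
    have bd: "bounded_by (U + cost n body) (sem n body s)"
      by (rule bounded_by_sem[OF wf_body Suc.prems(4-6)])
    have pot: "(\<Sum>A\<leftarrow>gs @ Bs. potential A) \<le> real k"
      using Suc.prems(8) B(2) by (simp add: snoc good_step_def)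
    have eq: "(fst (sem n body s) ANS \<noteq> 0 \<or> (\<exists>A\<in>set (gs @ Bs). solvable A)) \<longleftrightarrow>
        (fst s ANS \<noteq> 0 \<or> (\<exists>A\<in>set fs. solvable A))"
      using B(2,3) by (auto simp: snoc good_step_def)
    have rest: "runs (While (GO + 4) (compile body)) C' (k * ((cost n body + 1) * ?b) + ?b)
        (\<lambda>C'. (fst C' (ANS + 4) \<noteq> 0 \<longleftrightarrow> fst s ANS \<noteq> 0 \<or> (\<exists>A\<in>set fs. solvable A)) \<and> fst C' (ANS + 4) \<le> L)"
      if "represents n (sem n body s) C'" for C'
      unfolding eq[symmetric]
      by (rule Suc.IH[OF B(1,4) that bd]) (use Suc.prems pot in auto)
    have "runs (compile body) C (cost n body * ?b) (\<lambda>C'. runs (While (GO + 4) (compile body)) C'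
        (k * ((cost n body + 1) * ?b) + ?b)
        (\<lambda>C'. (fst C' (ANS + 4) \<noteq> 0 \<longleftrightarrow> fst s ANS \<noteq> 0 \<or> (\<exists>A\<in>set fs. solvable A)) \<and> fst C' (ANS + 4) \<le> L))"
      by (rule runs_weaken[OF run order_refl rest])
    moreover have go: "fst C (GO + 4) = length fs" using Suc.prems C by simp
    ultimately have "runs (While (GO + 4) (compile body)) C
        (bits (fst C (GO + 4)) + cost n body * ?b + (k * ((cost n body + 1) * ?b) + ?b))
        (\<lambda>C'. (fst C' (ANS + 4) \<noteq> 0 \<longleftrightarrow> fst s ANS \<noteq> 0 \<or> (\<exists>A\<in>set fs. solvable A)) \<and> fst C' (ANS + 4) \<le> L)"
      by (intro runs_While_step) (auto simp: snoc)
    moreover have "bits (fst C (GO + 4)) \<le> ?b"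
    proof (rule bits_mono)
      have "length fs \<le> U" using Suc.prems(2,4) unfolding bounded_by_def by metis
      also have "U \<le> (L + 1) * (L + 1)" using UL by (simp add: trans_le_add1)
      finally show "fst C (GO + 4) \<le> (L + 1) * (L + 1)" unfolding go .
    qed
    ultimately show ?thesis by (elim runs_le) (simp add: add_mult_distrib)
  qed
qed

lemma prog_runs:
  assumes s: "represents n ((\<lambda>_. 0), M) C" and M: "adj_ok M" "\<And>r v. M r v \<le> 1"
    and k: "potential (\<lambda>_. {0,1,2}) \<le> real k"
    and L: "L = n + 7 + cost n init + k * cost n body"
  shows "runs coloring_prog C ((cost n init + k * (cost n body + 1) + 4) * bits ((L + 1) * (L + 1)))
    (\<lambda>C'. accepting C' \<longleftrightarrow> solvable (\<lambda>_. {0,1,2}))"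
proof -
  let ?b = "bits ((L + 1) * (L + 1))"
  let ?start = "((\<lambda>_. 0), M) :: cstate"
  let ?s = "sem n init ?start"
  let ?full = "\<lambda>_. {0,1,2} :: nat set"
  have bd0: "bounded_by (n + 7) ?start" 
  proof -
    have "M r v \<le> n + 7" for r v using M(2)[of r v] by linarith
    thus ?thesis by (simp add: bounded_by_def)
  qed
  have bd: "bounded_by (n + 7 + cost n init) ?s"
    by (rule bounded_by_sem[OF wf_init bd0]) auto
  have r0: "runs (compile init) C (cost n init * ?b) (represents n ?s)"
    by (rule exec_compile[OF wf_init s bd0]) (use L n_pos in auto)
  have dec7: "dec 7 = {0,1,2}" using dec_enc[of "{0,1,2}"] by (simp add: enc_def)
  have "adj_ok (snd ?s)" unfolding init_sem by (rule adj_ok_upd) (use M in auto)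
  hence st: "stack_inv ?s [?full]"
    using dec7 by (simp add: stack_inv_def init_sem init_sem[simplified])
  have loop: "runs (While (GO + 4) (compile body)) C1 (k * ((cost n body + 1) * ?b) + ?b)
      (\<lambda>C'. (fst C' (ANS + 4) \<noteq> 0 \<longleftrightarrow> solvable ?full) \<and> fst C' (ANS + 4) \<le> L)"
    if "represents n ?s C1" for C1
    using loop_runs[OF st _ that bd, of k L] k L by (simp add: init_sem)
  have fin: "runs (Seq (Const 1 0) (Op 0 Plus (ANS + 4) 1)) C2 (?b + (?b + ?b))
     (\<lambda>C'. accepting C' \<longleftrightarrow> solvable ?full)"
    if "(fst C2 (ANS + 4) \<noteq> 0 \<longleftrightarrow> solvable ?full) \<and> fst C2 (ANS + 4) \<le> L" for C2
  proof -
    have "bits (fst C2 (ANS + 4)) \<le> ?b" "bits 0 \<le> ?b"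
      using that by (auto intro!: bits_mono simp: trans_le_add1)
    thus ?thesis
      using that by (intro runs_Seq runs_Const runs_Op) (auto simp: accepting_def)
  qed
  have "runs coloring_prog C (cost n init * ?b + ((k * ((cost n body + 1) * ?b) + ?b) + (?b + (?b + ?b))))
     (\<lambda>C'. accepting C' \<longleftrightarrow> solvable ?full)"
    unfolding coloring_prog_def
    by (rule runs_Seq, rule runs_weaken[OF r0 order_refl], rule runs_Seq,
        rule runs_weaken[OF loop order_refl], assumption, rule fin)
  thus ?thesis by (rule runs_le) (simp add: algebra_simps)
qed

lemma potential_full: "potential (\<lambda>_. {0,1,2}) = 3 * (3 * real n + 1) * bound (n - maxdeg - 1)"
  by (simp add: potential_def weight_def size_sum_def)

text \<open>The number of iterations is the branching bound times \<open>O(n)\<close>, each costs a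
  polynomial number of operations, and the operands have polynomially many bits because
  \<open>L\<close> is at most a polynomial times \<open>2 ^ n\<close>.\<close>

lemma running_time:
  assumes k: "real k \<le> potential (\<lambda>_. {0,1,2}) + 1" "k \<ge> 1"
    and cost: "cost n init + cost n body \<le> a * (n + 1) ^ d"
    and L: "L = n + 7 + cost n init + k * cost n body"
  shows "real ((cost n init + k * (cost n body + 1) + 4) * bits ((L + 1) * (L + 1)))
    \<le> 10000 * (real a + 1) ^ 2 * (real n + 1) ^ (2 * d + 4) * bound (n - maxdeg - 1)"
proof -
  define N \<beta> q where "N = real n + 1" and "\<beta> = bound (n - maxdeg - 1)" and "q = (real a + 1) * N ^ d"
  have N: "N \<ge> 1" and \<beta>: "\<beta> \<ge> 1" using bound_ge1 by (auto simp: N_def \<beta>_def)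
  have Nd: "N ^ d \<ge> 1" using N by (rule one_le_power)
  have q1: "1 \<le> q" using Nd mult_mono[of 1 "real a + 1" 1 "N ^ d"] by (simp add: q_def)
  have "real (cost n init + cost n body) \<le> real (a * (n + 1) ^ d)" using cost by (rule of_nat_mono)
  also have "\<dots> = real a * N ^ d" by (simp add: N_def add.commute)
  also have "\<dots> \<le> q" using Nd by (simp add: q_def algebra_simps)
  finally have c: "real (cost n init) + real (cost n body) \<le> q" by simp
  have kb: "real k \<le> 10 * N * \<beta>"
  proof -
    have "1 * 1 \<le> N * \<beta>" using N \<beta> by (intro mult_mono) auto
    thus ?thesis using k(1) \<beta> unfolding potential_full N_def \<beta>_def[symmetric] by (simp add: algebra_simps)
  qed
  have k1: "1 \<le> real k" using k(2) by simp
  have kq: "real k * real (cost n body) \<le> real k * q" using c by (intro mult_left_mono) auto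
  have kq1: "q \<le> real k * q" "real k \<le> real k * q" "1 \<le> real k * q"
    using mult_mono[of 1 "real k" q q] mult_mono[of "real k" "real k" 1 q] mult_mono[of 1 "real k" 1 q] q1 k1 by auto
  \<comment> \<open>One \<open>k * q\<close> each for \<open>init\<close>, for all runs of
    \<open>body\<close> and for the loop tests, and four for the summand 4.\<close>
  have steps: "real (cost n init + k * (cost n body + 1) + 4) \<le> 7 * (real k * q)"
    using c kq kq1 by (simp add: algebra_simps)
  have "real k * q \<le> 10 * N * \<beta> * q" using kb q1 by (intro mult_right_mono) auto
  hence kqb: "real k * q \<le> 10 * (N * q) * \<beta>" by (simp add: mult_ac)
  have Nq: "N \<le> N * q" "1 \<le> N * q"
    using mult_mono[of N N 1 q] mult_mono[of 1 N 1 q] q1 N by auto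
  have Lb: "real (L + 1) \<le> 28 * (N * q) * 2 ^ n"
  proof -
    have "\<beta> \<le> 2 ^ (n - maxdeg - 1)" unfolding \<beta>_def by (rule bound_le_two_power)
    also have "\<dots> \<le> 2 ^ n" by (intro power_increasing) auto
    finally have b2: "\<beta> \<le> 2 ^ n" .
    have "real (L + 1) \<le> 8 * N + q + real k * q" using c kq unfolding L N_def by simp
    also have "\<dots> \<le> 8 * (N * q) + 2 * (10 * (N * q) * \<beta>)" using kq1 kqb Nq by linarith
    also have "\<dots> \<le> 8 * (N * q) * \<beta> + 20 * (N * q) * \<beta>"
      using mult_left_mono[OF \<beta>, of "8 * (N * q)"] Nq by (simp add: mult_ac)
    also have "\<dots> = 28 * (N * q) * \<beta>" by simp
    also have "\<dots> \<le> 28 * (N * q) * 2 ^ n" using b2 Nq by (intro mult_left_mono) auto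
    finally show ?thesis .
  qed
  have "log 2 (real (L + 1)) \<le> log 2 (28 * (N * q) * 2 ^ n)"
    using Lb Nq by (subst log_le_cancel_iff) auto
  also have "\<dots> = log 2 (28 * (N * q)) + real n"
    using Nq by (subst log_mult) (auto simp: log_nat_power)
  also have "log 2 (28 * (N * q)) \<le> 2 * (28 * (N * q))"
  proof -
    have "log 2 x \<le> 2 * x" if "x \<ge> 1" for x :: real
    proof -
      have "ln x \<le> x" using that ln_le_minus_one[of x] by linarith
      moreover have "(1/2 :: real) \<le> ln 2" using ln_le_minus_one[of "1/2 :: real"] by (simp add: ln_div)
      moreover have "x * (1/2) \<le> x * ln 2" using that calculation by (intro mult_left_mono) auto
      ultimately have "ln x \<le> 2 * x * ln 2" by linarith
      thus ?thesis by (simp add: log_def divide_simps)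
    qed
    from this[of "28 * (N * q)"] show ?thesis using Nq by simp
  qed
  finally have "log 2 (real (L + 1)) \<le> 2 * (28 * (N * q)) + real n" by simp
  moreover have "real n \<le> N" by (simp add: N_def)
  \<comment> \<open>\<open>57 = 2 * 28 + 1\<close>; squaring \<open>L + 1\<close> and the additive 1
    of the bit length then give \<open>115 = 2 * 57 + 1\<close>.\<close>
  ultimately have "log 2 (real (L + 1)) \<le> 57 * (N * q)" using Nq by linarith
  moreover have "real (bits ((L + 1) * (L + 1))) \<le> 1 + log 2 (real ((L + 1) * (L + 1)))"
    by (rule bits_le_log) simp
  moreover have "log 2 (real ((L + 1) * (L + 1))) = 2 * log 2 (real (L + 1))"
    by (simp only: of_nat_mult) (subst log_mult, auto)
  ultimately have bits: "real (bits ((L + 1) * (L + 1))) \<le> 115 * (N * q)" using Nq by linarith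
  have "real ((cost n init + k * (cost n body + 1) + 4) * bits ((L + 1) * (L + 1)))
      \<le> 7 * (10 * (N * q) * \<beta>) * (115 * (N * q))"
    unfolding of_nat_mult
  proof (rule mult_mono)
    show "real (cost n init + k * (cost n body + 1) + 4) \<le> 7 * (10 * (N * q) * \<beta>)"
      using steps kqb by linarith
    show "0 \<le> 7 * (10 * (N * q) * \<beta>)" using N q1 \<beta> by (intro mult_nonneg_nonneg) auto
  qed (use bits in auto)
  also have "\<dots> = 8050 * (N * q) ^ 2 * \<beta>" by (simp add: power2_eq_square)
  also have "\<dots> \<le> 10000 * (N * q) ^ 2 * \<beta>" using \<beta> by (intro mult_right_mono) auto
  also have "(N * q) ^ 2 = (real a + 1) ^ 2 * N ^ (2 * d + 2)"
    unfolding power_add[of N "2 * d"] power_even_eq by (simp only: q_def power_mult_distrib mult_ac)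
  also have "10000 * ((real a + 1) ^ 2 * N ^ (2 * d + 2)) * \<beta> \<le> 10000 * ((real a + 1) ^ 2 * N ^ (2 * d + 4)) * \<beta>"
    using N \<beta> by (intro mult_right_mono mult_left_mono power_increasing) auto
  finally show ?thesis by (simp only: N_def \<beta>_def mult.assoc)
qed

end

section \<open>From graphs to list colorings\<close>

definition adjacent :: "'a pair_pre_digraph \<Rightarrow> 'a list \<Rightarrow> nat \<Rightarrow> nat \<Rightarrow> bool" where
  "adjacent G vs v w \<longleftrightarrow> v < length vs \<and> w < length vs \<and> (vs ! v, vs ! w) \<in> parcs G"

text \<open>Positions in \<open>vs\<close> number the vertices bijectively, and out-arcs of a vertex
  correspond to its neighbors. The index bounds in \<open>adjacent\<close> make symmetry and
  irreflexivity hold for all naturals, since \<open>!\<close> is unspecified beyond the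
  list.\<close>

lemma list_coloring_graph:
  assumes G: "pair_graph G" "pverts G \<noteq> {}" "min_degree G \<ge> 8" and vs: "distinct vs" "set vs = pverts G"
  defines "n \<equiv> length vs" and "E \<equiv> adjacent G vs"
  shows "list_coloring n E" "list_coloring.maxdeg n E = max_degree G"
    "list_coloring.solvable n E (\<lambda>_. {0,1,2}) \<longleftrightarrow> three_colorable G"
proof -
  interpret G: pair_graph G by fact
  have inj: "inj_on ((!) vs) {..<n}" using vs(1) by (auto simp: n_def inj_on_def nth_eq_iff_index_eq)
  have img: "(!) vs ` {..<n} = pverts G" using vs(2) by (auto simp: n_def set_conv_nth)
  have deg: "card {w. w < n \<and> E v w} = out_degree (with_proj G) (vs ! v)" if "v < n" for v
  proof -
    have "out_arcs (with_proj G) (vs ! v) = (\<lambda>w. (vs ! v, vs ! w)) ` {w. w < n \<and> E v w}"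
    proof
      show "out_arcs (with_proj G) (vs ! v) \<subseteq> (\<lambda>w. (vs ! v, vs ! w)) ` {w. w < n \<and> E v w}"
      proof
        fix e assume "e \<in> out_arcs (with_proj G) (vs ! v)"
        hence e: "e \<in> parcs G" "fst e = vs ! v" by auto
        hence "snd e \<in> pverts G" using G.in_arcsD2 by (metis prod.collapse)
        then obtain w where "w < n" "snd e = vs ! w" using img by auto
        moreover have "(vs ! v, vs ! w) \<in> parcs G" using e calculation by (metis prod.collapse)
        ultimately show "e \<in> (\<lambda>w. (vs ! v, vs ! w)) ` {w. w < n \<and> E v w}"
          using e that by (intro image_eqI[of _ _ w]) (auto simp: E_def adjacent_def n_def prod_eq_iff)
      qed
    qed (auto simp: E_def adjacent_def)
    moreover have "inj_on (\<lambda>w. (vs ! v, vs ! w)) {w. w < n \<and> E v w}"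
      using inj by (auto simp: inj_on_def)
    ultimately show ?thesis by (simp add: out_degree_def card_image)
  qed
  have n0: "n > 0" using G(2) vs(2) by (auto simp: n_def)
  have fin: "finite (pverts G)" by simp
  show lc: "list_coloring n E"
  proof
    show "E w v" if "E v w" for v w
      using that G.arcs_symmetric by (auto simp: E_def adjacent_def)
    show "\<not> E v v" for v using G.no_loops' by (auto simp: E_def adjacent_def)
    show "8 \<le> card {w. w < n \<and> E v w}" if "v < n" for v
    proof -
      have "vs ! v \<in> pverts G" using img that by auto
      hence "min_degree G \<le> out_degree (with_proj G) (vs ! v)"
        unfolding min_degree_def using fin by (intro Min_le) auto
      thus ?thesis using deg[OF that] G(3) by simp
    qed
  qed (rule n0)
  interpret lc: list_coloring n E by fact
  have "(\<lambda>v. card (lc.nbrs v)) ` {..<n} = (\<lambda>v. out_degree (with_proj G) (vs ! v)) ` {..<n}"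
    using deg by (auto simp: lc.nbrs_def)
  also have "\<dots> = out_degree (with_proj G) ` pverts G" using img by (metis image_image)
  finally show "lc.maxdeg = max_degree G" by (simp add: lc.maxdeg_def max_degree_def)
  show "lc.solvable (\<lambda>_. {0,1,2}) \<longleftrightarrow> three_colorable G"
  proof
    assume "lc.solvable (\<lambda>_. {0,1,2})"
    then obtain c where sc: "lc.sol (\<lambda>_. {0,1,2}) c" by (auto simp: lc.solvable_def)
    have c: "c v \<in> {0,1,2}" if "v < n" for v using sc that by (simp add: lc.sol_def)
    have ce: "c v \<noteq> c w" if "v < n" "w < n" "E v w" for v w using sc that by (simp add: lc.sol_def)
    define ix where "ix = inv_into {..<n} ((!) vs)"
    have ix: "ix u < n" "vs ! ix u = u" if "u \<in> pverts G" for u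
      using that img inv_into_into[of u "(!) vs" "{..<n}"] f_inv_into_f[of u "(!) vs" "{..<n}"] by (auto simp: ix_def)
    have "c (ix u) \<noteq> c (ix w)" if "(u, w) \<in> parcs G" for u w
    proof -
      have uw: "u \<in> pverts G" "w \<in> pverts G" using that G.in_arcsD1 G.in_arcsD2 by blast+
      hence "E (ix u) (ix w)" using ix[OF uw(1)] ix[OF uw(2)] that by (simp add: E_def adjacent_def n_def)
      thus ?thesis using ix(1)[OF uw(1)] ix(1)[OF uw(2)] by (rule ce[rotated 2])
    qed
    thus "three_colorable G" unfolding three_colorable_def
      using c ix(1) by (intro exI[of _ "\<lambda>u. c (ix u)"]) blast
  next
    assume "three_colorable G"
    then obtain c where c: "\<forall>v\<in>pverts G. c v \<in> {0,1,2::nat}" "\<forall>(u, v)\<in>parcs G. c u \<noteq> c v"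
      unfolding three_colorable_def by blast
    have "lc.sol (\<lambda>_. {0,1,2}) (\<lambda>v. c (vs ! v))"
      unfolding lc.sol_def
    proof (intro conjI allI impI)
      show "c (vs ! v) \<in> {0,1,2}" if "v < n" for v using c(1) img that by blast
      show "c (vs ! v) \<noteq> c (vs ! w)" if "E v w" for v w using c(2) that by (auto simp: E_def adjacent_def)
    qed
    thus "lc.solvable (\<lambda>_. {0,1,2})" by (auto simp: lc.solvable_def)
  qed
qed

text \<open>The constant combines the coefficient of the cost polynomial with the bound for the
  polynomial times the geometric factor, and neither depends on the graph.\<close>

theorem theorem1:
  "\<exists>(P :: prog) (C :: real).
     \<forall>(G :: nat pair_pre_digraph) (vs :: nat list).
       pair_graph G \<and> pverts G \<noteq> {} \<and> min_degree G \<ge> 8 \<and> distinct vs \<and> set vs = pverts G \<longrightarrow>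
       (\<exists>t s'. exec P (graph_input G vs) t s' \<and>
          (accepting s' \<longleftrightarrow> three_colorable G) \<and>
          real t \<le> C * 1.3158 powr (real (card (pverts G)) - 0.7 * real (max_degree G)))"
proof -
  \<comment> \<open>A single polynomial for the sequence covers \<open>init\<close> and
    \<open>body\<close> together.\<close>
  obtain a d where ad: "\<And>n. cost n (init ;; body) \<le> a * (n + 1) ^ d" using cost_poly by blast
  let ?r = "(1.4656 / 1.26) powr (2 / 7) * 1.26 / 1.3158 :: real"
  obtain c where c: "c > 0" "\<And>n. (real n + 1) ^ (2 * d + 4) * ?r ^ n \<le> c"
    using poly_times_power_bounded[OF _ ratio_less_1, of "2 * d + 4"] by auto
  show ?thesis
  proof (rule exI[of _ coloring_prog], rule exI[of _ "10000 * (real a + 1) ^ 2 * c"], intro allI impI, elim conjE)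
    fix G :: "nat pair_pre_digraph" and vs :: "nat list"
    assume G: "pair_graph G" "pverts G \<noteq> {}" "8 \<le> min_degree G" and vs: "distinct vs" "set vs = pverts G"
    define n where "n = length vs"
    note lcg = list_coloring_graph[OF G vs, folded n_def]
    interpret list_coloring n "adjacent G vs" by (rule lcg(1))
    have cardG: "card (pverts G) = n" using vs distinct_card by (metis n_def)
    define M where "M = (\<lambda>r v. if adjacent G vs r v then 1 else 0 :: nat)"
    define k where "k = nat \<lceil>potential (\<lambda>_. {0,1,2})\<rceil>"
    define L where "L = n + 7 + cost n init + k * cost n body"
    have k: "potential (\<lambda>_. {0,1,2}) \<le> real k" "real k \<le> potential (\<lambda>_. {0,1,2}) + 1" "k \<ge> 1"
      using potential_ge1[of "\<lambda>_. {0,1,2}"] unfolding k_def by linarith+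
    have rep: "represents n ((\<lambda>_. 0), M) (graph_input G vs)"
    proof -
      \<comment> \<open>The cutoff \<open>a < n * n\<close> of the input means exactly that the row
        is below \<open>n\<close>, so all further rows are zero on both sides.\<close>
      have "r * n + v < n * n \<longleftrightarrow> r < n" if "v < n" for r v
      proof
        assume "r < n"
        hence "Suc r * n \<le> n * n" by (intro mult_le_mono1) simp
        thus "r * n + v < n * n" using that by simp
      next
        assume "r * n + v < n * n"
        hence "r * n < n * n" by linarith
        thus "r < n" by simp
      qed
      moreover have "(r * n + v) div n = r" if "v < n" for r v using that by simp
      ultimately show ?thesis by (auto simp: represents_def graph_input_def Let_def M_def adjacent_def n_def)
    qed
    have "runs coloring_prog (graph_input G vs)
       ((cost n init + k * (cost n body + 1) + 4) * bits ((L + 1) * (L + 1)))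
       (\<lambda>C'. accepting C' \<longleftrightarrow> solvable (\<lambda>_. {0,1,2}))"
      by (rule prog_runs[OF rep _ _ k(1) L_def]) (auto simp: adj_ok_def M_def)
    then obtain t s' where t: "exec coloring_prog (graph_input G vs) t s'"
      "t \<le> (cost n init + k * (cost n body + 1) + 4) * bits ((L + 1) * (L + 1))"
      "accepting s' \<longleftrightarrow> solvable (\<lambda>_. {0,1,2})" unfolding runs_def by blast
    have "real t \<le> 10000 * (real a + 1) ^ 2 * (real n + 1) ^ (2 * d + 4) * bound (n - maxdeg - 1)"
      using running_time[OF k(2,3) _ L_def, of a d] ad[of n] t(2)
      by (simp only: cost.simps) (meson of_nat_mono order_trans)
    also have "\<dots> \<le> 10000 * (real a + 1) ^ 2 * (real n + 1) ^ (2 * d + 4) *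
        (?r ^ n * 1.3158 powr (real n - 0.7 * real maxdeg))"
      by (intro mult_left_mono bound_le_target) auto
    \<comment> \<open>Regrouped so that \<open>?r ^ n\<close> stands next to the polynomial that it
      absorbs.\<close>
    also have "\<dots> = 10000 * (real a + 1) ^ 2 * ((real n + 1) ^ (2 * d + 4) * ?r ^ n) *
        1.3158 powr (real n - 0.7 * real maxdeg)" by (simp only: mult_ac)
    also have "\<dots> \<le> 10000 * (real a + 1) ^ 2 * c * 1.3158 powr (real n - 0.7 * real maxdeg)"
      by (intro mult_right_mono mult_left_mono c) auto
    finally show "\<exists>t s'. exec coloring_prog (graph_input G vs) t s' \<and> (accepting s' \<longleftrightarrow> three_colorable G) \<and>
        real t \<le> 10000 * (real a + 1) ^ 2 * c * 1.3158 powr (real (card (pverts G)) - 0.7 * real (max_degree G))"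
      using t lcg(2,3) cardG by (intro exI[of _ t] exI[of _ s']) simp
  qed
qed

end
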